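(* Let $X$ be a symmetric transient Borel right process with state space $\mathbb N$ and strictly positive potential density $U=\{U_{j,k}\}_{j,k\in\mathbb N}$, and assume furthermore that $X$ is a uniform Markov chain. Let $f=\{f_k\}_{k\in\mathbb N}$ be a finite excessive function for $X$, let $\alpha>0$, and let $\widetilde X_\alpha=\{\widetilde X_{\alpha,j}\}_{j\in\mathbb N}$ be an $\alpha$-permanental sequence with kernel $\widetilde U_{j,k}=U_{j,k}+f_k$, $j,k\in\mathbb N$. If the row sums of the $Q$-matrix of $X$ are bounded away from $0$, and $f\in c_0^+$, then $$\limsup_{n\to\infty}\frac{\widetilde X_{\alpha,n}}{U_{n,n}\log n}=1\quad\text{a.s.}$$ Furthermore, when (the row sums of the $Q$-matrix are bounded away from $0$ and) the $Q$-matrix is a $(2k+1)$-diagonal matrix for some $k\ge 1$, the conditions "$f\in c_0^+$" and "$f=Uh$ for some $h\in c_0^+$" are equivalent.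
   Context: $\mathbb N=\{1,2,\dots\}$; $c_0^+$ is the set of non-negative sequences converging to $0$; $(Uh)_j=\sum_kU_{j,k}h_k$. Permanental sequences: for $\alpha>0$ and a matrix $K=\{K_{j,k}\}_{j,k\in\mathbb N}$, an $\alpha$-permanental sequence with kernel $K$ is a sequence $\{Z_j\}_{j\in\mathbb N}$ of non-negative random variables such that for all $n$, all distinct $i_1,\dots,i_n\in\mathbb N$ and all $s_1,\dots,s_n>0$, $E\exp(-\sum_{m=1}^n s_mZ_{i_m})=\det(I+K'S)^{-\alpha}$, where $K'=\{K_{i_p,i_q}\}_{p,q=1}^n$ and $S=\mathrm{diag}(s_1,\dots,s_n)$. Processes: a Borel right process $X$ on the countable discrete space $\mathbb N$ is a continuous-time right-continuous strong Markov process (possibly sent to a cemetery state at a finite lifetime) with transition functions $p_t(j,k)$ and semigroup $P_t$. Its potential density (with respect to counting measure) is $U_{j,k}=\int_0^\infty p_t(j,k)\,dt$; $X$ is transient if these are finite and symmetric if $p_t(j,k)=p_t(k,j)$. A non-negative function $f$ on $\mathbb N$ is excessive for $X$ if $P_tf(j)\uparrow f(j)$ as $t\downarrow 0$ for all $j$. It is a known fact that for such $X$ and finite excessive $f$, $\{U_{j,k}+f_k\}$ is the kernel of an $\alpha$-permanental sequence for every $\alpha>0$. $Q$-matrix: the $Q$-matrix of $X$ is its matrix of infinitesimal rates ($Q_{j,k}\ge 0$ for $j\ne k$, row sums $\le 0$, the negative of the row sum being the killing rate). $X$ is a uniform Markov chain if $\|Q\|=\sup_j\sum_k|Q_{j,k}|<\infty$.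 The row sums are bounded away from $0$ if there is $\delta>0$ with $\sum_kQ_{j,k}\le-\delta$ for all $j$. $Q$ is $(2k+1)$-diagonal if $Q_{i,j}=0$ for all $|j-i|>k$. *)

theory Defs
  imports "HOL-Probability.Probability" "Jordan_Normal_Form.Determinant"
begin

text \<open>
  The index set of the mathematics is the set of positive integers.  It is represented by
  the type \<open>nat\<close>, with \<open>n :: nat\<close> standing for the positive integer \<open>n + 1\<close>; so the
  logarithm of the index of \<open>n\<close> is \<open>ln (real (Suc n))\<close>.
\<close>

section \<open>Borel right processes on a countable discrete space\<close>

text \<open>
  \<open>law X j\<close> is the probability of the process started at \<open>j\<close>; all of these live on the measurable
  space of \<open>base X\<close> (whose measure is irrelevant).  \<open>state X t w\<close>, used only for \<open>t \<ge> 0\<close>, is the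
  position at time \<open>t\<close>, where \<open>None\<close> is the cemetery.
\<close>

record 'w process =
  base :: "'w measure"
  law :: "nat \<Rightarrow> 'w measure"
  state :: "real \<Rightarrow> 'w \<Rightarrow> nat option"

definition transition :: "'w process \<Rightarrow> real \<Rightarrow> nat \<Rightarrow> nat \<Rightarrow> real" where
  "transition X t j k = measure (law X j) {\<omega> \<in> space (base X). state X t \<omega> = Some k}"

definition past :: "'w process \<Rightarrow> real \<Rightarrow> 'w set set" where
  "past X t = sigma_sets (space (base X))
     {state X s -` B \<inter> space (base X) | s B. 0 \<le> s \<and> s \<le> t}"

text \<open>
  Stopping times of the right-continuous filtration \<open>\<F>\<^bsub>t+\<^esub>\<close>, and the events prior to them, are
  described by strict inequalities with respect to the natural filtration \<open>past X\<close>.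
\<close>

definition optional_time :: "'w process \<Rightarrow> ('w \<Rightarrow> ennreal) \<Rightarrow> bool" where
  "optional_time X T \<longleftrightarrow>
     (\<forall>t>0. {\<omega> \<in> space (base X). T \<omega> < ennreal t} \<in> past X t)"

definition past_at :: "'w process \<Rightarrow> ('w \<Rightarrow> ennreal) \<Rightarrow> 'w set set" where
  "past_at X T = {A. A \<subseteq> space (base X) \<and>
     (\<forall>t>0. {\<omega> \<in> A. T \<omega> < ennreal t} \<in> past X t)}"

text \<open>
  The strong Markov property
  \<open>P\<^sup>j (X\<^bsub>T+t\<^esub> = k | \<F>\<^bsub>T+\<^esub>) = p\<^sub>t (X\<^sub>T, k)\<close> on \<open>{T < \<infinity>}\<close>, integrated over \<open>A \<inter> {X\<^sub>T = i}\<close>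
  for an arbitrary event \<open>A\<close> prior to \<open>T\<close>.  The part on \<open>{X\<^sub>T = None}\<close> is the absorption at
  the cemetery.
\<close>

definition strong_markov :: "'w process \<Rightarrow> bool" where
  "strong_markov X \<longleftrightarrow>
     (\<forall>T A j i k t. optional_time X T \<longrightarrow> A \<in> past_at X T \<longrightarrow> 0 \<le> t \<longrightarrow>
        measure (law X j) {\<omega> \<in> A. T \<omega> < \<infinity> \<and> state X (enn2real (T \<omega>)) \<omega> = Some i \<and>
                                  state X (enn2real (T \<omega>) + t) \<omega> = Some k}
        = measure (law X j) {\<omega> \<in> A. T \<omega> < \<infinity> \<and> state X (enn2real (T \<omega>)) \<omega> = Some i}
          * transition X t i k)"

definition borel_right_process :: "'w process \<Rightarrow> bool" where
  "borel_right_process X \<longleftrightarrow>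
     (\<forall>j. prob_space (law X j) \<and> sets (law X j) = sets (base X)) \<and>
     (\<forall>t\<ge>0. state X t \<in> base X \<rightarrow>\<^sub>M count_space UNIV) \<and>
     (\<forall>j. AE \<omega> in law X j. state X 0 \<omega> = Some j) \<and>
     (\<forall>\<omega>\<in>space (base X). \<forall>t\<ge>0.
        limitin (discrete_topology UNIV) (\<lambda>s. state X s \<omega>) (state X t \<omega>) (at_right t)) \<and>
     (\<forall>\<omega>\<in>space (base X). \<forall>s t. 0 \<le> s \<longrightarrow> s \<le> t \<longrightarrow> state X s \<omega> = None \<longrightarrow> state X t \<omega> = None) \<and>
     strong_markov X"

definition symmetric_process :: "'w process \<Rightarrow> bool" where
  "symmetric_process X \<longleftrightarrow> (\<forall>t\<ge>0. \<forall>j k. transition X t j k = transition X t k j)"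

definition potential :: "'w process \<Rightarrow> nat \<Rightarrow> nat \<Rightarrow> ennreal" where
  "potential X j k = (\<integral>\<^sup>+ t\<in>{0..}. ennreal (transition X t j k) \<partial>lborel)"

definition transient :: "'w process \<Rightarrow> bool" where
  "transient X \<longleftrightarrow> (\<forall>j k. potential X j k < \<infinity>)"

definition potential_density :: "'w process \<Rightarrow> nat \<Rightarrow> nat \<Rightarrow> real" where
  "potential_density X j k = enn2real (potential X j k)"

definition semigroup_op :: "'w process \<Rightarrow> real \<Rightarrow> (nat \<Rightarrow> ennreal) \<Rightarrow> nat \<Rightarrow> ennreal" where
  "semigroup_op X t f j = (\<Sum>k. ennreal (transition X t j k) * f k)"

definition excessive :: "'w process \<Rightarrow> (nat \<Rightarrow> ennreal) \<Rightarrow> bool" where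
  "excessive X f \<longleftrightarrow>
     (\<forall>j. antimono_on {0<..} (\<lambda>t. semigroup_op X t f j) \<and>
          ((\<lambda>t. semigroup_op X t f j) \<longlongrightarrow> f j) (at_right 0))"

section \<open>Q-matrices\<close>

definition is_Q_matrix :: "'w process \<Rightarrow> (nat \<Rightarrow> nat \<Rightarrow> real) \<Rightarrow> bool" where
  "is_Q_matrix X Q \<longleftrightarrow>
     (\<forall>j k. ((\<lambda>t. transition X t j k) has_real_derivative Q j k) (at 0 within {0..}))"

definition matrix_sup_norm :: "(nat \<Rightarrow> nat \<Rightarrow> real) \<Rightarrow> ennreal" where
  "matrix_sup_norm Q = (SUP j. \<Sum>k. ennreal \<bar>Q j k\<bar>)"

definition uniform_markov_chain :: "'w process \<Rightarrow> bool" where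
  "uniform_markov_chain X \<longleftrightarrow> (\<exists>Q. is_Q_matrix X Q \<and> matrix_sup_norm Q < \<infinity>)"

definition row_sums_bounded_away :: "(nat \<Rightarrow> nat \<Rightarrow> real) \<Rightarrow> bool" where
  "row_sums_bounded_away Q \<longleftrightarrow>
     (\<exists>\<delta>>0. \<forall>j. summable (Q j) \<and> (\<Sum>k. Q j k) \<le> - \<delta>)"

text \<open>\<open>multidiagonal k Q\<close>: the matrix \<open>Q\<close> is \<open>(2k+1)\<close>-diagonal.\<close>

definition multidiagonal :: "nat \<Rightarrow> (nat \<Rightarrow> nat \<Rightarrow> real) \<Rightarrow> bool" where
  "multidiagonal k Q \<longleftrightarrow> (\<forall>i j. int k < \<bar>int j - int i\<bar> \<longrightarrow> Q i j = 0)"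

section \<open>Sequences and permanental sequences\<close>

definition c0_plus :: "(nat \<Rightarrow> real) set" where
  "c0_plus = {h. (\<forall>k. 0 \<le> h k) \<and> h \<longlonglongrightarrow> 0}"

text \<open>
  The positivity of the determinant is implicit in the real power; \<open>powr\<close> is total and would
  otherwise take arbitrary values.
\<close>

definition permanental_sequence ::
    "'b measure \<Rightarrow> real \<Rightarrow> (nat \<Rightarrow> nat \<Rightarrow> real) \<Rightarrow> (nat \<Rightarrow> 'b \<Rightarrow> real) \<Rightarrow> bool" where
  "permanental_sequence M \<alpha> K Z \<longleftrightarrow>
     prob_space M \<and>
     (\<forall>j. Z j \<in> borel_measurable M \<and> (AE \<omega> in M. 0 \<le> Z j \<omega>)) \<and>
     (\<forall>n (i :: nat \<Rightarrow> nat) (s :: nat \<Rightarrow> real).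
        inj_on i {..<n} \<longrightarrow> (\<forall>m<n. 0 < s m) \<longrightarrow>
        (let D = Determinant.det (1\<^sub>m n + Matrix.mat n n (\<lambda>(p, q). K (i p) (i q)) * mat_diag n s)
         in 0 < D \<and>
            (\<integral>\<omega>. exp (- (\<Sum>m<n. s m * Z (i m) \<omega>)) \<partial>M) = D powr (- \<alpha>)))"

end

theory Submission
  imports Defs "HOL-Real_Asymp.Real_Asymp"
begin

text \<open>
  For the upper bound, \<open>Z\<^sub>n\<close> is a gamma variable of shape \<open>\<alpha>\<close> and scale \<open>U\<^sub>n\<^sub>n + f\<^sub>n\<close>, with
  \<open>f\<^sub>n \<longlongrightarrow> 0\<close> and \<open>U\<^sub>n\<^sub>n\<close> bounded below by boundedness of the rates; so the first Borel--Cantelli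
  lemma suffices.

  For the lower bound, the killing makes the rows of \<open>U\<close> uniformly summable, so every
  \<open>{N\<^sub>0..<N}\<close> contains a set \<open>S\<close> of at least a fixed proportion of its points on which all
  off-diagonal entries of \<open>U\<close> are at most \<open>\<eta>\<close>.  On \<open>S\<close> the matrix \<open>U + 1 f\<^sup>T\<close> is the inverse of an
  M-matrix whose diagonal entries \<open>d\<^sub>i\<close> satisfy \<open>d\<^sub>i (U\<^sub>i\<^sub>i - \<eta>) \<le> 1\<close>, whatever the size of \<open>f\<close> (the Schur
  complement of the other states, seen through a maximum principle).  Expanding the Laplace
  transform around the diagonal of the M-matrix shows that \<open>(Z\<^sub>i)\<close> on \<open>S\<close> is a mixture of vectors of
  independent gamma variables with rates \<open>d\<^sub>i\<close> and shapes at least \<open>\<alpha>\<close>.  Hence all \<open>Z\<^sub>i\<close>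
  with \<open>i \<in> S\<close> are below \<open>(1 - \<epsilon>) U\<^sub>i\<^sub>i ln N\<close> with at most nearly the probability that this happens for
  independent gamma variables of shape \<open>\<alpha>\<close> and scales nearly \<open>U\<^sub>i\<^sub>i\<close>, which tends to \<open>0\<close>.

  The last claim is \<open>f = U (- Q f)\<close> for bounded \<open>f\<close>, where \<open>- Q f\<close> tends to \<open>0\<close> with \<open>f\<close> if \<open>Q\<close> is
  banded, together with the summability of the rows of \<open>U\<close>.
\<close>

section \<open>Symmetric semigroups with bounded rates\<close>

text \<open>The sequence is accessible only through Laplace transforms at positive arguments:
  neither independence for a converse Borel--Cantelli argument nor a correlation inequality is at
  hand. So the lower bound estimates directly the probability that a whole finite block stays low.
  The indicator of staying low is replaced by a polynomial in \<open>exp (- t * z)\<close>, whose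
  mean is a linear functional of the transform. Its coefficients alternate in sign, so two
  transforms can only be compared if one is a positive mixture; the signs of the entries and row
  sums of an M-matrix supply this. An independent gamma variable of rate \<open>d\<close> passes
  \<open>ln N / t\<close> with probability about \<open>N powr (- d / t)\<close>, up to logarithms.
  Hence one needs \<open>d / t\<close> below a fixed number less than 1 and a number of coordinates
  proportional to \<open>N\<close>. Coupling between coordinates raises \<open>d\<close> above the
  reciprocal of the diagonal entry, which is why the block is thinned first. A second obstacle is
  that \<open>Q\<close> consists of entrywise derivatives at time 0, while \<open>Q U = - I\<close>
  and \<open>Q f \<le> 0\<close> involve infinite sums.\<close>

lemma suminf_single: "(\<Sum>i::nat. if i = j then c else 0) = (c::real)"
  using sums_unique[OF sums_single[of j "\<lambda>_. c"]] by simp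

text \<open>\<open>rate\<close> is a one-sided derivative at time 0, entry by entry. Uniformity over
  the columns, regularity at other times and the identity \<open>Q_U\<close> have to be derived from
  it.\<close>

locale markov_semigroup =
  fixes p :: "real \<Rightarrow> nat \<Rightarrow> nat \<Rightarrow> real" and Q :: "nat \<Rightarrow> nat \<Rightarrow> real" and C \<delta> :: real
  assumes nonneg: "0 \<le> p t j k"
    and summable_row: "0 \<le> t \<Longrightarrow> summable (p t j)"
    and mass_le_1: "0 \<le> t \<Longrightarrow> (\<Sum>k. p t j k) \<le> 1"
    and zero: "p 0 j k = (if j = k then 1 else 0)"
    and chapman_kolmogorov: "0 \<le> s \<Longrightarrow> 0 \<le> t \<Longrightarrow> (\<lambda>i. p s j i * p t i k) sums p (s + t) j k"
    and sym: "0 \<le> t \<Longrightarrow> p t j k = p t k j"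
    and rate: "((\<lambda>t. p t j k) has_real_derivative Q j k) (at 0 within {0..})"
    and Q_summable: "summable (\<lambda>k. \<bar>Q j k\<bar>)"
    and Q_bound: "(\<Sum>k. \<bar>Q j k\<bar>) \<le> C"
    and Q_row: "(\<Sum>k. Q j k) \<le> - \<delta>"
    and \<delta>_pos: "0 < \<delta>"
begin

section \<open>Staying put and jumping over short times\<close>

lemma p_le_1: "0 \<le> t \<Longrightarrow> p t j k \<le> 1"
proof -
  assume t: "0 \<le> t"
  have "p t j k = (\<Sum>i\<in>{k}. p t j i)" by simp
  also have "\<dots> \<le> (\<Sum>k. p t j k)"
    by (rule sum_le_suminf[OF summable_row[OF t]]) (auto simp: nonneg)
  finally show ?thesis using mass_le_1[OF t, of j] by simp
qed

lemma Q_abs_le: "\<bar>Q j k\<bar> \<le> C"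
proof -
  have "\<bar>Q j k\<bar> = (\<Sum>i\<in>{k}. \<bar>Q j i\<bar>)" by simp
  also have "\<dots> \<le> (\<Sum>k. \<bar>Q j k\<bar>)"
    by (rule sum_le_suminf[OF Q_summable]) auto
  finally show ?thesis using Q_bound[of j] by simp
qed

lemma C_nonneg: "0 \<le> C"
  using Q_abs_le[of 0 0] by linarith

lemma chapman_kolmogorov_ge:
  assumes "0 \<le> s" "0 \<le> t" "finite F"
  shows "(\<Sum>i\<in>F. p s j i * p t i k) \<le> p (s + t) j k"
proof -
  note ck = chapman_kolmogorov[OF assms(1,2), of j k]
  have "(\<Sum>i\<in>F. p s j i * p t i k) \<le> (\<Sum>i. p s j i * p t i k)"
    using ck by (intro sum_le_suminf) (auto simp: nonneg assms sums_iff)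
  then show ?thesis using ck by (simp add: sums_iff)
qed

lemma diag_power_le: "0 \<le> h \<Longrightarrow> p h j j ^ n \<le> p (real n * h) j j"
proof (induction n)
  case 0 then show ?case by (simp add: zero)
next
  case (Suc n)
  have "p h j j ^ Suc n \<le> p h j j * p (real n * h) j j"
    using Suc by (simp add: mult_left_mono nonneg)
  also have "\<dots> \<le> p (h + real n * h) j j"
    using chapman_kolmogorov_ge[of h "real n * h" "{j}" j j] Suc.prems by simp
  finally show ?case by (simp add: algebra_simps)
qed

text \<open>The constant \<open>C + 1\<close> strictly exceeds the exit rate \<open>- Q j j\<close>,
  so differentiability at 0 alone gives the bound for short times. Cutting \<open>t\<close> into
  equal short pieces and using \<open>diag_power_le\<close> extends it to every
  \<open>t\<close>.\<close>

lemma diag_ge: "0 \<le> t \<Longrightarrow> exp (- (C + 1) * t) \<le> p t j j"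
proof -
  assume t: "0 \<le> t"
  let ?f = "\<lambda>h. p h j j - exp (- (C + 1) * h)"
  have "(?f has_real_derivative Q j j - exp (- (C + 1) * 0) * (- (C + 1))) (at 0 within {0..})"
    by (rule DERIV_diff[OF rate]) (auto intro!: derivative_eq_intros)
  then have "(?f has_real_derivative Q j j + (C + 1)) (at 0 within {0..})"
    by (simp del: minus_add_distrib)
  moreover have "0 < Q j j + (C + 1)" using Q_abs_le[of j j] by linarith
  ultimately obtain d where d: "d > 0" "\<And>h. 0 < h \<Longrightarrow> h < d \<Longrightarrow> ?f 0 < ?f h"
    using has_real_derivative_pos_inc_right[of ?f _ 0 "{0..}"] by force
  obtain n :: nat where n: "real n > t / d" "n > 0"
    using reals_Archimedean2[of "t / d"] t d
    by (metis divide_nonneg_pos gr0I not_less of_nat_0)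
  show ?thesis
  proof (cases "t = 0")
    case True then show ?thesis by (simp add: zero)
  next
    case False
    define h where "h = t / n"
    have h: "0 < h" "h < d" using n d t False by (auto simp: h_def field_simps)
    have "exp (- (C + 1) * h) \<le> p h j j" using d(2)[OF h] by (simp add: zero)
    then have "exp (- (C + 1) * h) ^ n \<le> p h j j ^ n" by (intro power_mono) auto
    also have "\<dots> \<le> p (real n * h) j j" using diag_power_le h by simp
    also have "real n * h = t" using n by (simp add: h_def)
    also have "exp (- (C + 1) * h) ^ n = exp (- (C + 1) * t)"
      using n by (simp add: exp_of_nat_mult[symmetric] h_def)
    finally show ?thesis .
  qed
qed

text \<open>
  Sums over the step at which the skeleton chain of mesh \<open>h\<close> makes its first jump from \<open>j\<close>, a
  jump to \<open>k\<close>, where it then stays; likewise for \<open>killing_iterate_ge\<close> with a jump to the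
  cemetery.  So the rates at time \<open>1 / n\<close> are dominated, uniformly in \<open>n\<close>, by the transition
  probabilities at time \<open>1\<close>, and no mass escapes to infinity in the limits below.
\<close>

lemma iterate_ge:
  assumes "j \<noteq> k" "0 \<le> h"
  shows "real m * exp (- (C + 1) * (real m * h)) * p h j k \<le> p (real m * h) j k"
proof (induction m)
  case 0 then show ?case by (simp add: nonneg)
next
  case (Suc m)
  let ?e = "\<lambda>t. exp (- (C + 1) * t)"
  have e: "?e (real (Suc m) * h) = ?e h * ?e (real m * h)"
    by (simp add: exp_add[symmetric] algebra_simps)
  have e1: "?e h \<le> 1" using C_nonneg assms by (simp add: mult_nonpos_nonneg)
  have "real (Suc m) * ?e (real (Suc m) * h) * p h j k
      = ?e h * (real m * ?e (real m * h) * p h j k) + ?e h * ?e (real m * h) * p h j k"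
    unfolding e by (simp add: algebra_simps)
  also have "\<dots> \<le> p h j j * p (real m * h) j k + p h j k * p (real m * h) k k"
  proof (intro add_mono)
    show "?e h * (real m * ?e (real m * h) * p h j k) \<le> p h j j * p (real m * h) j k"
      using Suc by (intro mult_mono diag_ge assms) (auto simp: nonneg)
    have "?e h * ?e (real m * h) * p h j k \<le> 1 * ?e (real m * h) * p h j k"
      using e1 by (intro mult_right_mono nonneg) auto
    also have "\<dots> \<le> p (real m * h) k k * p h j k"
      using diag_ge[of "real m * h" k] assms by (simp add: mult_right_mono nonneg)
    finally show "?e h * ?e (real m * h) * p h j k \<le> p h j k * p (real m * h) k k"
      by (simp add: mult.commute)
  qed
  also have "\<dots> \<le> p (h + real m * h) j k"
    using chapman_kolmogorov_ge[of h "real m * h" "{j,k}" j k] assms by simp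
  finally show ?case by (simp add: algebra_simps)
qed

lemma off_diag_le:
  assumes "j \<noteq> k"
  shows "real (Suc n) * p (1 / real (Suc n)) j k \<le> exp (C + 1) * p 1 j k"
proof -
  have "real (Suc n) * exp (- (C + 1)) * p (1 / real (Suc n)) j k \<le> p 1 j k"
    using iterate_ge[OF assms, of "1 / real (Suc n)" "Suc n"] by simp
  then have "exp (C + 1) * (real (Suc n) * exp (- (C + 1)) * p (1 / real (Suc n)) j k)
      \<le> exp (C + 1) * p 1 j k"
    by (rule mult_left_mono) simp
  moreover have "exp (C + 1) * (real (Suc n) * exp (- (C + 1)) * p (1 / real (Suc n)) j k)
      = (exp (C + 1) * exp (- (C + 1))) * (real (Suc n) * p (1 / real (Suc n)) j k)"
    by (simp only: mult_ac)
  ultimately show ?thesis by (simp only: exp_minus_inverse mult_1)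
qed

section \<open>Total mass and killing\<close>

definition P1 :: "real \<Rightarrow> nat \<Rightarrow> real" where
  "P1 t j = (\<Sum>k. p t j k)"

lemma P1_nonneg: "0 \<le> t \<Longrightarrow> 0 \<le> P1 t j"
  unfolding P1_def by (intro suminf_nonneg summable_row nonneg)

lemma P1_le_1: "0 \<le> t \<Longrightarrow> P1 t j \<le> 1"
  unfolding P1_def by (rule mass_le_1)

lemma summable_p_mult:
  assumes "0 \<le> t" "\<And>i. \<bar>g i\<bar> \<le> B"
  shows "summable (\<lambda>i. p t j i * g i)"
proof (rule summable_comparison_test')
  show "summable (\<lambda>i. p t j i * B)" using summable_row[OF assms(1)] by (rule summable_mult2)
  show "norm (p t j n * g n) \<le> p t j n * B" for n
    using assms(2) by (simp add: abs_mult nonneg mult_left_mono)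
qed


lemma summable_P1: "0 \<le> s \<Longrightarrow> 0 \<le> t \<Longrightarrow> summable (\<lambda>i. p s j i * P1 t i)"
  using summable_p_mult[of s "P1 t" 1 j] P1_nonneg P1_le_1 by simp

lemma P1_add_le:
  assumes "0 \<le> s" "0 \<le> t"
  shows "P1 (s + t) j \<le> (\<Sum>i. p s j i * P1 t i)"
  unfolding P1_def[of "s + t"]
proof (rule suminf_le_const)
  show "summable (p (s + t) j)" using assms by (intro summable_row) auto
  fix K
  have "(\<Sum>k<K. p (s + t) j k) = (\<Sum>k<K. \<Sum>i. p s j i * p t i k)"
    using chapman_kolmogorov[OF assms] by (simp add: sums_iff)
  also have "\<dots> = (\<Sum>i. \<Sum>k<K. p s j i * p t i k)"
    using chapman_kolmogorov[OF assms] by (intro suminf_sum[symmetric]) (simp add: sums_iff)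
  also have "\<dots> \<le> (\<Sum>i. p s j i * P1 t i)"
  proof (rule suminf_le)
    show "(\<Sum>k<K. p s j i * p t i k) \<le> p s j i * P1 t i" for i
      unfolding sum_distrib_left[symmetric] P1_def
      by (intro mult_left_mono sum_le_suminf summable_row assms nonneg) auto
    show "summable (\<lambda>i. \<Sum>k<K. p s j i * p t i k)"
      using chapman_kolmogorov[OF assms] by (intro summable_sum) (simp add: sums_iff)
  qed (rule summable_P1[OF assms])
  finally show "(\<Sum>k<K. p (s + t) j k) \<le> (\<Sum>i. p s j i * P1 t i)" .
qed

lemma killing_iterate_ge:
  assumes "0 \<le> h"
  shows "real m * exp (- (C + 1) * (real m * h)) * (1 - P1 h j) \<le> 1 - P1 (real m * h) j"
proof (induction m)
  case 0 then show ?case using P1_le_1[of 0 j] by simp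
next
  case (Suc m)
  let ?e = "\<lambda>t. exp (- (C + 1) * t)"
  have e: "?e (real (Suc m) * h) = ?e h * ?e (real m * h)"
    by (simp add: exp_add[symmetric] algebra_simps)
  have e1: "?e (real (Suc m) * h) \<le> 1"
    using C_nonneg assms by (simp add: mult_nonpos_nonneg)
  have mh: "0 \<le> real m * h" using assms by simp
  have "P1 (h + real m * h) j \<le> (\<Sum>i. p h j i * P1 (real m * h) i)"
    by (rule P1_add_le[OF assms mh])
  \<comment> \<open>Every intermediate state other than \<open>j\<close> is credited with full mass
    1; only staying at \<open>j\<close> during the first step keeps its deficit.\<close>
  also have "\<dots> \<le> (\<Sum>i. p h j i - (if i = j then p h j j * (1 - P1 (real m * h) j) else 0))"
  proof (rule suminf_le[OF _ summable_P1[OF assms mh]])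
    show "p h j i * P1 (real m * h) i
        \<le> p h j i - (if i = j then p h j j * (1 - P1 (real m * h) j) else 0)" for i
      using mult_left_mono[OF P1_le_1[OF mh] nonneg, of h j i i] by (simp add: algebra_simps)
    show "summable (\<lambda>i. p h j i - (if i = j then p h j j * (1 - P1 (real m * h) j) else 0))"
      by (intro summable_diff summable_row assms summable_finite[of "{j}"]) auto
  qed
  also have "\<dots> = P1 h j - p h j j * (1 - P1 (real m * h) j)"
    unfolding P1_def[of h]
    by (subst suminf_diff[symmetric])
       (auto intro!: summable_row assms summable_finite[of "{j}"] simp: suminf_single)
  finally have *: "P1 (h + real m * h) j \<le> P1 h j - p h j j * (1 - P1 (real m * h) j)" .
  have "real (Suc m) * ?e (real (Suc m) * h) * (1 - P1 h j)
      = ?e h * (real m * ?e (real m * h) * (1 - P1 h j)) + ?e (real (Suc m) * h) * (1 - P1 h j)"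
    unfolding e by (simp add: algebra_simps)
  also have "\<dots> \<le> p h j j * (1 - P1 (real m * h) j) + 1 * (1 - P1 h j)"
  proof (intro add_mono)
    show "?e h * (real m * ?e (real m * h) * (1 - P1 h j)) \<le> p h j j * (1 - P1 (real m * h) j)"
      using Suc P1_le_1[OF assms] by (intro mult_mono diag_ge assms) (auto simp: nonneg)
    show "?e (real (Suc m) * h) * (1 - P1 h j) \<le> 1 * (1 - P1 h j)"
      using e1 P1_le_1[OF assms] by (intro mult_right_mono) auto
  qed
  finally show ?case using * by (simp add: algebra_simps)
qed

section \<open>From difference quotients to the generator\<close>

lemma rate_sequence:
  "(\<lambda>n. real (Suc n) * (p (1 / real (Suc n)) j k - p 0 j k)) \<longlonglongrightarrow> Q j k"
proof -
  have "((\<lambda>y. (p y j k - p 0 j k) / (y - 0)) \<longlongrightarrow> Q j k) (at 0 within {0..})"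
    using rate[of j k] by (simp add: has_field_derivative_iff)
  moreover have "filterlim (\<lambda>n. 1 / real (Suc n)) (at 0 within {0..}) sequentially"
    unfolding filterlim_at
    using LIMSEQ_inverse_real_of_nat by (auto simp: inverse_eq_divide)
  ultimately have "(\<lambda>n. (p (1 / real (Suc n)) j k - p 0 j k) / (1 / real (Suc n) - 0)) \<longlonglongrightarrow> Q j k"
    by (rule filterlim_compose)
  then show ?thesis by (simp add: mult.commute)
qed

text \<open>Dominated convergence for series. Off the diagonal the quotients are at most
  \<open>exp (C + 1) * p 1 j i\<close> by \<open>off_diag_le\<close>, which is summable in
  \<open>i\<close>; the diagonal quotient is at most \<open>C + 1\<close> in absolute value by
  \<open>diag_ge\<close>.\<close>

lemma generator_sequence:
  assumes g: "\<And>i. \<bar>g i\<bar> \<le> B"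
  shows "(\<lambda>n. real (Suc n) * ((\<Sum>i. p (1 / real (Suc n)) j i * g i) - g j)) \<longlonglongrightarrow> (\<Sum>i. Q j i * g i)"
proof -
  let ?h = "\<lambda>n. 1 / real (Suc n)"
  let ?a = "\<lambda>i n. real (Suc n) * (p (?h n) j i - p 0 j i) * g i"
  let ?M = "\<lambda>i. exp (C + 1) * p 1 j i * B + (if i = j then (C + 1) * B else 0)"
  have B: "0 \<le> B" using g[of 0] by linarith
  have bound: "norm (?a i n) \<le> ?M i" for i n
  proof (cases "i = j")
    case True
    have "1 - (C + 1) * ?h n \<le> p (?h n) j j"
      using diag_ge[of "?h n" j] exp_ge_add_one_self[of "- (C + 1) * ?h n"]
      by (simp del: minus_add_distrib)
    then have "real (Suc n) * (1 - p (?h n) j j) \<le> real (Suc n) * ((C + 1) * ?h n)"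
      by (intro mult_left_mono) auto
    then have "\<bar>real (Suc n) * (p (?h n) j j - 1)\<bar> \<le> C + 1"
      using p_le_1[of "?h n" j j] by (simp add: abs_mult)
    then have "norm (?a i n) \<le> (C + 1) * B"
      unfolding True real_norm_def abs_mult[of _ "g j"]
      using g[of j] by (simp only: zero) (auto intro!: mult_mono)
    moreover have "0 \<le> exp (C + 1) * p 1 j i * B" using B by (simp add: nonneg)
    ultimately show ?thesis using True by simp
  next
    case False
    then have "norm (?a i n) = (real (Suc n) * p (?h n) j i) * \<bar>g i\<bar>"
      by (simp add: zero abs_mult nonneg del: of_nat_Suc)
    also have "\<dots> \<le> (exp (C + 1) * p 1 j i) * B"
      by (rule mult_mono) (use off_diag_le[of j i n] False g B nonneg in auto)
    finally show ?thesis using False by simp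
  qed
  have M: "summable ?M"
    by (intro summable_add summable_mult summable_mult2 summable_row summable_finite[of "{j}"]) auto
  have "(\<lambda>n. \<Sum>i. ?a i n) \<longlonglongrightarrow> (\<Sum>i. Q j i * g i)"
    by (intro conjunct2[OF conjunct2[OF tannerys_theorem[where M = ?M]]] M
          tendsto_mult tendsto_const rate_sequence always_eventually) (use bound in auto)
  moreover have "(\<Sum>i. ?a i n) = real (Suc n) * ((\<Sum>i. p (?h n) j i * g i) - g j)" for n
  proof -
    have "(\<Sum>i. ?a i n) = (\<Sum>i. real (Suc n) * (p (?h n) j i * g i - (if i = j then g j else 0)))"
      by (intro suminf_cong) (auto simp: zero algebra_simps)
    also have "\<dots> = real (Suc n) * (\<Sum>i. p (?h n) j i * g i - (if i = j then g j else 0))"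
      by (intro suminf_mult summable_diff summable_p_mult[where B = B] g
            summable_finite[of "{j}"]) auto
    also have "(\<Sum>i. p (?h n) j i * g i - (if i = j then g j else 0)) = (\<Sum>i. p (?h n) j i * g i) - g j"
      using suminf_diff[of "\<lambda>i. p (?h n) j i * g i" "\<lambda>i. if i = j then g j else 0"]
        summable_p_mult[of "?h n" g B j] g sums_summable[OF sums_single[of j "\<lambda>_. g j"]]
      by (simp add: suminf_single)
    finally show ?thesis .
  qed
  ultimately show ?thesis by simp
qed

text \<open>A lower bound for the chance of being killed by time 1: a killing rate of at least
  \<open>\<delta>\<close>, times the price \<open>exp (- (C + 1))\<close> of waiting in the initial
  state.\<close>

definition \<kappa> :: real where "\<kappa> = exp (- (C + 1)) * \<delta>"

lemma \<kappa>_pos: "0 < \<kappa>"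
  using \<delta>_pos by (simp add: \<kappa>_def)

text \<open>\<open>killing_iterate_ge\<close> with \<open>n\<close> steps of length
  \<open>1 / n\<close> bounds the loss of mass by time 1 from below; as \<open>n\<close> grows,
  \<open>generator_sequence\<close> for the constant function 1 turns the bound into the row sum of
  \<open>Q\<close>.\<close>

lemma P1_one_le: "P1 1 j \<le> 1 - \<kappa>"
proof -
  let ?h = "\<lambda>n. 1 / real (Suc n)"
  have "(\<lambda>n. real (Suc n) * ((\<Sum>i. p (?h n) j i * 1) - 1)) \<longlonglongrightarrow> (\<Sum>i. Q j i * 1)"
    by (rule generator_sequence[where B = 1]) simp
  then have "(\<lambda>n. real (Suc n) * (P1 (?h n) j - 1)) \<longlonglongrightarrow> (\<Sum>i. Q j i)"
    by (simp add: P1_def)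
  then have "(\<lambda>n. exp (- (C + 1)) * - (real (Suc n) * (P1 (?h n) j - 1))) \<longlonglongrightarrow>
      exp (- (C + 1)) * - (\<Sum>i. Q j i)"
    by (intro tendsto_intros)
  moreover have "exp (- (C + 1)) * - (real (Suc n) * (P1 (?h n) j - 1)) \<le> 1 - P1 1 j" for n
    using killing_iterate_ge[of "?h n" "Suc n" j] by (simp add: algebra_simps)
  ultimately have "exp (- (C + 1)) * - (\<Sum>i. Q j i) \<le> 1 - P1 1 j"
    by (intro LIMSEQ_le_const2) blast+
  moreover have "\<kappa> \<le> exp (- (C + 1)) * - (\<Sum>i. Q j i)"
    unfolding \<kappa>_def using Q_row[of j] by (intro mult_left_mono) auto
  ultimately show ?thesis by simp
qed

lemma \<kappa>_le_1: "\<kappa> \<le> 1"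
  using P1_one_le[of 0] P1_nonneg[of 1 0] by simp

lemma P1_add_le_mult:
  assumes "0 \<le> s" "0 \<le> t" "\<And>i. P1 t i \<le> B"
  shows "P1 (s + t) j \<le> B * P1 s j"
proof -
  have "P1 (s + t) j \<le> (\<Sum>i. p s j i * P1 t i)" by (rule P1_add_le[OF assms(1,2)])
  also have "\<dots> \<le> (\<Sum>i. p s j i * B)"
    by (intro suminf_le summable_P1 summable_mult2 summable_row assms mult_left_mono nonneg)
  also have "\<dots> = B * P1 s j"
    unfolding P1_def using suminf_mult2[OF summable_row[OF assms(1)], of j B] by (simp add: mult.commute)
  finally show ?thesis .
qed

lemma P1_le_power: "P1 (real n) j \<le> (1 - \<kappa>) ^ n"
proof (induction n arbitrary: j)
  case 0 then show ?case using P1_le_1 by simp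
next
  case (Suc n)
  have "P1 (1 + real n) j \<le> (1 - \<kappa>) ^ n * P1 1 j"
    by (rule P1_add_le_mult) (auto intro: Suc)
  also have "\<dots> \<le> (1 - \<kappa>) ^ n * (1 - \<kappa>)"
    using P1_one_le \<kappa>_le_1 by (intro mult_left_mono) auto
  finally show ?case by (simp add: mult.commute)
qed

lemma P1_le_exp:
  assumes "0 \<le> t"
  shows "P1 t j \<le> exp \<kappa> * exp (- \<kappa> * t)"
proof -
  \<comment> \<open>Rounding \<open>t\<close> down to an integer costs at most the factor
    \<open>exp \<kappa>\<close>.\<close>
  define n where "n = nat \<lfloor>t\<rfloor>"
  have n: "real n \<le> t" "t \<le> real n + 1"
    using assms by (auto simp: n_def of_nat_nat le_floor_iff)
  have "P1 (real n + (t - real n)) j \<le> 1 * P1 (real n) j"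
    by (rule P1_add_le_mult) (use n P1_le_1 in auto)
  also have "\<dots> \<le> (1 - \<kappa>) ^ n" using P1_le_power by simp
  also have "\<dots> \<le> exp (- \<kappa>) ^ n"
    using \<kappa>_le_1 exp_ge_add_one_self[of "- \<kappa>"] by (intro power_mono) auto
  also have "\<dots> = exp (\<kappa> * - real n)" by (simp add: exp_of_nat_mult[symmetric] mult.commute)
  also have "\<dots> \<le> exp (\<kappa> * (1 - t))"
    using n \<kappa>_pos by (intro iffD2[OF exp_le_cancel_iff] mult_left_mono) auto
  also have "\<dots> = exp \<kappa> * exp (- \<kappa> * t)" by (simp add: exp_add[symmetric] algebra_simps)
  finally show ?thesis by simp
qed


text \<open>An increment in either direction is at most the chance \<open>1 - p h j j\<close> of not
  being found at \<open>j\<close> after time \<open>h\<close>. The resulting Lipschitz bound serves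
  both the measurability in time and the error term of \<open>potential_shift\<close>.\<close>

lemma p_increment:
  assumes "0 \<le> h" "0 \<le> t"
  shows "\<bar>p (h + t) j k - p t j k\<bar> \<le> (C + 1) * h"
proof -
  have d: "1 - p h j j \<le> (C + 1) * h"
    using diag_ge[OF assms(1), of j] exp_ge_add_one_self[of "- (C + 1) * h"]
    by (simp del: minus_add_distrib)
  have "p (h + t) j k \<le> (\<Sum>i. p h j i - (if i = j then p h j j * (1 - p t j k) else 0))"
  proof (rule sums_le[OF _ chapman_kolmogorov[OF assms] summable_sums])
    show "p h j i * p t i k \<le> p h j i - (if i = j then p h j j * (1 - p t j k) else 0)" for i
      using mult_left_mono[OF p_le_1[OF assms(2)] nonneg, of h j i i] by (simp add: algebra_simps)
    show "summable (\<lambda>i. p h j i - (if i = j then p h j j * (1 - p t j k) else 0))"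
      by (intro summable_diff summable_row assms summable_finite[of "{j}"]) auto
  qed
  also have "\<dots> = P1 h j - p h j j * (1 - p t j k)"
    unfolding P1_def[of h]
    by (subst suminf_diff[symmetric])
       (auto intro!: summable_row assms summable_finite[of "{j}"] simp: suminf_single)
  finally have "p (h + t) j k - p t j k \<le> (1 - p t j k) * (1 - p h j j)"
    using P1_le_1[OF assms(1), of j] by (simp add: algebra_simps)
  also have "\<dots> \<le> 1 * (1 - p h j j)"
    using p_le_1 assms nonneg by (intro mult_right_mono) auto
  finally have upper: "p (h + t) j k - p t j k \<le> 1 - p h j j" by simp
  have "p t j k - p (h + t) j k \<le> (1 - p h j j) * p t j k"
    using chapman_kolmogorov_ge[OF assms, of "{j}" j k] by (simp add: algebra_simps)
  also have "\<dots> \<le> (1 - p h j j) * 1"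
    using p_le_1 assms nonneg by (intro mult_left_mono) auto
  finally show ?thesis using upper d by (simp only: abs_le_iff) simp
qed

section \<open>Regularity in time and the potential density\<close>

lemma continuous_on_p: "continuous_on {0..} (\<lambda>t. p t j k)"
proof (rule lipschitz_on_continuous_on)
  show "(C + 1)-lipschitz_on {0..} (\<lambda>t. p t j k)"
  proof (rule lipschitz_onI)
    fix x y :: real assume "x \<in> {0..}" "y \<in> {0..}"
    then show "dist (p x j k) (p y j k) \<le> (C + 1) * dist x y"
      using p_increment[of "x - y" y j k] p_increment[of "y - x" x j k]
      by (cases "x \<le> y") (auto simp: dist_real_def)
  qed (use C_nonneg in simp)
qed

lemma p_measurable [measurable]:
  "(\<lambda>t. ennreal (p t j k) * indicator {0..} t) \<in> borel_measurable borel"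
proof -
  have "(\<lambda>t. ennreal (indicator {0..} t *\<^sub>R p t j k)) \<in> borel_measurable borel"
    by (intro measurable_compose[OF _ measurable_ennreal]
          borel_measurable_continuous_on_indicator continuous_on_p) auto
  also have "(\<lambda>t. ennreal (indicator {0..} t *\<^sub>R p t j k)) = (\<lambda>t. ennreal (p t j k) * indicator {0..} t)"
    by (auto simp: indicator_def)
  finally show ?thesis .
qed

definition V :: "nat \<Rightarrow> nat \<Rightarrow> ennreal" where
  "V j k = (\<integral>\<^sup>+ t\<in>{0..}. ennreal (p t j k) \<partial>lborel)"

text \<open>The integral over \<open>t \<ge> 0\<close> of the bound in
  \<open>P1_le_exp\<close>.\<close>

definition mass_bound :: real where "mass_bound = exp \<kappa> / \<kappa>"

lemma V_sum_le: "(\<Sum>k. V j k) \<le> ennreal mass_bound"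
proof -
  have "(\<Sum>k. V j k) = (\<integral>\<^sup>+ t. (\<Sum>k. ennreal (p t j k) * indicator {0..} t) \<partial>lborel)"
    unfolding V_def by (rule nn_integral_suminf[symmetric]) simp
  also have "\<dots> \<le> (\<integral>\<^sup>+ t. ennreal (exp \<kappa> * exp (- \<kappa> * t)) * indicator {0..} t \<partial>lborel)"
  proof (rule nn_integral_mono)
    fix t :: real
    have "(\<Sum>k. ennreal (p t j k)) = ennreal (P1 t j)" if "0 \<le> t"
      unfolding P1_def using that by (intro suminf_ennreal2 nonneg summable_row)
    then show "(\<Sum>k. ennreal (p t j k) * indicator {0..} t)
        \<le> ennreal (exp \<kappa> * exp (- \<kappa> * t)) * indicator {0..} t"
      using P1_le_exp[of t j] by (auto simp: indicator_def ennreal_leI)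
  qed
  also have "\<dots> = ennreal (0 - (- exp \<kappa> / \<kappa> * exp (- \<kappa> * 0)))"
  proof (rule nn_integral_FTC_atLeast)
    show "((\<lambda>t. - exp \<kappa> / \<kappa> * exp (- \<kappa> * t)) \<longlongrightarrow> 0) at_top"
    proof -
      have "filterlim (\<lambda>t. \<kappa> * t) at_top at_top"
        by (intro filterlim_tendsto_pos_mult_at_top[OF tendsto_const \<kappa>_pos] filterlim_ident)
      then have "((\<lambda>t. exp (- \<kappa> * t)) \<longlongrightarrow> 0) at_top"
        by (intro filterlim_compose[OF exp_at_bot]) (simp add: filterlim_uminus_at_bot)
      then show ?thesis by (rule tendsto_mult_right_zero)
    qed
  qed (use \<kappa>_pos in \<open>auto intro!: derivative_eq_intros\<close>)
  finally show ?thesis by (simp add: mass_bound_def)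
qed

definition U :: "nat \<Rightarrow> nat \<Rightarrow> real" where "U j k = enn2real (V j k)"

lemma V_finite: "V j k < \<infinity>"
proof -
  have "V j k = (\<Sum>i\<in>{k}. V j i)" by simp
  also have "\<dots> \<le> (\<Sum>i. V j i)" by (rule sum_le_suminf) auto
  also have "\<dots> \<le> ennreal mass_bound" by (rule V_sum_le)
  finally show ?thesis by (auto simp: less_top[symmetric] top_unique)
qed

lemma V_eq: "V j k = ennreal (U j k)"
  using V_finite[of j k] by (simp add: U_def)

lemma U_nonneg: "0 \<le> U j k"
  by (simp add: U_def)

lemma U_sym: "U j k = U k j"
proof -
  have "V j k = V k j"
    unfolding V_def by (intro nn_integral_cong) (auto simp: indicator_def sym)
  then show ?thesis by (simp add: U_def)
qed

lemma mass_bound_pos: "0 < mass_bound"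
  using \<kappa>_pos by (simp add: mass_bound_def)

lemma U_summable: "summable (U j)"
proof (rule summable_suminf_not_top)
  show "(\<Sum>k. ennreal (U j k)) \<noteq> \<top>"
    using V_sum_le[of j] by (auto simp: V_eq[symmetric] top_unique)
qed (rule U_nonneg)

lemma U_sum_le: "(\<Sum>k. U j k) \<le> mass_bound"
proof -
  have "ennreal (\<Sum>k. U j k) \<le> ennreal mass_bound"
    using V_sum_le[of j] by (simp add: V_eq suminf_ennreal2 U_nonneg U_summable)
  then show ?thesis using mass_bound_pos by simp
qed

lemma U_le: "U j k \<le> mass_bound"
proof -
  have "U j k = (\<Sum>i\<in>{k}. U j i)" by simp
  also have "\<dots> \<le> (\<Sum>k. U j k)"
    by (rule sum_le_suminf[OF U_summable]) (auto simp: U_nonneg)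
  finally show ?thesis using U_sum_le[of j] by simp
qed

text \<open>The time integral is split at \<open>h\<close>. By Chapman--Kolmogorov the part after
  \<open>h\<close> is the semigroup at time \<open>h\<close> applied to \<open>U\<close>; the part
  before \<open>h\<close> is \<open>h\<close> times the identity up to an error of second order, by
  \<open>p_increment\<close>.\<close>

lemma potential_shift:
  assumes "0 \<le> h"
  shows "\<bar>U j k - (\<Sum>i. p h j i * U i k) - h * (if j = k then 1 else 0)\<bar> \<le> (C + 1) * h\<^sup>2"
proof -
  let ?I = "\<integral>\<^sup>+ t. (ennreal (p t j k) * indicator {0..} t) * indicator {0..<h} t \<partial>lborel"
  let ?b = "if j = k then 1 else 0 :: real"
  have sm: "summable (\<lambda>i. p h j i * U i k)"
    by (rule summable_p_mult[where B = mass_bound]) (use assms U_nonneg U_le in auto)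
  have "(\<integral>\<^sup>+ t. (ennreal (p t j k) * indicator {0..} t) * indicator {h..} t \<partial>lborel)
      = (\<integral>\<^sup>+ t. (ennreal (p (h + t) j k) * indicator {0..} (h + t)) * indicator {h..} (h + t) \<partial>lborel)"
    using nn_integral_real_affine[of "\<lambda>t. (ennreal (p t j k) * indicator {0..} t) * indicator {h..} t" 1 h]
    by simp
  also have "\<dots> = (\<integral>\<^sup>+ t. (\<Sum>i. ennreal (p h j i) * (ennreal (p t i k) * indicator {0..} t)) \<partial>lborel)"
  proof (rule nn_integral_cong)
    fix t :: real
    show "(ennreal (p (h + t) j k) * indicator {0..} (h + t)) * indicator {h..} (h + t)
        = (\<Sum>i. ennreal (p h j i) * (ennreal (p t i k) * indicator {0..} t))"
    proof (cases "0 \<le> t")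
      case True
      have "(\<Sum>i. ennreal (p h j i) * ennreal (p t i k)) = (\<Sum>i. ennreal (p h j i * p t i k))"
        by (simp add: ennreal_mult nonneg)
      also have "\<dots> = ennreal (p (h + t) j k)"
        using chapman_kolmogorov[OF assms True, of j k]
        by (subst suminf_ennreal2) (auto simp: nonneg sums_iff)
      finally show ?thesis using True assms by simp
    qed simp
  qed
  also have "\<dots> = (\<Sum>i. ennreal (p h j i) * V i k)"
    unfolding V_def by (subst nn_integral_suminf) (auto simp: nn_integral_cmult)
  also have "\<dots> = ennreal (\<Sum>i. p h j i * U i k)"
    using sm by (simp add: V_eq ennreal_mult[symmetric] nonneg U_nonneg suminf_ennreal2)
  finally have tail: "(\<integral>\<^sup>+ t. (ennreal (p t j k) * indicator {0..} t) * indicator {h..} t \<partial>lborel)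
      = ennreal (\<Sum>i. p h j i * U i k)" .
  have "V j k = (\<integral>\<^sup>+ t. (ennreal (p t j k) * indicator {0..} t) * indicator {0..<h} t
        + (ennreal (p t j k) * indicator {0..} t) * indicator {h..} t \<partial>lborel)"
    unfolding V_def using assms by (intro nn_integral_cong) (auto simp: indicator_def)
  also have "\<dots> = ?I + ennreal (\<Sum>i. p h j i * U i k)"
    unfolding tail[symmetric] by (rule nn_integral_add) auto
  finally have V: "ennreal (U j k) = ?I + ennreal (\<Sum>i. p h j i * U i k)"
    by (simp add: V_eq)
  have near: "\<bar>p t j k - ?b\<bar> \<le> (C + 1) * h" if "0 \<le> t" "t < h" for t
    using order_trans[OF p_increment[of t 0 j k] mult_left_mono[of t h "C + 1"]] that C_nonneg
    by (simp add: zero)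
  have const: "(\<integral>\<^sup>+ t. ennreal c * indicator {0..<h} t \<partial>lborel) = ennreal (c * h)" if "0 \<le> c" for c
    using assms that by (simp add: nn_integral_cmult ennreal_mult)
  have "?I \<le> (\<integral>\<^sup>+ t. ennreal (?b + (C + 1) * h) * indicator {0..<h} t \<partial>lborel)"
    by (intro nn_integral_mono) (use near in \<open>force simp: indicator_def intro!: ennreal_leI\<close>)
  also have "\<dots> = ennreal ((?b + (C + 1) * h) * h)"
    using C_nonneg assms by (intro const) auto
  finally have I_le: "?I \<le> ennreal ((?b + (C + 1) * h) * h)" .
  \<comment> \<open>The lower bound may be negative off the diagonal, so it is clipped at 0 before
    it is compared in \<open>ennreal\<close>.\<close>
  have "ennreal ((max 0 (?b - (C + 1) * h)) * h)
      = (\<integral>\<^sup>+ t. ennreal (max 0 (?b - (C + 1) * h)) * indicator {0..<h} t \<partial>lborel)"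
    by (rule const[symmetric]) simp
  also have "\<dots> \<le> ?I"
  proof (rule nn_integral_mono)
    fix t :: real
    have "max 0 (?b - (C + 1) * h) \<le> p t j k" if "0 \<le> t" "t < h"
      using near[OF that] nonneg[of t j k] by (simp only: abs_le_iff) simp
    then show "ennreal (max 0 (?b - (C + 1) * h)) * indicator {0..<h} t
        \<le> (ennreal (p t j k) * indicator {0..} t) * indicator {0..<h} t"
      by (auto simp: indicator_def ennreal_leI simp del: max_less_iff_conj max.bounded_iff)
  qed
  finally have I_ge: "ennreal ((max 0 (?b - (C + 1) * h)) * h) \<le> ?I" .
  obtain x where x: "?I = ennreal x" "0 \<le> x"
    using I_le by (cases ?I) (auto simp: top_unique)
  have S: "0 \<le> (\<Sum>i. p h j i * U i k)"
    by (intro suminf_nonneg sm mult_nonneg_nonneg nonneg U_nonneg)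
  have "U j k = x + (\<Sum>i. p h j i * U i k)"
    using V x S U_nonneg by (simp add: ennreal_plus[symmetric] del: ennreal_plus)
  moreover have "x \<le> (?b + (C + 1) * h) * h"
    using I_le x C_nonneg assms by (simp add: ennreal_le_iff)
  moreover have "(?b - (C + 1) * h) * h \<le> x"
  proof -
    have "(max 0 (?b - (C + 1) * h)) * h \<le> x" using I_ge x by (simp add: ennreal_le_iff)
    moreover have "(?b - (C + 1) * h) * h \<le> (max 0 (?b - (C + 1) * h)) * h"
      using assms by (intro mult_right_mono) auto
    ultimately show ?thesis by linarith
  qed
  ultimately show ?thesis
    by (simp add: abs_le_iff algebra_simps power2_eq_square)
qed

text \<open>The columns of \<open>U\<close> are bounded, so their difference quotients converge to
  the left side by \<open>generator_sequence\<close>; by \<open>potential_shift\<close> divided by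
  the mesh they also converge to the right side.\<close>

lemma Q_U: "(\<Sum>i. Q j i * U i k) = - (if j = k then 1 else 0)"
proof -
  let ?h = "\<lambda>n. 1 / real (Suc n)"
  let ?b = "if j = k then 1 else 0 :: real"
  let ?x = "\<lambda>n. real (Suc n) * ((\<Sum>i. p (?h n) j i * U i k) - U j k)"
  have "?x \<longlonglongrightarrow> (\<Sum>i. Q j i * U i k)"
    by (rule generator_sequence[where B = mass_bound]) (simp add: U_nonneg U_le)
  moreover have "?x \<longlonglongrightarrow> - ?b"
  proof (rule LIM_zero_cancel, rule Lim_null_comparison)
    show "(\<lambda>n. (C + 1) * ?h n) \<longlonglongrightarrow> 0"
      using tendsto_mult_right_zero[OF LIMSEQ_inverse_real_of_nat] by (simp add: inverse_eq_divide)
    show "\<forall>\<^sub>F n in sequentially. norm (?x n - - ?b) \<le> (C + 1) * ?h n"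
    proof (rule always_eventually, rule allI)
      fix n
      have "?x n + ?b = - real (Suc n) * (U j k - (\<Sum>i. p (?h n) j i * U i k) - ?h n * ?b)"
        by (simp add: field_simps del: of_nat_Suc)
      then have "\<bar>?x n + ?b\<bar> \<le> real (Suc n) * ((C + 1) * (?h n)\<^sup>2)"
        using potential_shift[of "?h n" j k]
        by (simp only: abs_mult abs_minus_cancel abs_of_nat) (intro mult_left_mono, auto)
      then show "norm (?x n - - ?b) \<le> (C + 1) * ?h n"
        by (simp add: power2_eq_square)
    qed
  qed
  ultimately show ?thesis by (rule LIMSEQ_unique)
qed

lemma Q_sym: "Q j k = Q k j"
proof -
  have "(\<lambda>n. real (Suc n) * (p (1 / real (Suc n)) j k - p 0 j k)) \<longlonglongrightarrow> Q k j"
    using rate_sequence[of k j] by (simp add: sym[of _ k j])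
  then show ?thesis using rate_sequence[of j k] LIMSEQ_unique by blast
qed

lemma Q_off_diag: "j \<noteq> k \<Longrightarrow> 0 \<le> Q j k"
  by (rule LIMSEQ_le_const[OF rate_sequence[of j k]]) (auto simp: zero nonneg)

lemma Q_excessive:
  assumes "\<And>i. \<bar>g i\<bar> \<le> B" "\<And>t. 0 < t \<Longrightarrow> (\<Sum>i. p t j i * g i) \<le> g j"
  shows "(\<Sum>i. Q j i * g i) \<le> 0"
  by (rule LIMSEQ_le_const2[OF generator_sequence[OF assms(1)]])
     (use assms(2) in \<open>auto simp: mult_le_0_iff\<close>)

end

section \<open>Potentials and inverse M-matrices\<close>

text \<open>Fubini for absolutely convergent double series, obtained from unordered sums over
  pairs.\<close>

lemma sums_swap:
  fixes a :: "nat \<Rightarrow> nat \<Rightarrow> real"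
  assumes "\<And>i. summable (\<lambda>j. \<bar>a i j\<bar>)" "summable (\<lambda>i. \<Sum>j. \<bar>a i j\<bar>)"
  shows "(\<lambda>j. \<Sum>i. a i j) sums (\<Sum>i. \<Sum>j. a i j)"
proof -
  have "(\<lambda>(i, j). \<bar>a i j\<bar>) summable_on UNIV \<times> UNIV"
  proof (rule summable_on_SigmaI[where g = "\<lambda>i. \<Sum>j. \<bar>a i j\<bar>"])
    show "((\<lambda>j. case (i, j) of (i, j) \<Rightarrow> \<bar>a i j\<bar>) has_sum (\<Sum>j. \<bar>a i j\<bar>)) UNIV" for i
      using norm_summable_imp_has_sum[OF _ summable_sums[OF assms(1)]] assms(1) by simp
    show "(\<lambda>i. \<Sum>j. \<bar>a i j\<bar>) summable_on UNIV"
      by (intro summable_nonneg_imp_summable_on assms suminf_nonneg) auto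
  qed auto
  then have s: "(\<lambda>(i, j). a i j) summable_on UNIV \<times> UNIV"
    using abs_summable_summable[of "\<lambda>(i, j). a i j" "UNIV \<times> UNIV"] by (simp add: case_prod_unfold)
  then have s': "(\<lambda>(j, i). a i j) summable_on UNIV \<times> UNIV"
    using summable_on_swap[of "\<lambda>(i, j). a i j" UNIV UNIV] by (simp add: case_prod_unfold)
  have eq: "infsum f UNIV = suminf f" if "f summable_on UNIV" for f :: "nat \<Rightarrow> real"
    using has_sum_imp_sums[OF has_sum_infsum[OF that]] by (simp add: sums_iff)
  have r: "a i summable_on UNIV" for i
    using assms(1)[of i] norm_summable_imp_summable_on[of "a i"] by simp
  have c: "(\<lambda>i. a i j) summable_on UNIV" for j
    using summable_on_SigmaD1[OF s', of j] by simp
  have R: "(\<lambda>i. \<Sum>j. a i j) summable_on UNIV"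
    using summable_on_Sigma_banach[OF s] by (simp add: eq[OF r])
  have L: "(\<lambda>j. \<Sum>i. a i j) summable_on UNIV"
    using summable_on_Sigma_banach[OF s'] by (simp add: eq[OF c])
  have "(\<Sum>i. \<Sum>j. a i j) = (\<Sum>j. \<Sum>i. a i j)"
    using infsum_swap_banach[OF s] by (simp add: eq[OF r] eq[OF c] eq[OF R] eq[OF L])
  then show ?thesis using summable_sums[OF summable_on_imp_summable[OF L]] by simp
qed

text \<open>The matrix type is confined to this proof, so that potential theory can work with plain
  functions of two indices.\<close>

lemma square_system_inverse:
  fixes k :: "nat \<Rightarrow> nat \<Rightarrow> real"
  assumes "\<And>w q. (\<And>p. p < n \<Longrightarrow> (\<Sum>q<n. k p q * w q) = 0) \<Longrightarrow> q < n \<Longrightarrow> w q = 0"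
  obtains a where
    "\<And>p r. p < n \<Longrightarrow> r < n \<Longrightarrow> (\<Sum>q<n. k p q * a q r) = (if p = r then 1 else 0)"
proof -
  let ?K = "Matrix.mat n n (\<lambda>(p, q). k p q)"
  have K: "?K \<in> carrier_mat n n" by simp
  have "Determinant.det ?K \<noteq> 0"
  proof
    assume "Determinant.det ?K = 0"
    then obtain v where v: "v \<in> carrier_vec n" "v \<noteq> 0\<^sub>v n" "?K *\<^sub>v v = 0\<^sub>v n"
      using det_0_iff_vec_prod_zero_field[OF K] by auto
    have "(\<Sum>q<n. k p q * v $ q) = 0" if "p < n" for p
    proof -
      have "(\<Sum>q<n. k p q * v $ q) = (?K *\<^sub>v v) $ p"
        using v(1) that by (simp add: scalar_prod_def lessThan_atLeast0)
      then show ?thesis using v(3) that by simp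
    qed
    then have "v $ q = 0" if "q < n" for q using assms[of "\<lambda>q. v $ q"] that by blast
    then have "v = 0\<^sub>v n" using v(1) by (intro eq_vecI) auto
    then show False using v(2) by simp
  qed
  from det_non_zero_imp_unit[OF K this, of "()"]
  obtain A where A: "A \<in> carrier_mat n n" "?K * A = 1\<^sub>m n"
    unfolding Units_def ring_mat_def by auto
  show thesis
  proof (rule that[of "\<lambda>p q. A $$ (p, q)"])
    fix p r assume pr: "p < n" "r < n"
    have "(\<Sum>q<n. k p q * A $$ (q, r)) = (?K * A) $$ (p, r)"
      using A(1) pr by (simp add: scalar_prod_def lessThan_atLeast0)
    then show "(\<Sum>q<n. k p q * A $$ (q, r)) = (if p = r then 1 else 0)" using A(2) pr by simp
  qed
qed

section \<open>Inversion of the generator and charges on finite sets\<close>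

context markov_semigroup begin

lemma summable_Q_mult:
  assumes "\<And>i. \<bar>g i\<bar> \<le> B"
  shows "summable (\<lambda>i. \<bar>Q j i * g i\<bar>)" "summable (\<lambda>i. Q j i * g i)"
proof -
  show s: "summable (\<lambda>i. \<bar>Q j i * g i\<bar>)"
  proof (rule summable_comparison_test')
    show "summable (\<lambda>i. \<bar>Q j i\<bar> * B)" by (rule summable_mult2[OF Q_summable])
    show "norm \<bar>Q j n * g n\<bar> \<le> \<bar>Q j n\<bar> * B" for n
      using assms by (simp add: abs_mult mult_left_mono)
  qed
  show "summable (\<lambda>i. Q j i * g i)" by (rule summable_rabs_cancel[OF s])
qed

text \<open>Associativity \<open>U (Q f) = (U Q) f\<close>, where \<open>U Q = - I\<close> is the
  transpose of \<open>Q_U\<close> since both matrices are symmetric. Fubini applies because the rows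
  of \<open>U\<close> are summable and those of \<open>Q\<close> have absolute sum at most
  \<open>C\<close>.\<close>

lemma potential_of_minus_Q:
  assumes f: "\<And>i. \<bar>f i\<bar> \<le> B"
  shows "(\<lambda>k. U j k * - (\<Sum>i. Q k i * f i)) sums f j"
proof -
  have B: "0 \<le> B" using f[of 0] by linarith
  let ?a = "\<lambda>k i. U j k * (Q k i * f i)"
  have sa: "summable (\<lambda>i. \<bar>?a k i\<bar>)" for k
    unfolding abs_mult[of "U j k"] by (intro summable_mult summable_Q_mult(1)[OF f])
  have bd: "(\<Sum>i. \<bar>?a k i\<bar>) \<le> U j k * (C * B)" for k
  proof -
    have "(\<Sum>i. \<bar>?a k i\<bar>) = U j k * (\<Sum>i. \<bar>Q k i * f i\<bar>)"
      unfolding abs_mult[of "U j k"] abs_of_nonneg[OF U_nonneg]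
      by (intro suminf_mult summable_Q_mult(1)[OF f])
    also have "(\<Sum>i. \<bar>Q k i * f i\<bar>) \<le> (\<Sum>i. \<bar>Q k i\<bar> * B)"
      by (intro suminf_le summable_Q_mult(1)[OF f] summable_mult2 Q_summable)
         (simp add: abs_mult mult_left_mono f)
    also have "\<dots> = (\<Sum>i. \<bar>Q k i\<bar>) * B" by (rule suminf_mult2[OF Q_summable, symmetric])
    also have "\<dots> \<le> C * B" using B Q_bound by (intro mult_right_mono)
    finally show ?thesis by (simp add: mult_left_mono U_nonneg)
  qed
  have sU: "summable (\<lambda>k. U j k * (C * B))" by (intro summable_mult2 U_summable)
  have "summable (\<lambda>k. \<Sum>i. \<bar>?a k i\<bar>)"
    by (rule summable_comparison_test'[OF sU]) (use bd suminf_nonneg[OF sa] in simp)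
  from sums_swap[OF sa this]
  have sw: "(\<lambda>i. \<Sum>k. ?a k i) sums (\<Sum>k. \<Sum>i. ?a k i)" .
  have col: "(\<Sum>k. ?a k i) = (if i = j then - f j else 0)" for i
  proof -
    have "(\<Sum>k. ?a k i) = (\<Sum>k. f i * (Q i k * U k j))"
      by (intro suminf_cong) (simp add: Q_sym[of i] U_sym[of _ j] mult_ac)
    also have "\<dots> = f i * (\<Sum>k. Q i k * U k j)"
      by (rule suminf_mult, rule summable_Q_mult(2)[where B = mass_bound]) (simp add: U_nonneg U_le)
    finally show ?thesis by (auto simp: Q_U)
  qed
  have "(\<Sum>k. \<Sum>i. ?a k i) = - f j"
    using sw sums_single[of j "\<lambda>_. - f j"] by (simp add: col sums_iff)
  moreover have row: "(\<Sum>i. ?a k i) = U j k * (\<Sum>i. Q k i * f i)" for k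
    by (rule suminf_mult[OF summable_Q_mult(2)[OF f]])
  moreover have "summable (\<lambda>k. \<Sum>i. ?a k i)"
  proof (rule summable_comparison_test'[OF sU])
    show "norm (\<Sum>i. ?a k i) \<le> U j k * (C * B)" for k
      using bd[of k] summable_rabs[OF sa[of k]] by simp
  qed
  ultimately have "(\<lambda>k. U j k * (\<Sum>i. Q k i * f i)) sums (- f j)" by (simp add: sums_iff)
  from sums_minus[OF this] show ?thesis by simp
qed

lemma U_tendsto_0: "(\<lambda>i. U i k) \<longlonglongrightarrow> 0"
  using summable_LIMSEQ_zero[OF U_summable[of k]] by (simp add: U_sym[of _ k])

text \<open>The potential of a signed charge with mass \<open>w q\<close> at the point
  \<open>\<sigma> q\<close>. Applying \<open>Q\<close> recovers minus the charge, so the function is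
  harmonic off these points.\<close>

definition combination :: "(nat \<Rightarrow> nat) \<Rightarrow> nat \<Rightarrow> (nat \<Rightarrow> real) \<Rightarrow> nat \<Rightarrow> real" where
  "combination \<sigma> n w i = (\<Sum>q<n. U i (\<sigma> q) * w q)"

lemma combination_tendsto_0: "combination \<sigma> n w \<longlonglongrightarrow> 0"
  unfolding combination_def by (intro tendsto_null_sum tendsto_mult_left_zero U_tendsto_0)

lemma combination_bounded: "\<exists>B. \<forall>i. \<bar>combination \<sigma> n w i\<bar> \<le> B"
  using convergent_imp_bounded[OF combination_tendsto_0[of \<sigma> n w]]
  by (auto simp: bounded_iff)

lemma Q_combination: "(\<Sum>j. Q i j * combination \<sigma> n w j) = - (\<Sum>q<n. if i = \<sigma> q then w q else 0)"
proof -
  have "(\<Sum>j. Q i j * combination \<sigma> n w j) = (\<Sum>j. \<Sum>q<n. Q i j * U j (\<sigma> q) * w q)"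
    by (simp add: combination_def sum_distrib_left mult.assoc)
  also have "\<dots> = (\<Sum>q<n. \<Sum>j. Q i j * U j (\<sigma> q) * w q)"
    by (intro suminf_sum summable_mult2 summable_Q_mult(2)[where B = mass_bound])
       (simp add: U_nonneg U_le)
  also have "\<dots> = (\<Sum>q<n. (\<Sum>j. Q i j * U j (\<sigma> q)) * w q)"
    by (intro sum.cong refl suminf_mult2[symmetric] summable_Q_mult(2)[where B = mass_bound])
       (simp add: U_nonneg U_le)
  also have "\<dots> = - (\<Sum>q<n. if i = \<sigma> q then w q else 0)"
    unfolding Q_U sum_negf[symmetric] by (intro sum.cong) auto
  finally show ?thesis .
qed

lemma Q_combination_at:
  assumes "inj_on \<sigma> {..<n}" "r < n"
  shows "(\<Sum>j. Q (\<sigma> r) j * combination \<sigma> n w j) = - w r"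
proof -
  have "(\<Sum>q<n. if \<sigma> r = \<sigma> q then w q else 0) = (\<Sum>q<n. if q = r then w q else 0)"
    using assms by (intro sum.cong) (auto simp: inj_on_def)
  then show ?thesis using assms by (simp add: Q_combination)
qed

text \<open>The potential vanishes at infinity, so a positive value is dominated by a maximum
  attained at some \<open>m\<close>. There \<open>Q\<close> applied to the potential is at most
  \<open>- \<delta>\<close> times the maximum, hence negative, which is possible only at a charged
  point.\<close>

lemma maximum_principle:
  assumes "0 < combination \<sigma> n w i"
  obtains q where "q < n" "combination \<sigma> n w i \<le> combination \<sigma> n w (\<sigma> q)"
proof -
  let ?u = "combination \<sigma> n w"
  have "\<forall>\<^sub>F l in sequentially. ?u l < ?u i"
    using order_tendstoD(2)[OF combination_tendsto_0 assms] .
  then obtain L where L: "\<And>l. L \<le> l \<Longrightarrow> ?u l < ?u i"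
    by (auto simp: eventually_sequentially)
  let ?S = "{l. ?u i \<le> ?u l}"
  have "?S \<subseteq> {..<L}" using L by (force simp: not_less[symmetric])
  then have fin: "finite ?S" by (rule finite_subset) simp
  have ne: "?S \<noteq> {}" by auto
  have "Max (?u ` ?S) \<in> ?u ` ?S" using fin ne by (intro Max_in) auto
  then obtain m where m: "?u i \<le> ?u m" "?u m = Max (?u ` ?S)" by auto
  have max: "?u l \<le> ?u m" for l
  proof (cases "?u i \<le> ?u l")
    case True then show ?thesis unfolding m(2) using fin by (intro Max_ge) auto
  next
    case False then show ?thesis using m(1) by simp
  qed
  have um: "0 < ?u m" using m(1) assms by simp
  obtain B where B: "\<And>i. \<bar>?u i\<bar> \<le> B" using combination_bounded by blast
  have "(\<Sum>j. Q m j * ?u j) \<le> (\<Sum>j. Q m j * ?u m)"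
  proof (rule suminf_le)
    show "Q m j * ?u j \<le> Q m j * ?u m" for j
      using Q_off_diag[of m j] max by (cases "j = m") (auto intro: mult_left_mono)
    show "summable (\<lambda>j. Q m j * ?u m)"
      by (rule summable_Q_mult[where B = "\<bar>?u m\<bar>"]) simp
  qed (rule summable_Q_mult[OF B])
  also have "\<dots> = (\<Sum>j. Q m j) * ?u m"
    by (rule suminf_mult2[symmetric]) (rule summable_rabs_cancel[OF Q_summable])
  also have "\<dots> \<le> - \<delta> * ?u m" using Q_row um by (intro mult_right_mono) auto
  also have "\<dots> < 0" using \<delta>_pos um by simp
  finally have "(\<Sum>q<n. if m = \<sigma> q then w q else 0) \<noteq> 0" by (simp add: Q_combination)
  then obtain q where "q \<in> {..<n}" "(if m = \<sigma> q then w q else 0) \<noteq> 0"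
    by (rule sum.not_neutral_contains_not_neutral)
  then have "q < n" "m = \<sigma> q" by (auto split: if_splits)
  then show thesis using that m(1) by blast
qed

text \<open>
  The signs of the entries and of the row sums of the inverse (which is thus an M-matrix) come from
  the maximum principle for the potentials whose densities are its columns or its row sums.
\<close>

lemma restricted_inverse:
  fixes \<sigma> :: "nat \<Rightarrow> nat" and n :: nat
  assumes \<sigma>: "inj_on \<sigma> {..<n}"
  obtains a where
    "\<And>p r. p < n \<Longrightarrow> r < n \<Longrightarrow> (\<Sum>q<n. U (\<sigma> p) (\<sigma> q) * a q r) = (if p = r then 1 else 0)"
    "\<And>p r. p < n \<Longrightarrow> r < n \<Longrightarrow> a p r = a r p"
    "\<And>p r. p < n \<Longrightarrow> r < n \<Longrightarrow> p \<noteq> r \<Longrightarrow> a p r \<le> 0"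
    "\<And>p. p < n \<Longrightarrow> \<delta> \<le> (\<Sum>q<n. a p q)"
    "\<And>g r B. (\<And>i. \<bar>g i\<bar> \<le> B) \<Longrightarrow> (\<And>j. (\<Sum>i. Q j i * g i) \<le> 0) \<Longrightarrow> r < n \<Longrightarrow>
        0 \<le> (\<Sum>p<n. g (\<sigma> p) * a p r)"
proof -
  let ?u = "combination \<sigma> n"
  \<comment> \<open>A vector in the kernel has a potential vanishing on the charged points, hence
    everywhere by the maximum principle for \<open>w\<close> and \<open>- w\<close>; then
    \<open>Q\<close> shows that the charge is zero.\<close>
  have inj0: "w q = 0"
    if w: "\<And>p. p < n \<Longrightarrow> (\<Sum>q<n. U (\<sigma> p) (\<sigma> q) * w q) = 0" and q: "q < n" for w q
  proof -
    have u: "?u w (\<sigma> p) = 0" if "p < n" for p using w[OF that] by (simp add: combination_def)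
    have mu: "?u (\<lambda>q. - w q) i = - ?u w i" for i by (simp add: combination_def sum_negf)
    have "?u w i = 0" for i
    proof (rule ccontr)
      assume "?u w i \<noteq> 0"
      then consider "0 < ?u w i" | "0 < ?u (\<lambda>q. - w q) i" using mu[of i] by linarith
      then show False
      proof cases
        case 1
        from maximum_principle[OF this] obtain q where "q < n" "?u w i \<le> ?u w (\<sigma> q)" .
        with 1 u show False by simp
      next
        case 2
        from maximum_principle[OF this] obtain q where "q < n" "?u (\<lambda>q. - w q) i \<le> - ?u w (\<sigma> q)"
          unfolding mu .
        with 2 u show False unfolding mu by simp
      qed
    qed
    then have "(\<Sum>j. Q (\<sigma> q) j * ?u w j) = 0" by simp
    then show "w q = 0" using Q_combination_at[OF \<sigma> q, of w] by simp
  qed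
  obtain a where Ua: "\<And>p r. p < n \<Longrightarrow> r < n \<Longrightarrow> (\<Sum>q<n. U (\<sigma> p) (\<sigma> q) * a q r) = (if p = r then 1 else 0)"
  proof (rule square_system_inverse[of n "\<lambda>p q. U (\<sigma> p) (\<sigma> q)"])
    show "w q = 0" if "\<And>p. p < n \<Longrightarrow> (\<Sum>q<n. U (\<sigma> p) (\<sigma> q) * w q) = 0" "q < n" for w q
      using that by (rule inj0)
  qed (rule that, assumption+)
  have sym: "a p r = a r p" if "p < n" "r < n" for p r
  proof -
    \<comment> \<open>Transpose of \<open>a\<close>, times the restricted \<open>U\<close>, times
      \<open>a\<close>: evaluated in two orders, this gives the two entries to be compared.\<close>
    have "(\<Sum>q<n. \<Sum>s<n. a q p * (U (\<sigma> q) (\<sigma> s) * a s r)) = (\<Sum>q<n. a q p * (if q = r then 1 else 0))"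
      using that by (intro sum.cong refl) (simp add: sum_distrib_left[symmetric] Ua)
    also have "\<dots> = a r p" using that by (simp add: if_distrib cong: if_cong)
    finally have 1: "(\<Sum>q<n. \<Sum>s<n. a q p * (U (\<sigma> q) (\<sigma> s) * a s r)) = a r p" .
    have "(\<Sum>q<n. \<Sum>s<n. a q p * (U (\<sigma> q) (\<sigma> s) * a s r))
        = (\<Sum>s<n. \<Sum>q<n. a q p * (U (\<sigma> q) (\<sigma> s) * a s r))"
      by (rule sum.swap)
    also have "\<dots> = (\<Sum>s<n. \<Sum>q<n. U (\<sigma> s) (\<sigma> q) * a q p * a s r)"
    proof (intro sum.cong refl)
      fix s q
      have "a q p * (U (\<sigma> q) (\<sigma> s) * a s r) = a q p * (U (\<sigma> s) (\<sigma> q) * a s r)"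
        by (rule arg_cong[OF U_sym])
      also have "\<dots> = U (\<sigma> s) (\<sigma> q) * a q p * a s r" by (simp only: mult_ac)
      finally show "a q p * (U (\<sigma> q) (\<sigma> s) * a s r) = U (\<sigma> s) (\<sigma> q) * a q p * a s r" .
    qed
    also have "\<dots> = (\<Sum>s<n. (\<Sum>q<n. U (\<sigma> s) (\<sigma> q) * a q p) * a s r)"
      by (simp only: sum_distrib_right)
    also have "\<dots> = (\<Sum>s<n. (if s = p then 1 else 0) * a s r)"
      using that by (intro sum.cong refl) (simp add: Ua)
    also have "\<dots> = (\<Sum>s<n. if s = p then a s r else 0)" by (intro sum.cong) auto
    also have "\<dots> = a p r" using that by simp
    finally show ?thesis using 1 by simp
  qed
  \<comment> \<open>The potential with value 1 at \<open>\<sigma> r\<close> and 0 at the other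
    selected points; its charge is column \<open>r\<close> of the inverse.\<close>
  define u where "u r = ?u (\<lambda>q. a q r)" for r
  have u_at: "u r (\<sigma> p) = (if p = r then 1 else 0)" if "p < n" "r < n" for p r
    using Ua[OF that] by (simp add: u_def combination_def)
  have u_nonneg: "0 \<le> u r i" if r: "r < n" for r i
  proof (rule ccontr)
    have mu: "?u (\<lambda>q. - a q r) i = - u r i" for i
      by (simp add: combination_def u_def sum_negf)
    assume "\<not> 0 \<le> u r i"
    then have "0 < ?u (\<lambda>q. - a q r) i" using mu by simp
    from maximum_principle[OF this] obtain q where "q < n" "- u r i \<le> - u r (\<sigma> q)"
      unfolding mu .
    then show False using u_at[of q r] r \<open>\<not> 0 \<le> u r i\<close> by (simp split: if_splits)
  qed
  have Qu: "(\<Sum>j. Q (\<sigma> p) j * u r j) = - a p r" if "p < n" for p r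
    unfolding u_def by (rule Q_combination_at[OF \<sigma> that])
  \<comment> \<open>At \<open>\<sigma> p\<close> the nonnegative function \<open>u r\<close> attains
    its minimum 0, so \<open>Q\<close> applied to it is nonnegative there; this value is
    \<open>- a p r\<close>.\<close>
  have off: "a p r \<le> 0" if "p < n" "r < n" "p \<noteq> r" for p r
  proof -
    obtain B where B: "\<And>i. \<bar>u r i\<bar> \<le> B" unfolding u_def using combination_bounded by blast
    have "0 \<le> (\<Sum>j. Q (\<sigma> p) j * u r j)"
    proof (rule suminf_nonneg[OF summable_Q_mult(2)[OF B]])
      fix j show "0 \<le> Q (\<sigma> p) j * u r j"
        using Q_off_diag[of "\<sigma> p" j] u_nonneg[OF that(2)] u_at[OF that(1,2)] that(3)
        by (cases "j = \<sigma> p") auto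
    qed
    then show ?thesis using Qu[OF that(1)] by simp
  qed
  \<comment> \<open>The row sums form the equilibrium charge: its potential is 1 on the selected
    points and at most 1 elsewhere, so comparison with the constant 1 brings in the killing
    rate.\<close>
  have row: "\<delta> \<le> (\<Sum>q<n. a p q)" if p: "p < n" for p
  proof -
    define w where "w q = (\<Sum>r<n. a q r)" for q
    have at: "?u w (\<sigma> p) = 1" if "p < n" for p
    proof -
      have "?u w (\<sigma> p) = (\<Sum>r<n. \<Sum>q<n. U (\<sigma> p) (\<sigma> q) * a q r)"
        unfolding combination_def w_def by (simp add: sum_distrib_left) (rule sum.swap)
      also have "\<dots> = 1" using that by (simp add: Ua)
      finally show ?thesis .
    qed
    have le1: "?u w i \<le> 1" for i
    proof (rule ccontr)
      assume i: "\<not> ?u w i \<le> 1"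
      then have "0 < ?u w i" by simp
      from maximum_principle[OF this] obtain q where "q < n" "?u w i \<le> ?u w (\<sigma> q)" .
      then show False using at i by simp
    qed
    obtain B where B: "\<And>i. \<bar>?u w i\<bar> \<le> B" using combination_bounded by blast
    have "- w p = (\<Sum>j. Q (\<sigma> p) j * ?u w j)" using Q_combination_at[OF \<sigma> p] by simp
    also have "\<dots> \<le> (\<Sum>j. Q (\<sigma> p) j)"
    proof (rule suminf_le[OF _ summable_Q_mult(2)[OF B] summable_rabs_cancel[OF Q_summable]])
      show "Q (\<sigma> p) j * ?u w j \<le> Q (\<sigma> p) j" for j
        using Q_off_diag[of "\<sigma> p" j] le1[of j] at[OF p] mult_left_mono[of "?u w j" 1 "Q (\<sigma> p) j"]
        by (cases "j = \<sigma> p") auto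
    qed
    also have "\<dots> \<le> - \<delta>" by (rule Q_row)
    finally show ?thesis by (simp add: w_def)
  qed
  have exc: "0 \<le> (\<Sum>p<n. g (\<sigma> p) * a p r)"
    if g: "\<And>i. \<bar>g i\<bar> \<le> B" "\<And>j. (\<Sum>i. Q j i * g i) \<le> 0" and r: "r < n" for g r B
  proof -
    \<comment> \<open>As \<open>g = U ?h\<close> with \<open>?h \<ge> 0\<close>, the sum in question
      is the pairing of \<open>?h\<close> with the nonnegative function \<open>u r\<close>.\<close>
    let ?h = "\<lambda>k. - (\<Sum>i. Q k i * g i)"
    have "(\<lambda>k. \<Sum>p<n. U (\<sigma> p) k * ?h k * a p r) sums (\<Sum>p<n. g (\<sigma> p) * a p r)"
      by (intro sums_sum sums_mult2 potential_of_minus_Q[of g B] g(1))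
    moreover have "0 \<le> (\<Sum>p<n. U (\<sigma> p) k * ?h k * a p r)" for k
    proof -
      have "(\<Sum>p<n. U (\<sigma> p) k * ?h k * a p r) = ?h k * u r k"
        unfolding u_def combination_def sum_distrib_left
        by (intro sum.cong refl) (subst U_sym[of k], simp)
      then show ?thesis using g(2)[of k] u_nonneg[OF r, of k] by (simp add: mult_nonpos_nonneg)
    qed
    ultimately show ?thesis by (rule sums_le[OF _ sums_zero, rotated])
  qed
  show thesis by (rule that[OF Ua sym off row exc])
qed

end

section \<open>The rank one perturbation\<close>

context markov_semigroup begin

text \<open>
  The rank one perturbation \<open>1 f\<^sup>T\<close> only decreases the entries of the inverse, by the
  Sherman--Morrison formula, so that the diagonal bound does not involve \<open>f\<close>.
\<close>

lemma permanental_kernel_inverse: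
  fixes \<sigma> :: "nat \<Rightarrow> nat" and n :: nat
  assumes \<sigma>: "inj_on \<sigma> {..<n}"
    and f: "\<And>i. 0 \<le> f i" "\<And>i. \<bar>f i\<bar> \<le> B" "\<And>j. (\<Sum>i. Q j i * f i) \<le> 0"
    and \<eta>: "0 \<le> \<eta>"
    and sep: "\<And>q r. q < n \<Longrightarrow> r < n \<Longrightarrow> q \<noteq> r \<Longrightarrow> U (\<sigma> q) (\<sigma> r) \<le> \<eta>"
  obtains b where
    "\<And>q r. q < n \<Longrightarrow> r < n \<Longrightarrow>
      (\<Sum>s<n. (U (\<sigma> q) (\<sigma> s) + f (\<sigma> s)) * b s r) = (if q = r then 1 else 0)"
    "\<And>q r. q < n \<Longrightarrow> r < n \<Longrightarrow> q \<noteq> r \<Longrightarrow> b q r \<le> 0"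
    "\<And>q. q < n \<Longrightarrow> 0 < (\<Sum>r<n. b q r)"
    "\<And>q. q < n \<Longrightarrow> b q q * (U (\<sigma> q) (\<sigma> q) - \<eta>) \<le> 1"
    "\<And>q. q < n \<Longrightarrow> 1 \<le> b q q * (U (\<sigma> q) (\<sigma> q) + f (\<sigma> q))"
proof -
  obtain a where
    Ua: "\<And>q r. q < n \<Longrightarrow> r < n \<Longrightarrow> (\<Sum>s<n. U (\<sigma> q) (\<sigma> s) * a s r) = (if q = r then 1 else 0)" and
    sym: "\<And>q r. q < n \<Longrightarrow> r < n \<Longrightarrow> a q r = a r q" and
    off: "\<And>q r. q < n \<Longrightarrow> r < n \<Longrightarrow> q \<noteq> r \<Longrightarrow> a q r \<le> 0" and
    row: "\<And>q. q < n \<Longrightarrow> \<delta> \<le> (\<Sum>s<n. a q s)" and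
    exc: "\<And>g r B. (\<And>i. \<bar>g i\<bar> \<le> B) \<Longrightarrow> (\<And>j. (\<Sum>i. Q j i * g i) \<le> 0) \<Longrightarrow> r < n \<Longrightarrow>
        0 \<le> (\<Sum>q<n. g (\<sigma> q) * a q r)"
    by (rule restricted_inverse[OF \<sigma>]) blast
  \<comment> \<open>In Sherman--Morrison the correction is the product of \<open>a\<close> applied
    to the constant 1 (\<open>R\<close>) and of \<open>f\<close> applied to \<open>a\<close>
    (\<open>F\<close>), divided by \<open>D\<close>.\<close>
  define R where "R q = (\<Sum>r<n. a q r)" for q
  define F where "F r = (\<Sum>q<n. f (\<sigma> q) * a q r)" for r
  define D where "D = 1 + (\<Sum>q<n. f (\<sigma> q) * R q)"
  define b where "b q r = a q r - R q * F r / D" for q r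
  have R: "0 < R q" if "q < n" for q using row[OF that] \<delta>_pos by (simp add: R_def)
  \<comment> \<open>Excessiveness of \<open>f\<close> enters here: it makes the subtracted
    correction nonnegative.\<close>
  have F: "0 \<le> F r" if "r < n" for r unfolding F_def using exc[OF f(2,3) that] .
  have "0 \<le> (\<Sum>q<n. f (\<sigma> q) * R q)"
    by (intro sum_nonneg mult_nonneg_nonneg f(1) less_imp_le R) auto
  then have D: "1 \<le> D" by (simp add: D_def)
  have sumF: "(\<Sum>r<n. F r) = D - 1"
  proof -
    have "(\<Sum>r<n. F r) = (\<Sum>q<n. \<Sum>r<n. f (\<sigma> q) * a q r)"
      unfolding F_def by (rule sum.swap)
    then show ?thesis by (simp add: D_def R_def sum_distrib_left)
  qed
  have RF: "0 \<le> R q * F r / D" if "q < n" "r < n" for q r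
    using R[OF that(1)] F[OF that(2)] D by simp
  have UR: "(\<Sum>s<n. U (\<sigma> q) (\<sigma> s) * R s) = 1" if "q < n" for q
  proof -
    have "(\<Sum>s<n. U (\<sigma> q) (\<sigma> s) * R s) = (\<Sum>r<n. \<Sum>s<n. U (\<sigma> q) (\<sigma> s) * a s r)"
      unfolding R_def sum_distrib_left by (rule sum.swap)
    also have "\<dots> = 1" using that by (simp add: Ua)
    finally show ?thesis .
  qed
  have Kb: "(\<Sum>s<n. (U (\<sigma> q) (\<sigma> s) + f (\<sigma> s)) * b s r) = (if q = r then 1 else 0)"
    if q: "q < n" and r: "r < n" for q r
  proof -
    have "(\<Sum>s<n. (U (\<sigma> q) (\<sigma> s) + f (\<sigma> s)) * b s r)
        = (\<Sum>s<n. U (\<sigma> q) (\<sigma> s) * a s r) + F r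
          - ((\<Sum>s<n. U (\<sigma> q) (\<sigma> s) * R s) + (\<Sum>s<n. f (\<sigma> s) * R s)) * (F r / D)"
      unfolding b_def F_def sum_distrib_right sum.distrib[symmetric] sum_subtractf[symmetric]
      by (intro sum.cong) (auto simp: algebra_simps add_divide_distrib)
    also have "\<dots> = (if q = r then 1 else 0) + F r - D * (F r / D)"
      by (simp add: Ua[OF q r] UR[OF q] D_def)
    finally show ?thesis using D by simp
  qed
  have b_off: "b q r \<le> 0" if "q < n" "r < n" "q \<noteq> r" for q r
    using off[OF that] RF[OF that(1,2)] by (simp add: b_def)
  have b_row: "0 < (\<Sum>r<n. b q r)" if "q < n" for q
  proof -
    have "(\<Sum>r<n. b q r) = R q - R q * (\<Sum>r<n. F r) / D"
      by (simp add: b_def sum_subtractf R_def sum_divide_distrib sum_distrib_left)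
    also have "\<dots> = R q / D" using D by (simp add: sumF field_simps)
    finally show ?thesis using R[OF that] D by simp
  qed
  have b_pos: "0 < b q q" if q: "q < n" for q
  proof -
    have "(\<Sum>r<n. b q r) = b q q + (\<Sum>r\<in>{..<n} - {q}. b q r)"
      using q by (simp add: sum.remove)
    moreover have "(\<Sum>r\<in>{..<n} - {q}. b q r) \<le> 0"
      using b_off q by (intro sum_nonpos) auto
    ultimately show ?thesis using b_row[OF q] by linarith
  qed
  \<comment> \<open>In column \<open>q\<close> the off-diagonal entries of \<open>a\<close> sum to
    at least \<open>- a q q\<close>, since the total is positive. Weighted with entries of
    \<open>U\<close> of size at most \<open>\<eta>\<close>, they offset at most
    \<open>\<eta> * a q q\<close> of the diagonal term in \<open>U a = I\<close>.\<close>
  have a_diag: "a q q * (U (\<sigma> q) (\<sigma> q) - \<eta>) \<le> 1" if q: "q < n" for q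
  proof -
    have "a q q + (\<Sum>s\<in>{..<n} - {q}. a s q) = (\<Sum>s<n. a q s)"
      using q sym by (simp add: sum.remove)
    then have "0 \<le> a q q + (\<Sum>s\<in>{..<n} - {q}. a s q)"
      using row[OF q] \<delta>_pos by linarith
    from mult_left_mono[OF this \<eta>]
    have "- (\<eta> * a q q) \<le> (\<Sum>s\<in>{..<n} - {q}. \<eta> * a s q)"
      by (simp add: algebra_simps sum_distrib_left)
    also have "\<dots> \<le> (\<Sum>s\<in>{..<n} - {q}. U (\<sigma> q) (\<sigma> s) * a s q)"
      using q sep off by (intro sum_mono mult_right_mono_neg) auto
    also have "\<dots> = 1 - U (\<sigma> q) (\<sigma> q) * a q q"
      using Ua[OF q q] q by (simp add: sum.remove)
    finally show ?thesis by (simp add: algebra_simps)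
  qed
  have b_diag: "b q q * (U (\<sigma> q) (\<sigma> q) - \<eta>) \<le> 1" if q: "q < n" for q
  proof (cases "\<eta> \<le> U (\<sigma> q) (\<sigma> q)")
    case True
    have "b q q \<le> a q q" using RF[OF q q] by (simp add: b_def)
    then show ?thesis using True mult_right_mono[of "b q q" "a q q" "U (\<sigma> q) (\<sigma> q) - \<eta>"] a_diag[OF q] by simp
  next
    case False
    then have "b q q * (U (\<sigma> q) (\<sigma> q) - \<eta>) \<le> 0"
      using b_pos[OF q] by (simp add: mult_nonneg_nonpos)
    then show ?thesis by simp
  qed
  \<comment> \<open>In the diagonal entry of the kernel times \<open>b\<close>, all other terms are
    nonpositive. This keeps the gamma rates away from 0.\<close>
  have b_ge: "1 \<le> b q q * (U (\<sigma> q) (\<sigma> q) + f (\<sigma> q))" if q: "q < n" for q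
  proof -
    have "1 = (U (\<sigma> q) (\<sigma> q) + f (\<sigma> q)) * b q q
        + (\<Sum>s\<in>{..<n} - {q}. (U (\<sigma> q) (\<sigma> s) + f (\<sigma> s)) * b s q)"
      using Kb[OF q q] q by (simp add: sum.remove)
    also have "(\<Sum>s\<in>{..<n} - {q}. (U (\<sigma> q) (\<sigma> s) + f (\<sigma> s)) * b s q) \<le> 0"
      using b_off q U_nonneg f(1) by (intro sum_nonpos mult_nonneg_nonpos) auto
    finally show ?thesis by (simp add: mult.commute)
  qed
  show thesis by (rule that[OF Kb b_off b_row b_diag b_ge])
qed

end

section \<open>Mixtures of independent gamma variables\<close>

text \<open>
  Multiplied by \<open>\<Prod>i<n. (d i / (d i + s i)) powr \<alpha>\<close>, a member of this class is the Laplace transform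
  of a mixture of laws of independent gamma variables with rates \<open>d i\<close> and shapes \<open>\<alpha> + m i\<close>,
  \<open>m i \<in> \<nat>\<close>.  The functions matter only for \<open>s i \<ge> 0\<close>.
\<close>

inductive gamma_mix :: "nat \<Rightarrow> (nat \<Rightarrow> real) \<Rightarrow> ((nat \<Rightarrow> real) \<Rightarrow> real) \<Rightarrow> bool" for n d where
  monom: "0 \<le> c \<Longrightarrow> gamma_mix n d (\<lambda>s. c * (\<Prod>i<n. (d i / (d i + s i)) ^ m i))"
| sums: "(\<And>k::nat. gamma_mix n d (g k)) \<Longrightarrow>
    (\<And>s. (\<And>i. i < n \<Longrightarrow> 0 \<le> s i) \<Longrightarrow> (\<lambda>k. g k s) sums G s) \<Longrightarrow> gamma_mix n d G"

lemma gamma_mix_const: "0 \<le> c \<Longrightarrow> gamma_mix n d (\<lambda>s. c)"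
  using monom[of c n d "\<lambda>_. 0"] by simp

lemma gamma_mix_finite_sum:
  fixes N :: nat
  assumes "\<And>k. k < N \<Longrightarrow> gamma_mix n d (g k)"
    and "\<And>s. (\<And>i. i < n \<Longrightarrow> 0 \<le> s i) \<Longrightarrow> G s = (\<Sum>k<N. g k s)"
  shows "gamma_mix n d G"
proof (rule sums)
  show "gamma_mix n d (\<lambda>s. if k < N then g k s else 0)" for k
    using assms(1)[of k] gamma_mix_const[of 0] by (cases "k < N") auto
  fix s :: "nat \<Rightarrow> real" assume "\<And>i. i < n \<Longrightarrow> 0 \<le> s i"
  then show "(\<lambda>k. if k < N then g k s else 0) sums G s"
    using sums_If_finite_set[of "{..<N}" "\<lambda>k. g k s"] by (simp add: assms(2))
qed

text \<open>The rule \<open>sums\<close> tests functions only at nonnegative arguments, so a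
  one-term sum transfers membership to any function that agrees there.\<close>

lemma gamma_mix_cong:
  assumes "gamma_mix n d g" "\<And>s. (\<And>i. i < n \<Longrightarrow> 0 \<le> s i) \<Longrightarrow> G s = g s"
  shows "gamma_mix n d G"
  by (rule gamma_mix_finite_sum[of "Suc 0" n d "\<lambda>_. g"]) (use assms in auto)

lemma gamma_mix_add:
  assumes "gamma_mix n d g" "gamma_mix n d h"
  shows "gamma_mix n d (\<lambda>s. g s + h s)"
  by (rule gamma_mix_finite_sum[of "Suc (Suc 0)" n d "\<lambda>k. if k = 0 then g else h"])
     (use assms in auto)

lemma gamma_mix_monom_mult:
  assumes "gamma_mix n d h" "0 \<le> c"
  shows "gamma_mix n d (\<lambda>s. (c * (\<Prod>i<n. (d i / (d i + s i)) ^ m i)) * h s)"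
  using assms(1)
proof induction
  case (monom c' m')
  have "gamma_mix n d (\<lambda>s. (c * c') * (\<Prod>i<n. (d i / (d i + s i)) ^ (m i + m' i)))"
    using monom assms by (intro gamma_mix.monom) auto
  then show ?case by (simp add: power_add prod.distrib mult_ac)
next
  case (sums g G)
  show ?case by (rule gamma_mix.sums[OF sums.IH], rule sums_mult, rule sums.hyps(2))
qed

lemma gamma_mix_mult:
  assumes "gamma_mix n d g" "gamma_mix n d h"
  shows "gamma_mix n d (\<lambda>s. g s * h s)"
  using assms(1)
proof induction
  case (monom c m) then show ?case by (intro gamma_mix_monom_mult assms(2))
next
  case (sums g G)
  show ?case by (rule gamma_mix.sums[OF sums.IH], rule sums_mult2, rule sums.hyps(2))
qed

lemma gamma_mix_power: "gamma_mix n d g \<Longrightarrow> gamma_mix n d (\<lambda>s. g s ^ k)"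
  by (induction k) (auto intro: gamma_mix_const gamma_mix_mult)

lemma gamma_mix_nonneg:
  assumes "gamma_mix n d g" "\<And>i. i < n \<Longrightarrow> 0 < d i" "\<And>i. i < n \<Longrightarrow> 0 \<le> s i"
  shows "0 \<le> g s"
  using assms(1)
proof induction
  case (monom c m)
  then show ?case using assms(2,3)
    by (intro mult_nonneg_nonneg prod_nonneg zero_le_power divide_nonneg_nonneg add_nonneg_nonneg ballI)
       (auto intro: less_imp_le)
next
  case (sums g G)
  then show ?case using sums_le[OF sums.IH sums_zero sums.hyps(2)] assms(3) by simp
qed

text \<open>For \<open>\<alpha> > 0\<close> the binomial series of
  \<open>(1 - g) powr (- \<alpha>)\<close> has the nonnegative coefficients
  \<open>pochhammer \<alpha> k / fact k\<close>.\<close>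

lemma gamma_mix_one_minus_powr:
  assumes g: "gamma_mix n d g" and d: "\<And>i. i < n \<Longrightarrow> 0 < d i"
    and less: "\<And>s. (\<And>i. i < n \<Longrightarrow> 0 \<le> s i) \<Longrightarrow> g s < 1" and \<alpha>: "0 < \<alpha>"
  shows "gamma_mix n d (\<lambda>s. (1 - g s) powr (- \<alpha>))"
proof (rule sums)
  show "gamma_mix n d (\<lambda>s. (pochhammer \<alpha> k / fact k) * g s ^ k)" for k
    using \<alpha> by (intro gamma_mix_mult gamma_mix_const gamma_mix_power g) (simp add: pochhammer_nonneg)
  fix s :: "nat \<Rightarrow> real" assume s: "\<And>i. i < n \<Longrightarrow> 0 \<le> s i"
  have "\<bar>- g s\<bar> < 1" using gamma_mix_nonneg[OF g d, of s] less[of s] s by simp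
  from gen_binomial_real[OF this, of "- \<alpha>"]
  have "(\<lambda>k. (- \<alpha> gchoose k) * (- g s) ^ k) sums (1 - g s) powr (- \<alpha>)" by simp
  moreover have "(- \<alpha> gchoose k) * (- g s) ^ k = (pochhammer \<alpha> k / fact k) * g s ^ k" for k
  proof -
    have "(- 1 :: real) ^ k * (- g s) ^ k = g s ^ k" by (simp add: power_mult_distrib[symmetric])
    then show ?thesis by (simp add: gbinomial_pochhammer)
  qed
  ultimately show "(\<lambda>k. (pochhammer \<alpha> k / fact k) * g s ^ k) sums (1 - g s) powr (- \<alpha>)" by simp
qed

lemma gamma_mix_inverse_one_minus:
  assumes "gamma_mix n d g" "\<And>i. i < n \<Longrightarrow> 0 < d i"
    and "\<And>s. (\<And>i. i < n \<Longrightarrow> 0 \<le> s i) \<Longrightarrow> g s < 1"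
  shows "gamma_mix n d (\<lambda>s. 1 / (1 - g s))"
  by (rule gamma_mix_cong[OF gamma_mix_one_minus_powr[of n d g 1]])
     (use assms in \<open>auto simp: powr_minus inverse_eq_divide less_imp_le\<close>)

text \<open>One elimination step: the matrix is a lower triangular matrix with unit diagonal times
  one whose first column vanishes below the pivot. The remaining block is the Schur
  complement.\<close>

lemma det_pivot:
  fixes A :: "nat \<Rightarrow> nat \<Rightarrow> real"
  assumes "A 0 0 \<noteq> 0"
  shows "Determinant.det (Matrix.mat (Suc N) (Suc N) (\<lambda>(i, j). A i j))
    = A 0 0 * Determinant.det (Matrix.mat N N (\<lambda>(i, j). A (Suc i) (Suc j) - A (Suc i) 0 * A 0 (Suc j) / A 0 0))"
proof -
  let ?L = "Matrix.mat (Suc N) (Suc N) (\<lambda>(i, j). if i = j then 1 else if j = 0 then A i 0 / A 0 0 else 0)"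
  let ?R = "Matrix.mat (Suc N) (Suc N) (\<lambda>(i, j). if i = 0 then A 0 j else A i j - A i 0 * A 0 j / A 0 0)"
  let ?S = "Matrix.mat N N (\<lambda>(i, j). A (Suc i) (Suc j) - A (Suc i) 0 * A 0 (Suc j) / A 0 0)"
  have LR: "Matrix.mat (Suc N) (Suc N) (\<lambda>(i, j). A i j) = ?L * ?R"
  proof (rule eq_matI)
    fix i j assume "i < dim_row (?L * ?R)" "j < dim_col (?L * ?R)"
    then have ij: "i < Suc N" "j < Suc N" by auto
    let ?l = "\<lambda>k. if i = k then 1 else if k = 0 then A i 0 / A 0 0 else 0"
    let ?r = "\<lambda>k. if k = 0 then A 0 j else A k j - A k 0 * A 0 j / A 0 0"
    have "(?L * ?R) $$ (i, j) = (\<Sum>k<Suc N. ?l k * ?r k)"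
      using ij by (simp add: scalar_prod_def lessThan_atLeast0 del: sum.op_ivl_Suc sum.lessThan_Suc)
    also have "\<dots> = (\<Sum>k\<in>{0, i}. ?l k * ?r k)"
      using ij by (intro sum.mono_neutral_right) auto
    also have "\<dots> = A i j" using assms by (cases "i = 0") auto
    finally show "Matrix.mat (Suc N) (Suc N) (\<lambda>(i, j). A i j) $$ (i, j) = (?L * ?R) $$ (i, j)"
      using ij by simp
  qed auto
  have "Determinant.det ?L = 1"
    by (subst det_lower_triangular[of "Suc N"]) (auto simp: prod_list_diag_prod)
  moreover have "Determinant.det ?R = A 0 0 * Determinant.det ?S"
  proof -
    have "Determinant.det ?R = (\<Sum>i<Suc N. ?R $$ (i, 0) * cofactor ?R i 0)"
      by (rule laplace_expansion_column) auto
    also have "\<dots> = (\<Sum>i\<in>{0}. ?R $$ (i, 0) * cofactor ?R i 0)"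
      using assms by (intro sum.mono_neutral_right) auto
    also have "\<dots> = A 0 0 * Determinant.det (mat_delete ?R 0 0)" by (simp add: cofactor_def)
    also have "mat_delete ?R 0 0 = ?S"
      by (rule eq_matI) (auto simp: mat_delete_def)
    finally show ?thesis .
  qed
  moreover have "Determinant.det (?L * ?R) = Determinant.det ?L * Determinant.det ?R"
    by (rule det_mult[of _ "Suc N"]) auto
  ultimately show ?thesis unfolding LR by simp
qed

text \<open>
  Gaussian elimination preserves both the membership of the entries in the class and the bound on
  the row sums, and turns the determinant into a product of pivots.
\<close>

lemma gamma_mix_det:
  fixes M :: "nat \<Rightarrow> nat \<Rightarrow> (nat \<Rightarrow> real) \<Rightarrow> real"
  assumes "\<And>i. i < n \<Longrightarrow> 0 < d i" "0 < \<alpha>"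
    and "\<And>i j. i < N \<Longrightarrow> j < N \<Longrightarrow> gamma_mix n d (M i j)"
    and "\<And>s i. (\<And>i. i < n \<Longrightarrow> 0 \<le> s i) \<Longrightarrow> i < N \<Longrightarrow> (\<Sum>j<N. M i j s) < 1"
  defines "Dt \<equiv> \<lambda>s. Determinant.det (Matrix.mat N N (\<lambda>(i, j). (if i = j then 1 else 0) - M i j s))"
  shows "gamma_mix n d (\<lambda>s. Dt s powr (- \<alpha>))" (is ?thesis1)
    and "\<And>s. (\<And>i. i < n \<Longrightarrow> 0 \<le> s i) \<Longrightarrow> 0 < Dt s"
proof -
  have "?thesis1 \<and> (\<forall>s. (\<forall>i<n. 0 \<le> s i) \<longrightarrow> 0 < Dt s)"
    using assms(3,4) unfolding Dt_def
  proof (induction N arbitrary: M)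
    case 0
    have "Determinant.det (Matrix.mat 0 0 f) = 1" for f :: "nat \<times> nat \<Rightarrow> real"
      by (rule det_dim_zero) simp
    then show ?case by (simp add: gamma_mix_const)
  next
    case (Suc N)
    note M = Suc.prems(1)
    have nn: "0 \<le> M i j s" if "i < Suc N" "j < Suc N" "\<And>i. i < n \<Longrightarrow> 0 \<le> s i" for i j s
      by (rule gamma_mix_nonneg[OF M[OF that(1,2)] assms(1) that(3)])
    have row: "M i 0 s + (\<Sum>j<N. M i (Suc j) s) < 1"
      if "i < Suc N" "\<And>i. i < n \<Longrightarrow> 0 \<le> s i" for i s
      using Suc.prems(2)[OF that(2,1)] by (simp only: sum.lessThan_Suc_shift)
    have M00: "M 0 0 s < 1" if s: "\<And>i. i < n \<Longrightarrow> 0 \<le> s i" for s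
    proof -
      have "0 \<le> (\<Sum>j<N. M 0 (Suc j) s)" using nn[of _ _ s, OF _ _ s] by (intro sum_nonneg) auto
      then show ?thesis using row[of 0 s, OF _ s] by simp
    qed
    \<comment> \<open>The Schur complement of \<open>I - M\<close> is \<open>I - M'\<close>; in
      terms of paths, excursions through state 0 are summed up. The last \<open>N\<close> entries of
      row 0 sum to at most \<open>1 - M 0 0 s\<close>, so rerouting does not increase a row
      sum.\<close>
    define M' where "M' i j s = M (Suc i) (Suc j) s + M (Suc i) 0 s * M 0 (Suc j) s * (1 / (1 - M 0 0 s))" for i j s
    let ?D = "\<lambda>s. Determinant.det (Matrix.mat (Suc N) (Suc N) (\<lambda>(i, j). (if i = j then 1 else 0) - M i j s))"
    let ?D' = "\<lambda>s. Determinant.det (Matrix.mat N N (\<lambda>(i, j). (if i = j then 1 else 0) - M' i j s))"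
    have "gamma_mix n d (\<lambda>s. ?D' s powr (- \<alpha>)) \<and> (\<forall>s. (\<forall>i<n. 0 \<le> s i) \<longrightarrow> 0 < ?D' s)"
    proof (rule Suc.IH)
      show "gamma_mix n d (M' i j)" if "i < N" "j < N" for i j
        unfolding M'_def using that
        by (intro gamma_mix_add gamma_mix_mult gamma_mix_inverse_one_minus M assms M00) auto
      fix s :: "nat \<Rightarrow> real" and i assume s: "\<And>i. i < n \<Longrightarrow> 0 \<le> s i" and i: "i < N"
      have "(\<Sum>j<N. M' i j s) = (\<Sum>j<N. M (Suc i) (Suc j) s) + M (Suc i) 0 s * ((\<Sum>j<N. M 0 (Suc j) s) / (1 - M 0 0 s))"
        unfolding M'_def by (simp add: sum.distrib sum_distrib_left sum_divide_distrib)
      also have "M (Suc i) 0 s * ((\<Sum>j<N. M 0 (Suc j) s) / (1 - M 0 0 s)) \<le> M (Suc i) 0 s * 1"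
        using row[of 0 s, OF _ s] M00[OF s] i nn[of _ _ s, OF _ _ s] by (intro mult_left_mono) auto
      finally show "(\<Sum>j<N. M' i j s) < 1" using row[of "Suc i" s, OF _ s] i by simp
    qed
    then have IH: "gamma_mix n d (\<lambda>s. ?D' s powr (- \<alpha>))"
      "\<And>s. (\<And>i. i < n \<Longrightarrow> 0 \<le> s i) \<Longrightarrow> 0 < ?D' s" by auto
    have eq: "?D s = (1 - M 0 0 s) * ?D' s" if s: "\<And>i. i < n \<Longrightarrow> 0 \<le> s i" for s
    proof -
      have "?D s = (1 - M 0 0 s) * Determinant.det (Matrix.mat N N (\<lambda>(i, j).
          ((if Suc i = Suc j then 1 else 0) - M (Suc i) (Suc j) s)
          - ((if Suc i = 0 then 1 else 0) - M (Suc i) 0 s) * ((if 0 = Suc j then 1 else 0) - M 0 (Suc j) s)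
            / ((if 0 = (0::nat) then 1 else 0) - M 0 0 s)))"
        using det_pivot[of "\<lambda>i j. (if i = j then 1 else 0) - M i j s" N] M00[of s, OF s] by simp
      also have "Matrix.mat N N (\<lambda>(i, j).
          ((if Suc i = Suc j then 1 else 0) - M (Suc i) (Suc j) s)
          - ((if Suc i = 0 then 1 else 0) - M (Suc i) 0 s) * ((if 0 = Suc j then 1 else 0) - M 0 (Suc j) s)
            / ((if 0 = (0::nat) then 1 else 0) - M 0 0 s))
          = Matrix.mat N N (\<lambda>(i, j). (if i = j then 1 else 0) - M' i j s)"
        by (rule eq_matI) (auto simp: M'_def)
      finally show ?thesis .
    qed
    have "gamma_mix n d (\<lambda>s. (1 - M 0 0 s) powr (- \<alpha>) * ?D' s powr (- \<alpha>))"
      by (intro gamma_mix_mult IH gamma_mix_one_minus_powr M assms M00) auto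
    then have "gamma_mix n d (\<lambda>s. ?D s powr (- \<alpha>))"
      by (rule gamma_mix_cong) (use eq M00 IH(2) in \<open>simp add: powr_mult less_imp_le\<close>)
    moreover have "0 < ?D s" if "\<forall>i<n. 0 \<le> s i" for s
      using eq M00 IH(2) that by (simp add: zero_less_mult_iff)
    ultimately show ?case by blast
  qed
  then show ?thesis1 "\<And>s. (\<And>i. i < n \<Longrightarrow> 0 \<le> s i) \<Longrightarrow> 0 < Dt s" by blast+
qed

text \<open>As \<open>b\<close> inverts \<open>K\<close>, multiplying \<open>I + K S\<close> by
  \<open>b\<close> gives \<open>b + S\<close>, and taking the diagonal \<open>b i i + s i\<close>
  out of the rows leaves the matrix of \<open>Dt s\<close>. The case \<open>s = 0\<close> evaluates
  the determinant of \<open>b\<close>; keeping \<open>Dt (\<lambda>_. 0)\<close> as a factor avoids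
  a division.\<close>

lemma det_one_plus_eq:
  fixes K b :: "nat \<Rightarrow> nat \<Rightarrow> real"
  assumes Kb: "\<And>q r. q < n \<Longrightarrow> r < n \<Longrightarrow> (\<Sum>k<n. K q k * b k r) = (if q = r then 1 else 0)"
    and d: "\<And>i. i < n \<Longrightarrow> 0 < b i i" and s: "\<And>i. i < n \<Longrightarrow> 0 \<le> s i"
  defines "Dt \<equiv> \<lambda>s. Determinant.det (Matrix.mat n n (\<lambda>(i, j). (if i = j then 1 else 0) -
      (if i = j then 0 else - b i j / b i i) * (b i i / (b i i + s i))))"
  shows "Determinant.det (1\<^sub>m n + Matrix.mat n n (\<lambda>(i, j). K i j) * mat_diag n s) * Dt (\<lambda>_. 0)
    = (\<Prod>i<n. (b i i + s i) / b i i) * Dt s"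
proof -
  let ?K = "Matrix.mat n n (\<lambda>(i, j). K i j)" and ?b = "Matrix.mat n n (\<lambda>(i, j). b i j)"
  let ?A = "\<lambda>s. Matrix.mat n n (\<lambda>(i, j). (if i = j then 1 else 0) -
      (if i = j then 0 else - b i j / b i i) * (b i i / (b i i + s i)))"
  let ?T = "1\<^sub>m n + ?K * mat_diag n s"
  have Kb': "?K * ?b = 1\<^sub>m n"
    by (rule eq_matI) (auto simp: scalar_prod_def lessThan_atLeast0[symmetric] Kb)
  have bK: "?b * ?K = 1\<^sub>m n"
    by (rule mat_mult_left_right_inverse[OF _ _ Kb']) auto
  have split: "?b + mat_diag n s = mat_diag n (\<lambda>i. b i i + s i) * ?A s" if "\<And>i. i < n \<Longrightarrow> 0 \<le> s i" for s
  proof (subst mat_diag_mult_left[of _ n n], simp, rule eq_matI, goal_cases)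
    case (1 i j)
    then have "(b i i + s i) * (x * (b i i / (b i i + s i))) = x * b i i" "b i i \<noteq> 0" for x
      using d[of i] that[of i] by auto
    then show ?case using 1 by (auto simp: mat_diag_def right_diff_distrib)
  qed (auto simp: mat_diag_def)
  have det_diag: "Determinant.det (mat_diag n g) = (\<Prod>i<n. g i)" for g :: "nat \<Rightarrow> real"
    by (subst det_lower_triangular[of n])
       (auto simp: mat_diag_def prod_list_diag_prod lessThan_atLeast0)
  have fac: "Determinant.det (?b + mat_diag n s) = (\<Prod>i<n. b i i + s i) * Dt s"
    if "\<And>i. i < n \<Longrightarrow> 0 \<le> s i" for s
  proof -
    have "Determinant.det (mat_diag n (\<lambda>i. b i i + s i) * ?A s)
        = Determinant.det (mat_diag n (\<lambda>i. b i i + s i)) * Determinant.det (?A s)"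
      by (rule det_mult[of _ n]) auto
    then show ?thesis using split[of s, OF that] by (simp only: det_diag Dt_def)
  qed
  have KS: "?K * mat_diag n s \<in> carrier_mat n n"
    by (rule mult_carrier_mat[of _ n n _ n]) auto
  have "?b * ?T = ?b * 1\<^sub>m n + ?b * (?K * mat_diag n s)"
    by (rule mult_add_distrib_mat[of _ n n _ n]) (use KS in auto)
  also have "?b * (?K * mat_diag n s) = (?b * ?K) * mat_diag n s"
    by (rule assoc_mult_mat[symmetric, of _ n n _ n _ n]) auto
  also have "?b * 1\<^sub>m n = ?b" by (rule right_mult_one_mat[of _ n n]) simp
  also have "(?b * ?K) * mat_diag n s = mat_diag n s"
    unfolding bK by (rule left_mult_one_mat[of _ n n]) simp
  finally have "Determinant.det (?b * ?T) = (\<Prod>i<n. b i i + s i) * Dt s"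
    using fac[of s, OF s] by simp
  moreover have "Determinant.det (?b * ?T) = Determinant.det ?b * Determinant.det ?T"
    by (rule det_mult[of _ n]) (use KS in auto)
  moreover have "Determinant.det ?b = (\<Prod>i<n. b i i) * Dt (\<lambda>_. 0)"
  proof -
    have "?b + mat_diag n (\<lambda>_. 0) = ?b" by (rule eq_matI) (auto simp: mat_diag_def)
    then show ?thesis using fac[of "\<lambda>_. 0"] by simp
  qed
  moreover have "(\<Prod>i<n. b i i) \<noteq> 0" using d by force
  ultimately have "(\<Prod>i<n. b i i) * (Determinant.det ?T * Dt (\<lambda>_. 0)) = (\<Prod>i<n. b i i + s i) * Dt s"
    by (simp only: mult_ac)
  then show ?thesis using \<open>(\<Prod>i<n. b i i) \<noteq> 0\<close> by (simp add: prod_dividef field_simps)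
qed

text \<open>The witness is the power \<open>- \<alpha>\<close> of the determinant in
  \<open>det_one_plus_eq\<close>; \<open>gamma_mix_det\<close> applies because positive row sums of
  \<open>b\<close> are what makes the row sums of \<open>m\<close> less than 1. The value
  \<open>\<psi> (\<lambda>_. 0)\<close> is the total mass of the mixture before
  normalization.\<close>

lemma permanental_laplace_gamma_mix:
  fixes K b :: "nat \<Rightarrow> nat \<Rightarrow> real"
  assumes Kb: "\<And>q r. q < n \<Longrightarrow> r < n \<Longrightarrow> (\<Sum>k<n. K q k * b k r) = (if q = r then 1 else 0)"
    and off: "\<And>q r. q < n \<Longrightarrow> r < n \<Longrightarrow> q \<noteq> r \<Longrightarrow> b q r \<le> 0"
    and row: "\<And>q. q < n \<Longrightarrow> 0 < (\<Sum>r<n. b q r)"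
    and d: "\<And>i. i < n \<Longrightarrow> 0 < b i i" and \<alpha>: "0 < \<alpha>"
  obtains \<psi> where "gamma_mix n (\<lambda>i. b i i) \<psi>" "0 < \<psi> (\<lambda>_. 0)"
    "\<And>s. (\<And>i. i < n \<Longrightarrow> 0 \<le> s i) \<Longrightarrow>
      Determinant.det (1\<^sub>m n + Matrix.mat n n (\<lambda>(i, j). K i j) * mat_diag n s) powr (- \<alpha>) * \<psi> (\<lambda>_. 0)
      = \<psi> s * (\<Prod>i<n. (b i i / (b i i + s i)) powr \<alpha>)"
proof -
  let ?d = "\<lambda>i. b i i"
  define m where "m i j s = (if i = j then 0 else - b i j / b i i) * (b i i / (b i i + s i))" for i j and s :: "nat \<Rightarrow> real"
  define Dt where "Dt s = Determinant.det (Matrix.mat n n (\<lambda>(i, j). (if i = j then 1 else 0) - m i j s))" for s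
  have mix: "gamma_mix n ?d (m i j)" if "i < n" "j < n" for i j
  proof -
    have "gamma_mix n ?d (\<lambda>s. (if i = j then 0 else - b i j / b i i) *
        (\<Prod>k<n. (b k k / (b k k + s k)) ^ (if k = i then 1 else 0)))"
      using off[OF that] d[OF that(1)] by (intro monom) (auto simp: divide_nonpos_pos)
    moreover have "(\<Prod>k<n. (b k k / (b k k + s k)) ^ (if k = i then 1 else 0)) = b i i / (b i i + s i)" for s :: "nat \<Rightarrow> real"
      using that by (subst prod.remove[of _ i]) auto
    ultimately show ?thesis by (simp add: m_def[abs_def])
  qed
  have sum: "(\<Sum>j<n. m i j s) < 1" if s: "\<And>i. i < n \<Longrightarrow> 0 \<le> s i" and i: "i < n" for s i
  proof -
    have "(\<Sum>j<n. m i j s) = (\<Sum>j\<in>{..<n} - {i}. - b i j) / (b i i + s i)"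
      using i d[OF i] by (simp add: m_def sum.remove[of _ i] sum_divide_distrib)
    also have "\<dots> = (b i i - (\<Sum>j<n. b i j)) / (b i i + s i)"
      using i by (simp add: sum.remove[of "{..<n}" i "b i"] sum_negf)
    also have "\<dots> < 1" using row[OF i] s[OF i] d[OF i] by simp
    finally show ?thesis .
  qed
  have md: "gamma_mix n ?d (\<lambda>s. Dt s powr (- \<alpha>))" "\<And>s. (\<And>i. i < n \<Longrightarrow> 0 \<le> s i) \<Longrightarrow> 0 < Dt s"
    unfolding Dt_def
    by (rule gamma_mix_det(1)[of n ?d \<alpha> n m, OF d \<alpha> mix sum]; auto)
       (rule gamma_mix_det(2)[of n ?d \<alpha> n m, OF d \<alpha> mix sum]; auto)
  show thesis
  proof (rule that)
    show "gamma_mix n ?d (\<lambda>s. Dt s powr (- \<alpha>))" by (rule md(1))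
    have D0: "0 < Dt (\<lambda>_. 0)" by (rule md(2)) auto
    then show "0 < Dt (\<lambda>_. 0) powr (- \<alpha>)" by simp
    fix s :: "nat \<Rightarrow> real" assume s: "\<And>i. i < n \<Longrightarrow> 0 \<le> s i"
    let ?T = "Determinant.det (1\<^sub>m n + Matrix.mat n n (\<lambda>(i, j). K i j) * mat_diag n s)"
    let ?P = "\<Prod>i<n. (b i i + s i) / b i i"
    have Ds: "0 < Dt s" by (rule md(2)) (rule s)
    have P: "0 < ?P" using d s by (intro prod_pos) (auto intro!: divide_pos_pos add_pos_nonneg)
    have e: "?T * Dt (\<lambda>_. 0) = ?P * Dt s"
      using det_one_plus_eq[of n K b s, OF Kb d s] by (simp add: Dt_def m_def)
    have "0 < ?T * Dt (\<lambda>_. 0)" unfolding e using P Ds by (rule mult_pos_pos)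
    then have T: "0 < ?T" using D0 by (rule zero_less_mult_pos2)
    have "?P powr (- \<alpha>) = (\<Prod>i<n. ((b i i + s i) / b i i) powr (- \<alpha>))"
      by (rule prod_powr_distrib)
    also have "\<dots> = (\<Prod>i<n. (b i i / (b i i + s i)) powr \<alpha>)"
    proof (rule prod.cong[OF refl])
      fix i assume "i \<in> {..<n}"
      then have "0 < (b i i + s i) / b i i" using d[of i] s[of i] by (intro divide_pos_pos) auto
      then show "((b i i + s i) / b i i) powr (- \<alpha>) = (b i i / (b i i + s i)) powr \<alpha>"
        by (simp add: powr_minus_divide powr_divide)
    qed
    finally have "(?T * Dt (\<lambda>_. 0)) powr (- \<alpha>) = (\<Prod>i<n. (b i i / (b i i + s i)) powr \<alpha>) * Dt s powr (- \<alpha>)"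
      unfolding e using P Ds by (simp add: powr_mult)
    then show "?T powr (- \<alpha>) * Dt (\<lambda>_. 0) powr (- \<alpha>) = Dt s powr (- \<alpha>) * (\<Prod>i<n. (b i i / (b i i + s i)) powr \<alpha>)"
      using T D0 by (simp add: powr_mult mult.commute)
  qed
qed

section \<open>Gamma laws\<close>

definition gamma_density :: "real \<Rightarrow> real \<Rightarrow> real \<Rightarrow> real" where
  "gamma_density \<beta> d z = (if 0 < z then d powr \<beta> * z powr (\<beta> - 1) * exp (- d * z) / Gamma \<beta> else 0)"

definition gamma_law :: "real \<Rightarrow> real \<Rightarrow> real measure" where
  "gamma_law \<beta> d = density lborel (\<lambda>z. ennreal (gamma_density \<beta> d z))"

lemma gamma_density_measurable [measurable]: "gamma_density \<beta> d \<in> borel_measurable borel"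
  unfolding gamma_density_def[abs_def] by measurable

lemma gamma_density_nonneg: "0 < \<beta> \<Longrightarrow> 0 \<le> gamma_density \<beta> d z"
  by (auto simp: gamma_density_def intro!: divide_nonneg_pos mult_nonneg_nonneg Gamma_real_pos)

lemma has_bochner_integral_gamma_density:
  assumes "0 < \<beta>" "0 < d"
  shows "has_bochner_integral lborel (gamma_density \<beta> d) 1"
proof (rule has_bochner_integral_nn_integral)
  have G: "0 < Gamma \<beta>" using assms by (rule_tac Gamma_real_pos)
  let ?f = "\<lambda>t. ennreal (indicator {0..} t * t powr (\<beta> - 1) / exp t)"
  have "ennreal (Gamma \<beta>) = \<bar>d\<bar> * (\<integral>\<^sup>+ z. ?f (0 + d * z) \<partial>lborel)"
    unfolding Gamma_conv_nn_integral_real[OF assms(1)]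
    by (rule nn_integral_real_affine) (use assms in auto)
  also have "\<dots> = (\<integral>\<^sup>+ z. d * ?f (0 + d * z) \<partial>lborel)"
    using assms by (subst nn_integral_cmult) auto
  also have "\<dots> = (\<integral>\<^sup>+ z. ennreal (Gamma \<beta>) * ennreal (gamma_density \<beta> d z) \<partial>lborel)"
  proof (rule nn_integral_cong)
    fix z :: real
    consider "z < 0" | "z = 0" | "0 < z" by linarith
    then show "d * ?f (0 + d * z) = ennreal (Gamma \<beta>) * ennreal (gamma_density \<beta> d z)"
    proof cases
      case 3
      have "d * (indicator {0..} (d * z) * (d * z) powr (\<beta> - 1) / exp (d * z))
          = d powr \<beta> * z powr (\<beta> - 1) * exp (- d * z)"
        using 3 assms by (simp add: powr_mult powr_diff exp_minus field_simps)
      also have "\<dots> = Gamma \<beta> * gamma_density \<beta> d z"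
        using 3 G by (simp add: gamma_density_def)
      finally show ?thesis
        using assms G by (simp add: ennreal_mult'[symmetric] gamma_density_nonneg)
    qed (use assms in \<open>auto simp: gamma_density_def indicator_def zero_le_mult_iff\<close>)
  qed
  also have "\<dots> = ennreal (Gamma \<beta>) * (\<integral>\<^sup>+ z. ennreal (gamma_density \<beta> d z) \<partial>lborel)"
    by (rule nn_integral_cmult) simp
  finally show "(\<integral>\<^sup>+ z. ennreal (gamma_density \<beta> d z) \<partial>lborel) = ennreal 1"
    using G by (cases "\<integral>\<^sup>+ z. ennreal (gamma_density \<beta> d z) \<partial>lborel")
      (auto simp: ennreal_mult'[symmetric] ennreal_mult_top)
qed (use assms in \<open>auto simp: gamma_density_nonneg\<close>)

lemma prob_space_gamma_law: "0 < \<beta> \<Longrightarrow> 0 < d \<Longrightarrow> prob_space (gamma_law \<beta> d)"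
proof (rule prob_spaceI)
  assume a: "0 < \<beta>" "0 < d"
  note h = has_bochner_integral_gamma_density[OF a]
  have "emeasure (gamma_law \<beta> d) (space (gamma_law \<beta> d)) = (\<integral>\<^sup>+ z. ennreal (gamma_density \<beta> d z) \<partial>lborel)"
    by (simp add: gamma_law_def emeasure_density)
  also have "\<dots> = ennreal 1"
    using nn_integral_eq_integral[of lborel "gamma_density \<beta> d"] h a
    by (simp add: has_bochner_integral_iff gamma_density_nonneg)
  finally show "emeasure (gamma_law \<beta> d) (space (gamma_law \<beta> d)) = 1" by simp
qed

lemma sets_gamma_law [simp, measurable_cong]: "sets (gamma_law \<beta> d) = sets borel"
  by (simp add: gamma_law_def)

lemma gamma_law_AE_pos: "AE z in gamma_law \<beta> d. 0 < z"
  unfolding gamma_law_def by (subst AE_density) (auto simp: gamma_density_def)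

lemma gamma_law_laplace:
  assumes "0 < \<beta>" "0 < d" "0 < d + s"
  shows "has_bochner_integral (gamma_law \<beta> d) (\<lambda>z. exp (- s * z)) ((d / (d + s)) powr \<beta>)"
  unfolding gamma_law_def
proof (rule has_bochner_integral_density)
  have "has_bochner_integral lborel (\<lambda>z. (d / (d + s)) powr \<beta> * gamma_density \<beta> (d + s) z) ((d / (d + s)) powr \<beta> * 1)"
    by (intro has_bochner_integral_mult_right has_bochner_integral_gamma_density assms)
  moreover have "(d / (d + s)) powr \<beta> * gamma_density \<beta> (d + s) z = gamma_density \<beta> d z *\<^sub>R exp (- s * z)" for z
    using assms by (auto simp: gamma_density_def powr_divide exp_add[symmetric] algebra_simps)
  ultimately show "has_bochner_integral lborel (\<lambda>z. gamma_density \<beta> d z *\<^sub>R exp (- s * z)) ((d / (d + s)) powr \<beta>)"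
    by simp
qed (use assms in \<open>auto simp: gamma_density_nonneg\<close>)

lemma gamma_density_Suc:
  assumes "0 < \<beta>" "0 < d"
  shows "gamma_density (\<beta> + 1) d z = (d * z / \<beta>) * gamma_density \<beta> d z"
proof (cases "0 < z")
  case True
  have "Gamma (\<beta> + 1) = \<beta> * Gamma \<beta>"
    using assms by (intro Gamma_plus1) auto
  moreover have "z powr \<beta> = z * z powr (\<beta> - 1)" "d powr (\<beta> + 1) = d * d powr \<beta>"
    using True assms by (auto simp: powr_diff powr_add)
  ultimately show ?thesis using True by (simp add: gamma_density_def)
qed (simp add: gamma_density_def)

text \<open>Raising the shape by 1 is size biasing: the density is multiplied by \<open>z\<close>
  divided by the mean \<open>\<beta> / d\<close>.\<close>

lemma gamma_law_Suc:
  fixes g :: "real \<Rightarrow> real"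
  assumes "0 < \<beta>" "0 < d" and g[measurable]: "g \<in> borel_measurable borel" and B: "\<And>z. 0 < z \<Longrightarrow> \<bar>g z\<bar> \<le> B"
  shows "integrable (gamma_law \<beta> d) (\<lambda>z. d * z / \<beta> * g z)"
    and "(\<integral>z. d * z / \<beta> * g z \<partial>gamma_law \<beta> d) = (\<integral>z. g z \<partial>gamma_law (\<beta> + 1) d)"
proof -
  interpret prob_space "gamma_law (\<beta> + 1) d" by (rule prob_space_gamma_law) (use assms in auto)
  have "integrable (gamma_law (\<beta> + 1) d) g"
    using gamma_law_AE_pos[of "\<beta> + 1" d] by (intro integrable_const_bound[of _ B]) (use B in auto)
  then have "integrable lborel (\<lambda>z. gamma_density (\<beta> + 1) d z *\<^sub>R g z)"
    using assms unfolding gamma_law_def by (subst (asm) integrable_density) (auto simp: gamma_density_nonneg)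
  then show "integrable (gamma_law \<beta> d) (\<lambda>z. d * z / \<beta> * g z)"
    using assms unfolding gamma_law_def
    by (subst integrable_density) (auto simp: gamma_density_nonneg gamma_density_Suc mult_ac)
  have "(\<integral>z. d * z / \<beta> * g z \<partial>gamma_law \<beta> d)
      = (\<integral>z. gamma_density \<beta> d z * (d * z / \<beta> * g z) \<partial>lborel)"
    using assms unfolding gamma_law_def by (subst integral_density) (auto simp: gamma_density_nonneg)
  also have "\<dots> = (\<integral>z. gamma_density (\<beta> + 1) d z * g z \<partial>lborel)"
    using assms by (simp add: gamma_density_Suc mult_ac)
  also have "\<dots> = (\<integral>z. g z \<partial>gamma_law (\<beta> + 1) d)"
    using assms unfolding gamma_law_def by (subst integral_density) (auto simp: gamma_density_nonneg)
  finally show "(\<integral>z. d * z / \<beta> * g z \<partial>gamma_law \<beta> d) = (\<integral>z. g z \<partial>gamma_law (\<beta> + 1) d)" .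
qed

text \<open>Chebyshev's association inequality: the density ratio of the two laws is increasing.\<close>

lemma gamma_law_Suc_le:
  fixes g :: "real \<Rightarrow> real"
  assumes "0 < \<beta>" "0 < d" and g[measurable]: "g \<in> borel_measurable borel" and B: "\<And>z. 0 < z \<Longrightarrow> \<bar>g z\<bar> \<le> B"
    and anti: "\<And>x y. 0 < x \<Longrightarrow> x \<le> y \<Longrightarrow> g y \<le> g x"
  shows "(\<integral>z. g z \<partial>gamma_law (\<beta> + 1) d) \<le> (\<integral>z. g z \<partial>gamma_law \<beta> d)"
proof -
  interpret prob_space "gamma_law \<beta> d" by (rule prob_space_gamma_law) (use assms in auto)
  interpret S: prob_space "gamma_law (\<beta> + 1) d" by (rule prob_space_gamma_law) (use assms in auto)
  \<comment> \<open>At the mean the density ratio crosses 1. Subtracting the value of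
    \<open>g\<close> there gives the integrand below a fixed sign at every positive point.\<close>
  let ?\<mu> = "\<beta> / d"
  have i1: "integrable (gamma_law \<beta> d) (\<lambda>z. d * z / \<beta> * g z)"
    "(\<integral>z. d * z / \<beta> * g z \<partial>gamma_law \<beta> d) = (\<integral>z. g z \<partial>gamma_law (\<beta> + 1) d)"
    using gamma_law_Suc[of \<beta> d g B] assms by auto
  have i2: "integrable (gamma_law \<beta> d) (\<lambda>z. d * z / \<beta> * g ?\<mu>)"
    "(\<integral>z. d * z / \<beta> * g ?\<mu> \<partial>gamma_law \<beta> d) = g ?\<mu>"
    using gamma_law_Suc[OF assms(1,2), of "\<lambda>_. g ?\<mu>" "\<bar>g ?\<mu>\<bar>"] S.prob_space by auto
  have i3: "integrable (gamma_law \<beta> d) g"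
    using gamma_law_AE_pos[of \<beta> d] by (intro integrable_const_bound[of _ B]) (use B in auto)
  have "(\<integral>z. (d * z / \<beta> - 1) * (g z - g ?\<mu>) \<partial>gamma_law \<beta> d) \<le> (\<integral>z. 0 \<partial>gamma_law \<beta> d)"
  proof (rule integral_mono_AE)
    show "integrable (gamma_law \<beta> d) (\<lambda>z. (d * z / \<beta> - 1) * (g z - g ?\<mu>))"
      unfolding left_diff_distrib right_diff_distrib
      by (intro Bochner_Integration.integrable_diff i1 i2) (use i3 in auto)
    show "AE z in gamma_law \<beta> d. (d * z / \<beta> - 1) * (g z - g ?\<mu>) \<le> 0"
      using gamma_law_AE_pos
    proof eventually_elim
      case (elim z)
      show ?case
      proof (cases "z \<le> ?\<mu>")
        case True
        then have "d * z / \<beta> - 1 \<le> 0" using assms by (simp add: field_simps)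
        moreover have "0 \<le> g z - g ?\<mu>" using anti[OF elim True] by simp
        ultimately show ?thesis by (rule mult_nonpos_nonneg)
      next
        case False
        then have "0 \<le> d * z / \<beta> - 1" using assms by (simp add: field_simps)
        moreover have "g z - g ?\<mu> \<le> 0" using anti[of ?\<mu> z] False assms by simp
        ultimately show ?thesis by (rule mult_nonneg_nonpos)
      qed
    qed
  qed simp
  also have "(\<integral>z. (d * z / \<beta> - 1) * (g z - g ?\<mu>) \<partial>gamma_law \<beta> d)
      = (\<integral>z. d * z / \<beta> * g z \<partial>gamma_law \<beta> d) - (\<integral>z. d * z / \<beta> * g ?\<mu> \<partial>gamma_law \<beta> d)
        - ((\<integral>z. g z \<partial>gamma_law \<beta> d) - g ?\<mu>)"
  proof -
    have "(\<lambda>z. (d * z / \<beta> - 1) * (g z - g ?\<mu>)) = (\<lambda>z. (d * z / \<beta> * g z - d * z / \<beta> * g ?\<mu>) - (g z - g ?\<mu>))"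
      by (simp add: algebra_simps)
    then show ?thesis using i1(1) i2(1) i3 prob_space by simp
  qed
  finally show ?thesis using i1(2) i2(2) by simp
qed

section \<open>A product bound for permanental vectors\<close>

text \<open>
  A smooth substitute for the indicator of \<open>z < ln N / t\<close>: it is polynomial in \<open>exp (- t * z)\<close>
  without constant term, so that its moments are read off the Laplace transform at positive
  arguments.
\<close>

definition miss :: "real \<Rightarrow> nat \<Rightarrow> real \<Rightarrow> real" where
  "miss t N z = 1 - (1 - exp (- t * z)) ^ N"

definition miss_coeff :: "nat \<Rightarrow> nat \<Rightarrow> real" where
  "miss_coeff N k = - (real (N choose k) * (- 1) ^ k)"

lemma miss_expand: "miss t N z = (\<Sum>k\<in>{1..N}. miss_coeff N k * exp (- (t * real k) * z))"
proof -
  let ?y = "exp (- t * z)"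
  have "(1 - ?y) ^ N = (- ?y + 1) ^ N" by simp
  also have "\<dots> = (\<Sum>k\<le>N. real (N choose k) * (- ?y) ^ k * 1 ^ (N - k))"
    by (rule binomial_ring)
  also have "\<dots> = (\<Sum>k\<in>{0..N}. real (N choose k) * (- ?y) ^ k)"
    by (simp add: atMost_atLeast0)
  also have "\<dots> = 1 + (\<Sum>k\<in>{1..N}. real (N choose k) * (- ?y) ^ k)"
    by (simp add: sum.atLeast_Suc_atMost)
  finally have "miss t N z = (\<Sum>k\<in>{1..N}. - (real (N choose k) * (- ?y) ^ k))"
    by (simp add: miss_def sum_negf)
  also have "\<dots> = (\<Sum>k\<in>{1..N}. miss_coeff N k * exp (- (t * real k) * z))"
  proof (rule sum.cong[OF refl])
    fix k
    have "exp (- (t * real k) * z) = ?y ^ k"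
      by (simp add: exp_of_nat_mult[symmetric] mult_ac)
    then show "- (real (N choose k) * (- ?y) ^ k) = miss_coeff N k * exp (- (t * real k) * z)"
      by (simp only: miss_coeff_def power_minus[of ?y]) simp
  qed
  finally show ?thesis .
qed

lemma miss_measurable [measurable]: "miss t N \<in> borel_measurable borel"
  unfolding miss_def[abs_def] by measurable

lemma miss_bounds:
  assumes "0 \<le> t" "0 \<le> z"
  shows "0 \<le> miss t N z" "miss t N z \<le> 1"
proof -
  have "exp (- t * z) \<le> 1" using assms by simp
  then show "0 \<le> miss t N z" "miss t N z \<le> 1"
    by (auto simp: miss_def power_le_one)
qed

lemma miss_antimono: "0 \<le> t \<Longrightarrow> 0 \<le> x \<Longrightarrow> x \<le> y \<Longrightarrow> miss t N y \<le> miss t N x"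
  unfolding miss_def by (intro diff_left_mono power_mono) (auto intro: mult_left_mono)

definition miss_mean :: "real \<Rightarrow> nat \<Rightarrow> real \<Rightarrow> real \<Rightarrow> real" where
  "miss_mean t N \<beta> d = (\<integral>z. miss t N z \<partial>gamma_law \<beta> d)"

lemma miss_mean_expand:
  assumes "0 < \<beta>" "0 < d" "0 < t"
  shows "(\<Sum>k\<in>{1..N}. miss_coeff N k * (d / (d + t * real k)) powr \<beta>) = miss_mean t N \<beta> d"
proof -
  have "has_bochner_integral (gamma_law \<beta> d)
      (\<lambda>z. \<Sum>k\<in>{1..N}. miss_coeff N k * exp (- (t * real k) * z))
      (\<Sum>k\<in>{1..N}. miss_coeff N k * (d / (d + t * real k)) powr \<beta>)"
    using assms
    by (intro has_bochner_integral_sum has_bochner_integral_mult_right gamma_law_laplace)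
       (auto intro: add_pos_nonneg)
  then show ?thesis
    by (simp add: miss_mean_def miss_expand has_bochner_integral_integral_eq)
qed

lemma integrable_miss:
  assumes "0 < \<beta>" "0 < d" "0 < t"
  shows "integrable (gamma_law \<beta> d) (miss t N)"
proof -
  interpret prob_space "gamma_law \<beta> d" by (rule prob_space_gamma_law[OF assms(1,2)])
  show ?thesis
    using gamma_law_AE_pos[of \<beta> d] miss_bounds[of t] assms
    by (intro integrable_const_bound[of _ 1]) auto
qed

lemma miss_mean_nonneg:
  assumes "0 < \<beta>" "0 < d" "0 < t"
  shows "0 \<le> miss_mean t N \<beta> d"
  unfolding miss_mean_def
  by (rule integral_nonneg_AE)
     (use gamma_law_AE_pos[of \<beta> d] miss_bounds[of t] assms in auto)

lemma miss_mean_add_le: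
  assumes "0 < \<beta>" "0 < d" "0 < t"
  shows "miss_mean t N (\<beta> + real m) d \<le> miss_mean t N \<beta> d"
proof (induction m)
  case (Suc m)
  have "miss_mean t N ((\<beta> + real m) + 1) d \<le> miss_mean t N (\<beta> + real m) d"
    unfolding miss_mean_def
    by (rule gamma_law_Suc_le[where B = 1]) (use assms miss_bounds[of t] miss_antimono in auto)
  then show ?case using Suc by (simp add: add_ac)
qed simp

text \<open>If \<open>\<phi>\<close> is the Laplace transform of a nonnegative random vector, this
  is the mean of the product of \<open>miss (t i) N\<close> over its coordinates, by
  \<open>miss_expand\<close>.\<close>

definition miss_functional :: "nat \<Rightarrow> nat \<Rightarrow> (nat \<Rightarrow> real) \<Rightarrow> ((nat \<Rightarrow> real) \<Rightarrow> real) \<Rightarrow> real" where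
  "miss_functional n N t \<phi> = (\<Sum>g\<in>PiE {..<n} (\<lambda>_. {1..N}).
     (\<Prod>i<n. miss_coeff N (g i)) * \<phi> (\<lambda>i. t i * real (g i)))"

lemma miss_functional_prod:
  "miss_functional n N t (\<lambda>s. \<Prod>i<n. h i (s i))
    = (\<Prod>i<n. \<Sum>k\<in>{1..N}. miss_coeff N k * h i (t i * real k))"
  unfolding miss_functional_def by (subst prod_sum_PiE) (auto simp: prod.distrib)

lemma miss_functional_cong:
  assumes "\<And>s. (\<And>i. i < n \<Longrightarrow> 0 < s i) \<Longrightarrow> \<phi> s = \<phi>' s" "\<And>i. i < n \<Longrightarrow> 0 < t i"
  shows "miss_functional n N t \<phi> = miss_functional n N t \<phi>'"
  unfolding miss_functional_def
proof (intro sum.cong refl arg_cong2[of _ _ _ _ "(*)"] assms(1))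
  fix g i assume "g \<in> PiE {..<n} (\<lambda>_. {1..N})" "i < n"
  then have "1 \<le> g i" by (auto simp: PiE_iff)
  then show "0 < t i * real (g i)" using assms(2)[OF \<open>i < n\<close>] by simp
qed

lemma miss_functional_mult: "miss_functional n N t (\<lambda>s. c * \<phi> s) = c * miss_functional n N t \<phi>"
  by (simp add: miss_functional_def sum_distrib_left mult_ac)

text \<open>
  Each monomial in the mixture raises the shape parameters of independent gamma variables, which
  makes them stochastically larger.
\<close>

lemma miss_functional_gamma_mix:
  assumes "gamma_mix n d \<psi>" and d: "\<And>i. i < n \<Longrightarrow> 0 < d i" and t: "\<And>i. i < n \<Longrightarrow> 0 < t i"
    and \<alpha>: "0 < \<alpha>"
  shows "miss_functional n N t (\<lambda>s. \<psi> s * (\<Prod>i<n. (d i / (d i + s i)) powr \<alpha>))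
    \<le> \<psi> (\<lambda>_. 0) * (\<Prod>i<n. miss_mean (t i) N \<alpha> (d i))"
  using assms(1)
proof induction
  case (monom c m)
  have "miss_functional n N t (\<lambda>s. (c * (\<Prod>i<n. (d i / (d i + s i)) ^ m i)) * (\<Prod>i<n. (d i / (d i + s i)) powr \<alpha>))
      = miss_functional n N t (\<lambda>s. c * (\<Prod>i<n. (d i / (d i + s i)) powr (\<alpha> + real (m i))))"
  proof (rule miss_functional_cong[OF _ t])
    fix s :: "nat \<Rightarrow> real" assume s: "\<And>i. i < n \<Longrightarrow> 0 < s i"
    have "(d i / (d i + s i)) ^ m i * (d i / (d i + s i)) powr \<alpha> = (d i / (d i + s i)) powr (\<alpha> + real (m i))"
      if "i < n" for i
    proof -
      have "0 < d i / (d i + s i)" using d[OF that] s[OF that] by simp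
      then show ?thesis by (simp only: powr_add powr_realpow mult.commute)
    qed
    then show "(c * (\<Prod>i<n. (d i / (d i + s i)) ^ m i)) * (\<Prod>i<n. (d i / (d i + s i)) powr \<alpha>)
        = c * (\<Prod>i<n. (d i / (d i + s i)) powr (\<alpha> + real (m i)))"
      by (simp add: mult.assoc prod.distrib[symmetric])
  qed
  also have "\<dots> = c * (\<Prod>i<n. miss_mean (t i) N (\<alpha> + real (m i)) (d i))"
    unfolding miss_functional_mult
      miss_functional_prod[where h = "\<lambda>i u. (d i / (d i + u)) powr (\<alpha> + real (m i))"]
    using d t \<alpha> by (intro arg_cong2[of _ _ _ _ "(*)"] refl prod.cong miss_mean_expand) auto
  also have "\<dots> \<le> c * (\<Prod>i<n. miss_mean (t i) N \<alpha> (d i))"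
    using monom d t \<alpha>
    by (intro mult_left_mono prod_mono conjI miss_mean_nonneg miss_mean_add_le) auto
  finally have "miss_functional n N t (\<lambda>s. (c * (\<Prod>i<n. (d i / (d i + s i)) ^ m i)) * (\<Prod>i<n. (d i / (d i + s i)) powr \<alpha>))
      \<le> c * (\<Prod>i<n. miss_mean (t i) N \<alpha> (d i))" .
  moreover have "(\<Prod>i<n. (d i / (d i + 0)) ^ m i) = 1" using d by (intro prod.neutral) force
  ultimately show ?case by simp
next
  case (sums g G)
  let ?h = "\<lambda>s. \<Prod>i<n. (d i / (d i + s i)) powr \<alpha>"
  \<comment> \<open>The functional is a finite combination of evaluations, so it commutes with
    pointwise convergent series whatever the signs of its coefficients.\<close>
  have "(\<lambda>k. miss_functional n N t (\<lambda>s. g k s * ?h s)) sums miss_functional n N t (\<lambda>s. G s * ?h s)"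
    unfolding miss_functional_def
  proof (intro sums_sum sums_mult sums_mult2 sums.hyps(2))
    show "0 \<le> t i * real (v i)" if "i < n" for v and i :: nat using t[OF that] by simp
  qed
  moreover have "(\<lambda>k. g k (\<lambda>_. 0) * (\<Prod>i<n. miss_mean (t i) N \<alpha> (d i)))
      sums (G (\<lambda>_. 0) * (\<Prod>i<n. miss_mean (t i) N \<alpha> (d i)))"
    by (intro sums_mult2 sums.hyps(2)) simp
  ultimately show ?case using sums.IH by (rule sums_le[rotated])
qed

text \<open>
  The comparison with independent gamma variables on which the lower bound rests: no coordinate
  exceeding its threshold is at most as likely as if the coordinates were independent.
\<close>

lemma permanental_miss_bound:
  fixes n N :: nat
  assumes Z: "permanental_sequence M \<alpha> K Z" and \<alpha>: "0 < \<alpha>" and \<sigma>: "inj_on \<sigma> {..<n}"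
    and Kb: "\<And>q r. q < n \<Longrightarrow> r < n \<Longrightarrow> (\<Sum>k<n. K (\<sigma> q) (\<sigma> k) * b k r) = (if q = r then 1 else 0)"
    and off: "\<And>q r. q < n \<Longrightarrow> r < n \<Longrightarrow> q \<noteq> r \<Longrightarrow> b q r \<le> 0"
    and row: "\<And>q. q < n \<Longrightarrow> 0 < (\<Sum>r<n. b q r)"
    and d: "\<And>i. i < n \<Longrightarrow> 0 < b i i" and t: "\<And>i. i < n \<Longrightarrow> 0 < t i"
  shows "(\<integral>\<omega>. (\<Prod>i<n. miss (t i) N (Z (\<sigma> i) \<omega>)) \<partial>M) \<le> (\<Prod>i<n. miss_mean (t i) N \<alpha> (b i i))"
proof -
  interpret prob_space M using Z by (simp add: permanental_sequence_def)
  have [measurable]: "Z j \<in> borel_measurable M" for j using Z by (simp add: permanental_sequence_def)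
  have Z_pos: "AE \<omega> in M. \<forall>j. 0 \<le> Z j \<omega>"
    using Z by (simp add: permanental_sequence_def AE_all_countable)
  obtain \<psi> where \<psi>: "gamma_mix n (\<lambda>i. b i i) \<psi>" "0 < \<psi> (\<lambda>_. 0)"
    "\<And>s. (\<And>i. i < n \<Longrightarrow> 0 \<le> s i) \<Longrightarrow>
      Determinant.det (1\<^sub>m n + Matrix.mat n n (\<lambda>(i, j). K (\<sigma> i) (\<sigma> j)) * mat_diag n s) powr (- \<alpha>) * \<psi> (\<lambda>_. 0)
      = \<psi> s * (\<Prod>i<n. (b i i / (b i i + s i)) powr \<alpha>)"
    by (rule permanental_laplace_gamma_mix[of n "\<lambda>i j. K (\<sigma> i) (\<sigma> j)" b \<alpha>, OF Kb off row d \<alpha>]) blast+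
  define \<phi> where "\<phi> s = (\<integral>\<omega>. exp (- (\<Sum>m<n. s m * Z (\<sigma> m) \<omega>)) \<partial>M)" for s
  have \<phi>: "\<phi> s = Determinant.det (1\<^sub>m n + Matrix.mat n n (\<lambda>(i, j). K (\<sigma> i) (\<sigma> j)) * mat_diag n s) powr (- \<alpha>)"
    if "\<And>i. i < n \<Longrightarrow> 0 < s i" for s
    using Z \<sigma> that by (simp add: permanental_sequence_def \<phi>_def Let_def)
  have int: "integrable M (\<lambda>\<omega>. exp (- (\<Sum>m<n. s m * Z (\<sigma> m) \<omega>)))"
    if "\<And>i. i < n \<Longrightarrow> 0 \<le> s i" for s
  proof (rule integrable_const_bound[of _ 1])
    show "AE \<omega> in M. norm (exp (- (\<Sum>m<n. s m * Z (\<sigma> m) \<omega>))) \<le> 1"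
      using Z_pos by eventually_elim (use that in \<open>auto intro!: sum_nonneg\<close>)
  qed measurable
  have "(\<integral>\<omega>. (\<Prod>i<n. miss (t i) N (Z (\<sigma> i) \<omega>)) \<partial>M)
      = (\<integral>\<omega>. (\<Sum>g\<in>PiE {..<n} (\<lambda>_. {1..N}). (\<Prod>i<n. miss_coeff N (g i)) *
          exp (- (\<Sum>m<n. (t m * real (g m)) * Z (\<sigma> m) \<omega>))) \<partial>M)"
    unfolding miss_expand by (subst prod_sum_PiE) (auto simp: prod.distrib exp_sum sum_negf[symmetric])
  also have "\<dots> = (\<Sum>g\<in>PiE {..<n} (\<lambda>_. {1..N}). (\<Prod>i<n. miss_coeff N (g i)) * \<phi> (\<lambda>m. t m * real (g m)))"
    unfolding \<phi>_def
  proof (subst Bochner_Integration.integral_sum)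
    show "integrable M (\<lambda>\<omega>. (\<Prod>i<n. miss_coeff N (g i)) * exp (- (\<Sum>m<n. (t m * real (g m)) * Z (\<sigma> m) \<omega>)))"
      for g :: "nat \<Rightarrow> nat"
      by (intro integrable_mult_right int mult_nonneg_nonneg) (auto intro: less_imp_le t)
  qed simp
  also have "\<dots> = miss_functional n N t \<phi>" by (simp add: miss_functional_def)
  finally have E: "(\<integral>\<omega>. (\<Prod>i<n. miss (t i) N (Z (\<sigma> i) \<omega>)) \<partial>M) = miss_functional n N t \<phi>" .
  have "\<psi> (\<lambda>_. 0) * miss_functional n N t \<phi> = miss_functional n N t (\<lambda>s. \<psi> (\<lambda>_. 0) * \<phi> s)"
    by (rule miss_functional_mult[symmetric])
  also have "\<dots> = miss_functional n N t (\<lambda>s. \<psi> s * (\<Prod>i<n. (b i i / (b i i + s i)) powr \<alpha>))"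
    using \<psi>(3) by (intro miss_functional_cong t) (simp add: \<phi> less_imp_le mult.commute)
  also have "\<dots> \<le> \<psi> (\<lambda>_. 0) * (\<Prod>i<n. miss_mean (t i) N \<alpha> (b i i))"
    by (rule miss_functional_gamma_mix[OF \<psi>(1) d t \<alpha>])
  finally show ?thesis unfolding E using \<psi>(2) by simp
qed

section \<open>Tail estimates\<close>

lemma hit_mean:
  assumes "0 < \<beta>" "0 < d" "0 < t"
  shows "integrable (gamma_law \<beta> d) (\<lambda>z. (1 - exp (- t * z)) ^ N)"
    and "1 - miss_mean t N \<beta> d = (\<integral>z. (1 - exp (- t * z)) ^ N \<partial>gamma_law \<beta> d)"
proof -
  interpret prob_space "gamma_law \<beta> d" by (rule prob_space_gamma_law[OF assms(1,2)])
  have eq: "(\<lambda>z. (1 - exp (- t * z)) ^ N) = (\<lambda>z. 1 - miss t N z)" by (simp add: miss_def)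
  show "integrable (gamma_law \<beta> d) (\<lambda>z. (1 - exp (- t * z)) ^ N)"
    unfolding eq by (intro Bochner_Integration.integrable_diff integrable_miss assms) auto
  show "1 - miss_mean t N \<beta> d = (\<integral>z. (1 - exp (- t * z)) ^ N \<partial>gamma_law \<beta> d)"
    unfolding eq miss_mean_def using integrable_miss[OF assms, of N] by (simp add: prob_space)
qed

lemma half_le_power:
  assumes "0 \<le> y" "real N * y \<le> 1 / 2" "y \<le> 1"
  shows "1 / 2 \<le> (1 - y) ^ N"
  using Bernoulli_inequality[of "- y" N] assms by simp

text \<open>Only \<open>z\<close> between \<open>L / t\<close> and \<open>(L + 1) / t\<close> is
  used. There \<open>exp (- t * z) \<le> 1 / (2 * N)\<close>, so the integrand is at least 1/2 by
  Bernoulli. The assumption on \<open>L\<close> gives \<open>d * z \<ge> 1\<close>, hence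
  \<open>(d * z) powr (\<alpha> - 1) \<ge> 1 / (d * z)\<close> for every positive
  \<open>\<alpha>\<close>.\<close>

lemma hit_mean_ge:
  assumes "0 < \<alpha>" "0 < d" "0 < t" "0 < N"
  defines "L \<equiv> ln (2 * real N)"
  assumes L: "1 \<le> d / t * L"
  shows "exp (- (d / t) * (L + 1)) / (2 * (L + 1) * Gamma \<alpha>) \<le> 1 - miss_mean t N \<alpha> d"
proof -
  have G: "0 < Gamma \<alpha>" using assms by (rule_tac Gamma_real_pos)
  have L0: "0 < L" using assms(4) unfolding L_def by (intro ln_gt_zero) simp
  define c where "c = d * (t / (d * (L + 1))) * exp (- (d / t) * (L + 1)) / Gamma \<alpha>"
  have c: "0 \<le> c" using assms(1-3) G L0 by (simp add: c_def)
  have dens: "c \<le> gamma_density \<alpha> d z" if z: "L / t \<le> z" "z \<le> (L + 1) / t" for z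
  proof -
    have z0: "0 < z" using z(1) L0 assms(3) by (meson divide_pos_pos less_le_trans)
    have dz1: "1 \<le> d * z"
    proof -
      have "d / t * L \<le> d * z" using z(1) assms(2) mult_left_mono[of "L / t" z d] by simp
      then show ?thesis using L by simp
    qed
    have dz2: "d * z \<le> d / t * (L + 1)" using z(2) assms(2) mult_left_mono[of z "(L + 1) / t" d] by simp
    have "t / (d * (L + 1)) = 1 / (d / t * (L + 1))" using assms by (simp add: field_simps)
    also have "\<dots> \<le> 1 / (d * z)" using dz1 dz2 by (intro frac_le) auto
    also have "\<dots> = (d * z) powr (- 1)" using dz1 by (simp add: powr_minus_divide)
    also have "\<dots> \<le> (d * z) powr (\<alpha> - 1)" using dz1 assms(1) by (intro powr_mono) auto
    finally have 1: "t / (d * (L + 1)) \<le> (d * z) powr (\<alpha> - 1)" .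
    have "c \<le> d * (d * z) powr (\<alpha> - 1) * exp (- d * z) / Gamma \<alpha>"
      unfolding c_def using 1 dz2 assms(1-3) G L0
      by (intro divide_right_mono mult_mono) (auto simp: less_imp_le)
    also have "d * (d * z) powr (\<alpha> - 1) = d powr \<alpha> * z powr (\<alpha> - 1)"
      using z0 assms(2) by (simp add: powr_mult powr_diff)
    finally show ?thesis using z0 by (simp add: gamma_density_def)
  qed
  have "exp (- (d / t) * (L + 1)) / (2 * (L + 1) * Gamma \<alpha>) = c / 2 * ((L + 1) / t - L / t)"
  proof -
    have "c = t * (exp (- (d / t) * (L + 1)) / ((L + 1) * Gamma \<alpha>))"
      using assms(2) by (simp add: c_def)
    moreover have "(L + 1) / t - L / t = 1 / t" by (simp add: diff_divide_distrib[symmetric])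
    ultimately show ?thesis using assms(3) by simp
  qed
  also have "\<dots> = (\<integral>z. c / 2 * indicator {L / t..(L + 1) / t} z \<partial>lborel)"
    using assms(3) by (simp add: divide_right_mono)
  also have "\<dots> \<le> (\<integral>z. gamma_density \<alpha> d z * (1 - exp (- t * z)) ^ N \<partial>lborel)"
  proof (rule integral_mono)
    show "integrable lborel (\<lambda>z. c / 2 * indicator {L / t..(L + 1) / t} z :: real)"
      by (intro integrable_mult_right integrable_real_indicator) (auto simp: emeasure_lborel_Icc_eq)
    show "integrable lborel (\<lambda>z. gamma_density \<alpha> d z * (1 - exp (- t * z)) ^ N)"
      using hit_mean(1)[OF assms(1-3), of N] assms(1) unfolding gamma_law_def
      by (subst (asm) integrable_density) (auto simp: gamma_density_nonneg)
    fix z :: real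
    show "c / 2 * indicator {L / t..(L + 1) / t} z \<le> gamma_density \<alpha> d z * (1 - exp (- t * z)) ^ N"
    proof (cases "z \<in> {L / t..(L + 1) / t}")
      case True
      then have "L \<le> t * z" using assms(3) by (simp add: field_simps)
      then have "exp (- t * z) \<le> exp (- L)" by simp
      also have "\<dots> = 1 / (2 * real N)" using assms(4) by (simp add: L_def exp_minus inverse_eq_divide)
      finally have e: "exp (- t * z) \<le> 1 / (2 * real N)" .
      have "1 / 2 \<le> (1 - exp (- t * z)) ^ N"
      proof (rule half_le_power)
        show "real N * exp (- t * z) \<le> 1 / 2"
          using mult_left_mono[OF e, of "real N"] assms(4) by simp
        show "exp (- t * z) \<le> 1" using \<open>L \<le> t * z\<close> L0 by simp
      qed simp
      then have "c * (1 / 2) \<le> gamma_density \<alpha> d z * (1 - exp (- t * z)) ^ N"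
        using dens[of z] True c by (intro mult_mono) auto
      then show ?thesis using True by simp
    next
      case False
      have "0 \<le> gamma_density \<alpha> d z * (1 - exp (- t * z)) ^ N"
      proof (cases "0 < z")
        case True
        then show ?thesis using assms(1,3) by (intro mult_nonneg_nonneg zero_le_power gamma_density_nonneg) auto
      qed (simp add: gamma_density_def)
      then show ?thesis using False by simp
    qed
  qed
  also have "\<dots> = (\<integral>z. (1 - exp (- t * z)) ^ N \<partial>gamma_law \<alpha> d)"
    using assms(1) unfolding gamma_law_def by (subst integral_density) (auto simp: gamma_density_nonneg)
  also have "\<dots> = 1 - miss_mean t N \<alpha> d" by (rule hit_mean(2)[symmetric]) (use assms in auto)
  finally show ?thesis .
qed

text \<open>With \<open>y = exp (- t * z)\<close>, the product of \<open>(1 - y) ^ N\<close> and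
  \<open>(1 + y) ^ N \<ge> N * y\<close> is at most 1, so the integrand is at most
  \<open>exp (t * z) / N\<close>, which has finite mean for \<open>t < d\<close>.\<close>

lemma hit_mean_le:
  assumes "0 < \<alpha>" "0 < t" "t < d" "0 < N"
  shows "1 - miss_mean t N \<alpha> d \<le> (d / (d - t)) powr \<alpha> / real N"
proof -
  have d: "0 < d" using assms by simp
  have h: "has_bochner_integral (gamma_law \<alpha> d) (\<lambda>z. exp (t * z)) ((d / (d - t)) powr \<alpha>)"
    using gamma_law_laplace[of \<alpha> d "- t"] assms by simp
  have "1 - miss_mean t N \<alpha> d = (\<integral>z. (1 - exp (- t * z)) ^ N \<partial>gamma_law \<alpha> d)"
    by (rule hit_mean(2)) (use assms d in auto)
  also have "\<dots> \<le> (\<integral>z. exp (t * z) / real N \<partial>gamma_law \<alpha> d)"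
  proof (rule integral_mono_AE)
    show "integrable (gamma_law \<alpha> d) (\<lambda>z. (1 - exp (- t * z)) ^ N)"
      by (rule hit_mean(1)) (use assms d in auto)
    show "integrable (gamma_law \<alpha> d) (\<lambda>z. exp (t * z) / real N)"
      using h by (simp add: has_bochner_integral_iff)
    show "AE z in gamma_law \<alpha> d. (1 - exp (- t * z)) ^ N \<le> exp (t * z) / real N"
      using gamma_law_AE_pos
    proof eventually_elim
      case (elim z)
      define y where "y = exp (- t * z)"
      have y: "0 < y" "y \<le> 1" using elim assms by (auto simp: y_def)
      have "(1 - y) ^ N * (real N * y) \<le> (1 - y) ^ N * (1 + y) ^ N"
        using Bernoulli_inequality[of y N] y by (intro mult_left_mono) auto
      also have "\<dots> = (1 - y\<^sup>2) ^ N"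
        by (simp add: power_mult_distrib[symmetric] algebra_simps power2_eq_square)
      also have "\<dots> \<le> 1" using y by (intro power_le_one) (auto simp: power_le_one)
      finally have "(1 - y) ^ N \<le> 1 / (real N * y)" using y assms(4) by (simp add: field_simps)
      also have "\<dots> = exp (t * z) / real N" by (simp add: y_def exp_minus field_simps)
      finally show ?case by (simp add: y_def)
    qed
  qed
  also have "\<dots> = (d / (d - t)) powr \<alpha> / real N"
    using h by (simp add: has_bochner_integral_iff)
  finally show ?thesis .
qed

text \<open>Both sides expand by \<open>miss_expand\<close> into the same combination of Laplace
  transforms at positive arguments, so the law of \<open>Z j\<close> itself need not be
  identified.\<close>

lemma permanental_marginal:
  assumes Z: "permanental_sequence M \<alpha> K Z" and \<alpha>: "0 < \<alpha>" and K: "0 < K j j" and t: "0 < t"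
  shows "(\<integral>\<omega>. miss t N (Z j \<omega>) \<partial>M) = miss_mean t N \<alpha> (1 / K j j)"
proof -
  interpret prob_space M using Z by (simp add: permanental_sequence_def)
  have [measurable]: "Z j \<in> borel_measurable M" using Z by (simp add: permanental_sequence_def)
  have Z_pos: "AE \<omega> in M. 0 \<le> Z j \<omega>" using Z by (simp add: permanental_sequence_def)
  have \<phi>: "(\<integral>\<omega>. exp (- s * Z j \<omega>) \<partial>M) = (1 / K j j / (1 / K j j + s)) powr \<alpha>" if s: "0 < s" for s
  proof -
    have det: "Determinant.det (1\<^sub>m 1 + Matrix.mat 1 1 (\<lambda>(p, q). K j j) * mat_diag 1 (\<lambda>_. s)) = 1 + K j j * s"
      by (subst det_single) (auto simp: mat_diag_def scalar_prod_def)
    have "(\<integral>\<omega>. exp (- s * Z j \<omega>) \<partial>M) = (1 + K j j * s) powr (- \<alpha>)"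
      using Z[unfolded permanental_sequence_def, THEN conjunct2, THEN conjunct2, rule_format, of "\<lambda>_. j" 1 "\<lambda>_. s"] s
      by (simp add: Let_def det[unfolded One_nat_def] inj_on_def)
    also have "\<dots> = (1 / (1 + K j j * s)) powr \<alpha>"
      using K s by (simp add: powr_minus_divide powr_divide)
    also have "1 / (1 + K j j * s) = 1 / K j j / (1 / K j j + s)" using K s by (simp add: field_simps)
    finally show ?thesis .
  qed
  have int: "integrable M (\<lambda>\<omega>. exp (- s * Z j \<omega>))" if s: "0 \<le> s" for s
  proof (rule integrable_const_bound[of _ 1])
    show "AE \<omega> in M. norm (exp (- s * Z j \<omega>)) \<le> 1"
      using Z_pos by eventually_elim (use s in auto)
  qed measurable
  have "(\<integral>\<omega>. miss t N (Z j \<omega>) \<partial>M) = (\<Sum>k\<in>{1..N}. miss_coeff N k * (\<integral>\<omega>. exp (- (t * real k) * Z j \<omega>) \<partial>M))"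
    unfolding miss_expand
  proof (subst Bochner_Integration.integral_sum)
    show "integrable M (\<lambda>\<omega>. miss_coeff N k * exp (- (t * real k) * Z j \<omega>))" for k
      using t by (intro integrable_mult_right int) simp
  qed simp
  also have "\<dots> = (\<Sum>k\<in>{1..N}. miss_coeff N k * (1 / K j j / (1 / K j j + t * real k)) powr \<alpha>)"
    using t by (intro sum.cong refl arg_cong2[of _ _ _ _ "(*)"] \<phi>) auto
  also have "\<dots> = miss_mean t N \<alpha> (1 / K j j)" by (rule miss_mean_expand) (use K t \<alpha> in auto)
  finally show ?thesis .
qed

lemma permanental_tail:
  assumes Z: "permanental_sequence M \<alpha> K Z" and \<alpha>: "0 < \<alpha>" and K: "0 < K j j"
    and t: "0 < t" "t * K j j < 1" and a: "4 \<le> exp (t * a)"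
  shows "measure M {\<omega> \<in> space M. a \<le> Z j \<omega>} \<le> 8 * (1 / (1 - t * K j j)) powr \<alpha> * exp (- t * a)"
proof -
  interpret prob_space M using Z by (simp add: permanental_sequence_def)
  have [measurable]: "Z j \<in> borel_measurable M" using Z by (simp add: permanental_sequence_def)
  have Z_pos: "AE \<omega> in M. 0 \<le> Z j \<omega>" using Z by (simp add: permanental_sequence_def)
  \<comment> \<open>Small enough that \<open>a \<le> Z j\<close> forces
    \<open>miss t N (Z j) \<le> 1/2\<close>, and at least \<open>exp (t * a) / 4\<close>. The
    constant 8 is 2 from the value 1/2 times this 4.\<close>
  define N where "N = nat \<lfloor>exp (t * a) / 2\<rfloor>"
  have N: "real N \<le> exp (t * a) / 2" "exp (t * a) / 2 < real N + 1"
    using of_int_floor_le[of "exp (t * a) / 2"] floor_correct[of "exp (t * a) / 2"]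
    by (auto simp: N_def of_nat_nat)
  have N4: "exp (t * a) / 4 \<le> real N" using N(2) a by linarith
  have N0: "0 < N" using N4 a by (cases N) auto
  have "(1 / 2) * measure M {\<omega> \<in> space M. a \<le> Z j \<omega>} = (\<integral>\<omega>. (1 / 2) * indicator {\<omega> \<in> space M. a \<le> Z j \<omega>} \<omega> \<partial>M)"
    by simp
  also have "\<dots> \<le> (\<integral>\<omega>. 1 - miss t N (Z j \<omega>) \<partial>M)"
  proof (rule integral_mono_AE)
    show "integrable M (\<lambda>\<omega>. 1 / 2 * indicator {\<omega> \<in> space M. a \<le> Z j \<omega>} \<omega> :: real)"
      by (intro integrable_mult_right integrable_real_indicator) (auto simp: less_top[symmetric])
    show "integrable M (\<lambda>\<omega>. 1 - miss t N (Z j \<omega>))"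
    proof (rule integrable_const_bound[of _ 1])
      show "AE \<omega> in M. norm (1 - miss t N (Z j \<omega>)) \<le> 1"
        using Z_pos by eventually_elim (use miss_bounds[of t _ N] t in auto)
    qed measurable
    show "AE \<omega> in M. 1 / 2 * indicator {\<omega> \<in> space M. a \<le> Z j \<omega>} \<omega> \<le> 1 - miss t N (Z j \<omega>)"
      using Z_pos
    proof eventually_elim
      case (elim \<omega>)
      show ?case
      proof (cases "a \<le> Z j \<omega>")
        case True
        have "exp (- t * Z j \<omega>) \<le> exp (- (t * a))" using True t by simp
        then have e: "real N * exp (- t * Z j \<omega>) \<le> exp (t * a) / 2 * exp (- (t * a))"
          using N by (intro mult_mono) auto
        have "1 / 2 \<le> (1 - exp (- t * Z j \<omega>)) ^ N"
          by (rule half_le_power) (use e elim t in \<open>auto simp: exp_minus_inverse\<close>)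
        then show ?thesis by (simp add: miss_def indicator_def)
      next
        case False
        then show ?thesis using miss_bounds[of t "Z j \<omega>" N] elim t by simp
      qed
    qed
  qed
  also have "\<dots> = 1 - miss_mean t N \<alpha> (1 / K j j)"
  proof -
    have "integrable M (\<lambda>\<omega>. miss t N (Z j \<omega>))"
    proof (rule integrable_const_bound[of _ 1])
      show "AE \<omega> in M. norm (miss t N (Z j \<omega>)) \<le> 1"
        using Z_pos by eventually_elim (use miss_bounds[of t _ N] t in auto)
    qed measurable
    then show ?thesis using permanental_marginal[of M \<alpha> K Z j t N, OF Z \<alpha> K t(1)] by (simp add: prob_space)
  qed
  also have "\<dots> \<le> (1 / K j j / (1 / K j j - t)) powr \<alpha> / real N"
    by (rule hit_mean_le) (use \<alpha> t K N0 in \<open>auto simp: field_simps\<close>)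
  also have "1 / K j j / (1 / K j j - t) = 1 / (1 - t * K j j)"
    using K t by (simp add: field_simps)
  also have "(1 / (1 - t * K j j)) powr \<alpha> / real N \<le> (1 / (1 - t * K j j)) powr \<alpha> / (exp (t * a) / 4)"
    using N4 N0 by (intro divide_left_mono) auto
  finally show ?thesis by (simp add: exp_minus field_simps)
qed

text \<open>A maximal separated subset: by maximality each point of \<open>V\<close> lies in
  \<open>S\<close> or is joined to a point of \<open>S\<close> by an entry above
  \<open>\<eta>\<close>, and each row has at most \<open>R / \<eta>\<close> such entries.\<close>

lemma large_sparse_subset:
  fixes W :: "nat \<Rightarrow> nat \<Rightarrow> real"
  assumes sym: "\<And>i j. W i j = W j i" and nonneg: "\<And>i j. 0 \<le> W i j"
    and sm: "\<And>i. summable (W i)" "\<And>i. (\<Sum>j. W i j) \<le> R" and \<eta>: "0 < \<eta>" and V: "finite V"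
  obtains S where "S \<subseteq> V" "\<And>i j. i \<in> S \<Longrightarrow> j \<in> S \<Longrightarrow> i \<noteq> j \<Longrightarrow> W i j \<le> \<eta>"
    "real (card V) \<le> real (card S) * (1 + R / \<eta>)"
proof -
  let ?I = "\<lambda>S. S \<subseteq> V \<and> (\<forall>i\<in>S. \<forall>j\<in>S. i \<noteq> j \<longrightarrow> W i j \<le> \<eta>)"
  have fin: "finite {S. ?I S}" by (rule finite_subset[of _ "Pow V"]) (use V in auto)
  have "{} \<in> {S. ?I S}" by simp
  from finite_has_maximal2[OF fin this]
  obtain S where S: "S \<in> {S. ?I S}" and max: "\<forall>T\<in>{S. ?I S}. S \<subseteq> T \<longrightarrow> S = T" by (elim bexE conjE)
  from S have S: "?I S" by (rule CollectD)
  let ?N = "\<lambda>i. insert i {j \<in> V. \<eta> < W i j}"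
  have cover: "V \<subseteq> (\<Union>i\<in>S. ?N i)"
  proof
    fix j assume j: "j \<in> V"
    show "j \<in> (\<Union>i\<in>S. ?N i)"
    proof (rule ccontr)
      assume n: "j \<notin> (\<Union>i\<in>S. ?N i)"
      have "W i j \<le> \<eta>" if "i \<in> S" for i using n that j by auto
      then have "insert j S \<in> {S. ?I S}" using S j sym by auto
      from bspec[OF max this] have "S = insert j S" by blast
      then show False using n by auto
    qed
  qed
  have finS: "finite S" using S V finite_subset by blast
  have "real (card V) \<le> real (card (\<Union>i\<in>S. ?N i))"
    using cover V finS by (intro of_nat_mono card_mono) auto
  also have "\<dots> \<le> real (\<Sum>i\<in>S. card (?N i))"
    using finS by (intro of_nat_mono card_UN_le)
  also have "\<dots> = (\<Sum>i\<in>S. real (card (?N i)))" by simp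
  also have "\<dots> \<le> (\<Sum>i\<in>S. 1 + R / \<eta>)"
  proof (rule sum_mono)
    fix i assume "i \<in> S"
    have "\<eta> * real (card {j \<in> V. \<eta> < W i j}) = (\<Sum>j\<in>{j \<in> V. \<eta> < W i j}. \<eta>)" by simp
    also have "\<dots> \<le> (\<Sum>j\<in>{j \<in> V. \<eta> < W i j}. W i j)" by (intro sum_mono) auto
    also have "\<dots> \<le> (\<Sum>j. W i j)" using V nonneg by (intro sum_le_suminf sm) auto
    finally have "\<eta> * real (card {j \<in> V. \<eta> < W i j}) \<le> R" using sm(2)[of i] by simp
    then have "real (card {j \<in> V. \<eta> < W i j}) \<le> R / \<eta>" using \<eta> by (simp add: field_simps)
    moreover have "card (?N i) \<le> Suc (card {j \<in> V. \<eta> < W i j})" by (rule card_insert_le_m1) auto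
    ultimately show "real (card (?N i)) \<le> 1 + R / \<eta>" by linarith
  qed
  also have "\<dots> = real (card S) * (1 + R / \<eta>)" by simp
  finally show thesis using that S by blast
qed

section \<open>The limit superior\<close>

lemma miss_product_ge:
  fixes x :: real
  assumes "0 \<le> x" "x \<le> 1" "\<And>i. i < n \<Longrightarrow> 1 - x \<le> y i"
  shows "1 - real n * x \<le> (\<Prod>i<n. y i)"
proof -
  have "1 - real n * x \<le> (1 - x) ^ n" using Bernoulli_inequality[of "- x" n] assms by simp
  also have "\<dots> = (\<Prod>i<n. 1 - x)" by simp
  also have "\<dots> \<le> (\<Prod>i<n. y i)" using assms by (intro prod_mono) auto
  finally show ?thesis .
qed

text \<open>The power is at most \<open>exp (- (N powr (1 - \<rho>)))\<close>. The factor
  \<open>N\<close> pays for up to \<open>N\<close> coordinates at once.\<close>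

lemma all_miss_tendsto_0:
  assumes "0 < \<rho>" "\<rho> < (1::real)"
  shows "(\<lambda>N. real N * (1 - exp (- (\<rho> * ln (real N)))) ^ N) \<longlonglongrightarrow> 0"
proof (rule Lim_null_comparison)
  show "(\<lambda>N. real N * exp (- (real N powr (1 - \<rho>)))) \<longlonglongrightarrow> 0"
    using assms by real_asymp
  show "\<forall>\<^sub>F N in sequentially. norm (real N * (1 - exp (- (\<rho> * ln (real N)))) ^ N)
      \<le> real N * exp (- (real N powr (1 - \<rho>)))"
    using eventually_gt_at_top[of 0]
  proof eventually_elim
    case (elim N)
    let ?y = "exp (- (\<rho> * ln (real N)))"
    have y: "?y \<le> 1" using assms elim by simp
    have "(1 - ?y) ^ N \<le> exp (- ?y) ^ N"
      using y exp_ge_add_one_self[of "- ?y"] by (intro power_mono) auto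
    also have "\<dots> = exp (- (real N * ?y))" by (simp add: exp_of_nat_mult[symmetric])
    also have "real N * ?y = real N powr (1 - \<rho>)"
      using elim by (simp add: powr_def exp_diff exp_minus field_simps)
    finally show ?case using y by (simp add: mult_left_mono)
  qed
qed

section \<open>Almost sure upper and lower bounds\<close>

context markov_semigroup begin

text \<open>The diagonal potential is at least the mean holding time, whose reciprocal
  \<open>- Q j j\<close> is at most \<open>C\<close>; the summand 1 keeps the denominator
  positive.\<close>

definition U_floor :: real where "U_floor = 1 / (C + 1)"

lemma U_floor_pos: "0 < U_floor"
  using C_nonneg by (simp add: U_floor_def)

lemma U_diag_ge: "U_floor \<le> U j j"
proof -
  have "Q j j * U j j = (\<Sum>i. if i = j then Q j j * U j j else 0)" by (simp add: suminf_single)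
  also have "\<dots> \<le> (\<Sum>i. Q j i * U i j)"
  proof (rule suminf_le)
    show "(if i = j then Q j j * U j j else 0) \<le> Q j i * U i j" for i
      using Q_off_diag[of j i] U_nonneg by auto
    show "summable (\<lambda>i. if i = j then Q j j * U j j else 0)"
      using sums_summable[OF sums_single[of j "\<lambda>_. Q j j * U j j"]] by simp
    show "summable (\<lambda>i. Q j i * U i j)"
      by (rule summable_Q_mult[where B = mass_bound]) (simp add: U_nonneg U_le)
  qed
  also have "\<dots> = - 1" by (simp add: Q_U)
  finally have "1 \<le> - Q j j * U j j" by simp
  also have "\<dots> \<le> (C + 1) * U j j"
    using Q_abs_le[of j j] U_nonneg by (intro mult_right_mono) auto
  finally show ?thesis using C_nonneg by (simp add: U_floor_def field_simps)
qed

lemma U_diag_pos: "0 < U j j"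
  using U_diag_ge U_floor_pos by (rule less_le_trans[rotated])

text \<open>\<open>permanental_tail\<close> with \<open>t\<close> slightly below the reciprocal of
  the scale \<open>U j j + f j\<close> gives tails of order
  \<open>Suc j powr (- (1 + \<epsilon>))\<close>, which are summable.\<close>

lemma permanental_eventually_less:
  assumes Z: "permanental_sequence M \<alpha> (\<lambda>j k. U j k + f k) Z" and \<alpha>: "0 < \<alpha>"
    and f: "\<And>i. 0 \<le> f i" "f \<longlonglongrightarrow> 0" and \<epsilon>: "0 < \<epsilon>" "\<epsilon> \<le> 1 / 5"
  shows "AE \<omega> in M. \<forall>\<^sub>F j in sequentially. Z j \<omega> < (1 + 4 * \<epsilon>) * (U j j * ln (real (Suc j)))"
proof -
  interpret prob_space M using Z by (simp add: permanental_sequence_def)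
  have [measurable]: "Z j \<in> borel_measurable M" for j using Z by (simp add: permanental_sequence_def)
  let ?a = "\<lambda>j. (1 + 4 * \<epsilon>) * (U j j * ln (real (Suc j)))"
  let ?A = "\<lambda>j. {\<omega> \<in> space M. ?a j \<le> Z j \<omega>}"
  let ?c = "8 * (1 / \<epsilon>) powr \<alpha>"
  have "\<forall>\<^sub>F j in sequentially. f j < \<epsilon> * U_floor"
    using order_tendstoD(2)[OF f(2), of "\<epsilon> * U_floor"] \<epsilon> U_floor_pos by simp
  then have ev: "\<forall>\<^sub>F j in sequentially. measure M (?A j) \<le> ?c * real (Suc j) powr (- (1 + \<epsilon>))"
    using eventually_ge_at_top[of 3]
  proof eventually_elim
    case (elim j)
    define K where "K = U j j + f j"
    define t where "t = (1 - \<epsilon>) / K"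
    define l where "l = ln (real (Suc j))"
    have K: "0 < K" using U_diag_pos[of j] f(1)[of j] by (simp add: K_def)
    have t: "0 < t" "t * K = 1 - \<epsilon>" using K \<epsilon> by (auto simp: t_def)
    have l: "ln 4 \<le> l" "0 \<le> l" using elim by (auto simp: l_def)
    have ta: "(1 + \<epsilon>) * l \<le> t * ?a j"
    proof -
      have "K \<le> (1 + \<epsilon>) * U j j"
      proof -
        have "\<epsilon> * U_floor \<le> \<epsilon> * U j j" using U_diag_ge \<epsilon> by (intro mult_left_mono) auto
        then show ?thesis using elim(1) by (simp add: K_def algebra_simps)
      qed
      then have "(1 + \<epsilon>) * K \<le> (1 + \<epsilon>) * ((1 + \<epsilon>) * U j j)" using \<epsilon> by (intro mult_left_mono) auto
      also have "\<dots> = ((1 + \<epsilon>) * (1 + \<epsilon>)) * U j j" by simp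
      \<comment> \<open>The factor \<open>1 + 4 * \<epsilon>\<close> must cover three losses:
        \<open>K\<close> against \<open>U j j\<close>, \<open>t\<close> against
        \<open>1 / K\<close>, and the exponent of the tail. The inequality amounts to
        \<open>5 * \<epsilon> * \<epsilon> \<le> \<epsilon>\<close>, whence the limit
        \<open>1 / 5\<close>.\<close>
      also have "\<dots> \<le> ((1 - \<epsilon>) * (1 + 4 * \<epsilon>)) * U j j"
      proof (rule mult_right_mono)
        have "\<epsilon> * \<epsilon> \<le> \<epsilon> * (1 / 5)" using \<epsilon> by (intro mult_left_mono) auto
        then show "(1 + \<epsilon>) * (1 + \<epsilon>) \<le> (1 - \<epsilon>) * (1 + 4 * \<epsilon>)" by (simp add: algebra_simps)
      qed (rule U_nonneg)
      finally have "1 + \<epsilon> \<le> (1 - \<epsilon>) * (1 + 4 * \<epsilon>) * U j j / K" using K by (simp add: pos_le_divide_eq)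
      then have "(1 + \<epsilon>) * l \<le> (1 - \<epsilon>) * (1 + 4 * \<epsilon>) * U j j / K * l" using l by (intro mult_right_mono)
      then show ?thesis by (simp add: t_def l_def mult_ac)
    qed
    have "ln 4 \<le> (1 + \<epsilon>) * l" using l \<epsilon> by (simp add: algebra_simps add_increasing2)
    then have "exp (ln 4) \<le> exp (t * ?a j)" using ta by (intro iffD2[OF exp_le_cancel_iff]) linarith
    then have four: "4 \<le> exp (t * ?a j)" by simp
    have "measure M (?A j) \<le> 8 * (1 / (1 - t * K)) powr \<alpha> * exp (- t * ?a j)"
      using permanental_tail[of M \<alpha> "\<lambda>j k. U j k + f k" Z j t "?a j"] Z \<alpha> K t \<epsilon> four
      by (simp add: K_def)
    also have "1 - t * K = \<epsilon>" using t by simp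
    also have "?c * exp (- t * ?a j) \<le> ?c * exp (- ((1 + \<epsilon>) * l))"
      using ta by (intro mult_left_mono) auto
    also have "exp (- ((1 + \<epsilon>) * l)) = real (Suc j) powr (- (1 + \<epsilon>))"
      by (simp add: powr_def l_def del: minus_add_distrib)
    finally show ?case .
  qed
  have "summable (\<lambda>j. measure M (?A j))"
  proof (rule summable_comparison_test_ev)
    show "\<forall>\<^sub>F j in sequentially. norm (measure M (?A j)) \<le> ?c * real (Suc j) powr (- (1 + \<epsilon>))"
      using ev by simp
    have "summable (\<lambda>n. real n powr (- (1 + \<epsilon>)))" using \<epsilon> by (simp add: summable_real_powr_iff)
    then show "summable (\<lambda>j. ?c * real (Suc j) powr (- (1 + \<epsilon>)))"
      by (intro summable_mult) (subst summable_Suc_iff)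
  qed
  then have "AE \<omega> in M. \<forall>\<^sub>F j in sequentially. \<omega> \<in> space M - ?A j"
    by (intro borel_cantelli_AE1) (auto simp: less_top[symmetric])
  then show ?thesis
    by eventually_elim (auto elim!: eventually_mono simp: not_le)
qed

text \<open>For every \<open>N\<close> the event forces all selected coordinates below
  \<open>N\<close> to stay low. Each independent comparison variable escapes with probability at
  least \<open>q N\<close>, of order \<open>N powr (- \<theta>) / ln N\<close>, and a positive
  proportion of \<open>N\<close> coordinates is available.\<close>

lemma permanental_small_null:
  assumes Z: "permanental_sequence M \<alpha> (\<lambda>j k. U j k + f k) Z" and \<alpha>: "0 < \<alpha>"
    and f: "\<And>i. 0 \<le> f i" "\<And>i. \<bar>f i\<bar> \<le> B" "\<And>j. (\<Sum>i. Q j i * f i) \<le> 0"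
    and \<epsilon>: "0 < \<epsilon>" "\<epsilon> < 1"
  shows "measure M {\<omega> \<in> space M. \<forall>j\<ge>N0. Z j \<omega> \<le> (1 - \<epsilon>) * (U j j * ln (real (Suc j)))} = 0"
proof -
  interpret prob_space M using Z by (simp add: permanental_sequence_def)
  have [measurable]: "Z j \<in> borel_measurable M" for j using Z by (simp add: permanental_sequence_def)
  have Z_pos: "AE \<omega> in M. \<forall>j. 0 \<le> Z j \<omega>"
    using Z by (simp add: permanental_sequence_def AE_all_countable)
  let ?A = "{\<omega> \<in> space M. \<forall>j\<ge>N0. Z j \<omega> \<le> (1 - \<epsilon>) * (U j j * ln (real (Suc j)))}"
  \<comment> \<open>Relative to \<open>U i i\<close> there are three scales:
    \<open>1 - \<epsilon>\<close> in the event, \<open>1 - \<epsilon> / 2\<close> in the smoothing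
    parameter \<open>t i\<close>, and \<open>1 - \<epsilon> / 4\<close> as lower bound for
    \<open>U i i - \<eta>\<close>. Their consecutive ratios are \<open>\<rho>\<close> and
    \<open>\<theta>\<close>, both below 1. The lower bound \<open>\<theta>0\<close> of
    \<open>b i i / t i\<close> serves the assumption on \<open>L\<close> in
    \<open>hit_mean_ge\<close>.\<close>
  define \<eta> where "\<eta> = \<epsilon> / 4 * U_floor"
  define D where "D = 1 + mass_bound / \<eta>"
  define \<theta> where "\<theta> = (1 - \<epsilon> / 2) / (1 - \<epsilon> / 4)"
  define \<rho> where "\<rho> = (1 - \<epsilon>) / (1 - \<epsilon> / 2)"
  define \<theta>0 where "\<theta>0 = (1 - \<epsilon> / 2) * (U_floor / (mass_bound + B))"
  define L where "L N = ln (2 * real N)" for N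
  define x where "x N = (1 - exp (- (\<rho> * ln (real N)))) ^ N" for N :: nat
  define q where "q N = exp (- \<theta> * (L N + 1)) / (2 * (L N + 1) * Gamma \<alpha>)" for N
  have G: "0 < Gamma \<alpha>" using \<alpha> by (rule Gamma_real_pos)
  have \<eta>: "0 < \<eta>" using \<epsilon> U_floor_pos by (simp add: \<eta>_def)
  have D: "0 < D" using \<eta> mass_bound_pos by (simp add: D_def add_pos_pos)
  have \<theta>: "0 < \<theta>" "\<theta> < 1" using \<epsilon> by (auto simp: \<theta>_def)
  have \<rho>: "0 < \<rho>" "\<rho> < 1" using \<epsilon> by (auto simp: \<rho>_def)
  have B: "0 \<le> B" using f(2)[of 0] by linarith
  have \<theta>0: "0 < \<theta>0" using \<epsilon> U_floor_pos mass_bound_pos B by (simp add: \<theta>0_def add_pos_nonneg)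
  have main: "measure M ?A * (1 - real N * x N) \<le> exp (- (q N * ((real N - real N0) / D)))"
    if N: "0 < N" "N0 \<le> N" "1 \<le> \<theta>0 * L N" for N
  proof -
    obtain S where S: "S \<subseteq> {N0..<N}" "\<And>i j. i \<in> S \<Longrightarrow> j \<in> S \<Longrightarrow> i \<noteq> j \<Longrightarrow> U i j \<le> \<eta>"
      "real (card {N0..<N}) \<le> real (card S) * (1 + mass_bound / \<eta>)"
      by (rule large_sparse_subset[of U mass_bound \<eta> "{N0..<N}"])
        (use U_sym U_nonneg U_summable U_sum_le \<eta> in auto)
    have finS: "finite S" using S(1) finite_subset by blast
    define n where "n = card S"
    obtain \<sigma> where \<sigma>: "bij_betw \<sigma> {..<n} S"
      using ex_bij_betw_nat_finite[OF finS] by (auto simp: n_def lessThan_atLeast0)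
    have inj: "inj_on \<sigma> {..<n}" using \<sigma> by (rule bij_betw_imp_inj_on)
    have \<sigma>S: "\<sigma> i \<in> S" if "i < n" for i using \<sigma> that by (auto simp: bij_betw_def)
    have nN: "n \<le> N"
    proof -
      have "card S \<le> card {N0..<N}" using S(1) by (intro card_mono) auto
      then show ?thesis by (simp add: n_def)
    qed
    have n_ge: "(real N - real N0) / D \<le> real n"
      using S(3) N(2) D by (simp add: D_def n_def pos_divide_le_eq of_nat_diff)
    have sep: "U (\<sigma> i) (\<sigma> j) \<le> \<eta>" if "i < n" "j < n" "i \<noteq> j" for i j
      using S(2)[OF \<sigma>S \<sigma>S] that inj by (auto simp: inj_on_def)
    obtain b where
      Kb: "\<And>q r. q < n \<Longrightarrow> r < n \<Longrightarrow>
        (\<Sum>s<n. (U (\<sigma> q) (\<sigma> s) + f (\<sigma> s)) * b s r) = (if q = r then 1 else 0)" and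
      off: "\<And>q r. q < n \<Longrightarrow> r < n \<Longrightarrow> q \<noteq> r \<Longrightarrow> b q r \<le> 0" and
      row: "\<And>q. q < n \<Longrightarrow> 0 < (\<Sum>r<n. b q r)" and
      diag: "\<And>q. q < n \<Longrightarrow> b q q * (U (\<sigma> q) (\<sigma> q) - \<eta>) \<le> 1" and
      ge: "\<And>q. q < n \<Longrightarrow> 1 \<le> b q q * (U (\<sigma> q) (\<sigma> q) + f (\<sigma> q))"
      by (rule permanental_kernel_inverse[OF inj f less_imp_le[OF \<eta>] sep]) blast+
    define t where "t i = 1 / ((1 - \<epsilon> / 2) * U (\<sigma> i) (\<sigma> i))" for i
    have t: "0 < t i" for i using U_diag_pos \<epsilon> by (simp add: t_def)
    have Kpos: "0 < U (\<sigma> i) (\<sigma> i) + f (\<sigma> i)" for i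
      using U_diag_pos[of "\<sigma> i"] f(1)[of "\<sigma> i"] by simp
    have b_pos: "0 < b i i" if "i < n" for i
    proof -
      have "0 < b i i * (U (\<sigma> i) (\<sigma> i) + f (\<sigma> i))" using ge[OF that] by linarith
      then show ?thesis using Kpos by (rule zero_less_mult_pos2)
    qed
    have \<theta>_le: "b i i / t i \<le> \<theta>" if i: "i < n" for i
    proof -
      have "U_floor * (\<epsilon> / 4) \<le> U (\<sigma> i) (\<sigma> i) * (\<epsilon> / 4)"
        using U_diag_ge \<epsilon> by (intro mult_right_mono) auto
      then have "(1 - \<epsilon> / 4) * U (\<sigma> i) (\<sigma> i) \<le> U (\<sigma> i) (\<sigma> i) - \<eta>"
        by (simp add: \<eta>_def algebra_simps)
      then have "b i i * ((1 - \<epsilon> / 4) * U (\<sigma> i) (\<sigma> i)) \<le> b i i * (U (\<sigma> i) (\<sigma> i) - \<eta>)"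
        using b_pos[OF i] by (intro mult_left_mono) auto
      also have "\<dots> \<le> 1" by (rule diag[OF i])
      finally have "b i i * U (\<sigma> i) (\<sigma> i) \<le> 1 / (1 - \<epsilon> / 4)" using \<epsilon> by (simp add: field_simps)
      then have "(1 - \<epsilon> / 2) * (b i i * U (\<sigma> i) (\<sigma> i)) \<le> (1 - \<epsilon> / 2) * (1 / (1 - \<epsilon> / 4))"
        using \<epsilon> by (intro mult_left_mono) auto
      then show ?thesis by (simp add: t_def \<theta>_def mult_ac)
    qed
    have \<theta>_ge: "\<theta>0 \<le> b i i / t i" if i: "i < n" for i
    proof -
      have "U_floor / (mass_bound + B) \<le> U (\<sigma> i) (\<sigma> i) / (U (\<sigma> i) (\<sigma> i) + f (\<sigma> i))"
        using U_diag_ge U_le[of "\<sigma> i" "\<sigma> i"] f(2)[of "\<sigma> i"] Kpos[of i] U_nonneg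
        by (intro frac_le) auto
      also have "\<dots> \<le> b i i * U (\<sigma> i) (\<sigma> i)"
        using mult_right_mono[OF ge[OF i] U_nonneg[of "\<sigma> i" "\<sigma> i"]] Kpos[of i]
        by (simp add: pos_divide_le_eq mult_ac)
      finally have "(1 - \<epsilon> / 2) * (U_floor / (mass_bound + B)) \<le> (1 - \<epsilon> / 2) * (b i i * U (\<sigma> i) (\<sigma> i))"
        using \<epsilon> by (intro mult_left_mono) auto
      then show ?thesis by (simp add: t_def \<theta>0_def mult_ac)
    qed
    have L0: "0 < L N" using N(1) unfolding L_def by (intro ln_gt_zero) simp
    have mm: "miss_mean (t i) N \<alpha> (b i i) \<le> 1 - q N" if i: "i < n" for i
    proof -
      have "1 \<le> b i i / t i * L N"
        using N(3) mult_right_mono[OF \<theta>_ge[OF i] less_imp_le[OF L0]] by linarith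
      then have "exp (- (b i i / t i) * (L N + 1)) / (2 * (L N + 1) * Gamma \<alpha>) \<le> 1 - miss_mean (t i) N \<alpha> (b i i)"
        unfolding L_def by (intro hit_mean_ge \<alpha> b_pos[OF i] t N(1))
      moreover have "q N \<le> exp (- (b i i / t i) * (L N + 1)) / (2 * (L N + 1) * Gamma \<alpha>)"
        unfolding q_def using \<theta>_le[OF i] L0 G
        by (intro divide_right_mono iffD2[OF exp_le_cancel_iff] mult_right_mono) auto
      ultimately show ?thesis by linarith
    qed
    have q0: "0 \<le> q N" using L0 G by (simp add: q_def)
    have x: "0 \<le> x N" "x N \<le> 1" using \<rho> N(1) unfolding x_def
      by (auto intro!: zero_le_power power_le_one)
    have int: "integrable M (\<lambda>\<omega>. \<Prod>i<n. miss (t i) N (Z (\<sigma> i) \<omega>))"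
    proof (rule integrable_const_bound[of _ 1])
      show "AE \<omega> in M. norm (\<Prod>i<n. miss (t i) N (Z (\<sigma> i) \<omega>)) \<le> 1"
        using Z_pos
      proof eventually_elim
        case (elim \<omega>)
        have "0 \<le> miss (t i) N (Z (\<sigma> i) \<omega>)" "miss (t i) N (Z (\<sigma> i) \<omega>) \<le> 1" for i
          using miss_bounds[of "t i" "Z (\<sigma> i) \<omega>" N] t elim by (auto simp: less_imp_le)
        then show ?case by (simp add: prod_nonneg prod_le_1)
      qed
    qed measurable
    \<comment> \<open>A Markov-type inequality: the product of smoothed indicators is nonnegative,
      and on the event it is at least \<open>1 - real N * x N\<close>.\<close>
    have "measure M ?A * (1 - real N * x N) = (\<integral>\<omega>. (1 - real N * x N) * indicator ?A \<omega> \<partial>M)"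
      by (simp add: mult.commute)
    also have "\<dots> \<le> (\<integral>\<omega>. (\<Prod>i<n. miss (t i) N (Z (\<sigma> i) \<omega>)) \<partial>M)"
    proof (rule integral_mono_AE[OF _ int])
      show "integrable M (\<lambda>\<omega>. (1 - real N * x N) * indicator ?A \<omega>)"
        by (intro integrable_mult_right integrable_real_indicator) (auto simp: less_top[symmetric])
      show "AE \<omega> in M. (1 - real N * x N) * indicator ?A \<omega> \<le> (\<Prod>i<n. miss (t i) N (Z (\<sigma> i) \<omega>))"
        using Z_pos
      proof eventually_elim
        case (elim \<omega>)
        show ?case
        proof (cases "\<omega> \<in> ?A")
          case True
          have "1 - x N \<le> miss (t i) N (Z (\<sigma> i) \<omega>)" if i: "i < n" for i
          proof -
            have j: "N0 \<le> \<sigma> i" "\<sigma> i < N" using \<sigma>S[OF i] S(1) by auto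
            then have "Z (\<sigma> i) \<omega> \<le> (1 - \<epsilon>) * (U (\<sigma> i) (\<sigma> i) * ln (real (Suc (\<sigma> i))))"
              using True by simp
            also have "\<dots> \<le> (1 - \<epsilon>) * (U (\<sigma> i) (\<sigma> i) * ln (real N))"
              using j \<epsilon> U_nonneg by (intro mult_left_mono) auto
            finally have "t i * Z (\<sigma> i) \<omega> \<le> t i * ((1 - \<epsilon>) * (U (\<sigma> i) (\<sigma> i) * ln (real N)))"
              using t[of i] by (intro mult_left_mono) auto
            also have "\<dots> = \<rho> * ln (real N)"
              using U_diag_pos[of "\<sigma> i"] by (simp add: t_def \<rho>_def)
            finally have "1 - exp (- t i * Z (\<sigma> i) \<omega>) \<le> 1 - exp (- (\<rho> * ln (real N)))" by simp
            then have "(1 - exp (- t i * Z (\<sigma> i) \<omega>)) ^ N \<le> x N"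
              unfolding x_def using elim t[of i] by (intro power_mono) auto
            then show ?thesis by (simp add: miss_def)
          qed
          then have "1 - real n * x N \<le> (\<Prod>i<n. miss (t i) N (Z (\<sigma> i) \<omega>))"
            by (rule miss_product_ge[OF x])
          moreover have "real n * x N \<le> real N * x N" using nN x by (intro mult_right_mono) auto
          ultimately show ?thesis using True by simp
        next
          case False
          have "0 \<le> miss (t i) N (Z (\<sigma> i) \<omega>)" for i
            using miss_bounds[of "t i" "Z (\<sigma> i) \<omega>" N] t elim by (auto simp: less_imp_le)
          then show ?thesis using False by (simp add: prod_nonneg)
        qed
      qed
    qed
    also have "\<dots> \<le> (\<Prod>i<n. miss_mean (t i) N \<alpha> (b i i))"
      by (rule permanental_miss_bound[OF Z \<alpha> inj Kb off row b_pos t])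
    also have "\<dots> \<le> (\<Prod>i<n. 1 - q N)"
      using mm miss_mean_nonneg[OF \<alpha> b_pos t] by (intro prod_mono) auto
    also have "\<dots> = (1 - q N) ^ n" by simp
    also have "\<dots> \<le> exp (- q N) ^ n"
    proof (cases "n = 0")
      case False
      then have "0 \<le> 1 - q N"
        using mm[of 0] miss_mean_nonneg[OF \<alpha> b_pos[of 0] t[of 0], of N] by linarith
      then show ?thesis using exp_ge_add_one_self[of "- q N"] by (intro power_mono) auto
    qed simp
    also have "\<dots> = exp (- (q N * real n))" by (simp add: exp_of_nat_mult[symmetric] mult.commute)
    also have "\<dots> \<le> exp (- (q N * ((real N - real N0) / D)))"
      using mult_left_mono[OF n_ge q0] by simp
    finally show ?thesis .
  qed
  have lim1: "(\<lambda>N. measure M ?A * (1 - real N * x N)) \<longlonglongrightarrow> measure M ?A * (1 - 0)"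
    unfolding x_def by (intro tendsto_intros all_miss_tendsto_0 \<rho>)
  have lim2: "(\<lambda>N. exp (- (q N * ((real N - real N0) / D)))) \<longlonglongrightarrow> 0"
  proof -
    \<comment> \<open>Writing \<open>\<theta>\<close> as \<open>1 - \<kappa>'\<close> displays the
      gain: the exponent grows like \<open>N powr \<kappa>' / ln N\<close>.\<close>
    have "(\<lambda>N. exp (- (c * exp (- (1 - \<kappa>') * (ln (2 * real N) + 1))
        / (ln (2 * real N) + 1) * (real N - real N0)))) \<longlonglongrightarrow> 0"
      if "0 < c" "0 < \<kappa>'" for c \<kappa>' :: real
      using that by real_asymp
    from this[of "1 / (2 * Gamma \<alpha> * D)" "1 - \<theta>"]
    have "(\<lambda>N. exp (- (1 / (2 * Gamma \<alpha> * D) * exp (- (1 - (1 - \<theta>)) * (ln (2 * real N) + 1))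
        / (ln (2 * real N) + 1) * (real N - real N0)))) \<longlonglongrightarrow> 0"
      using \<theta> G D by simp
    then show ?thesis by (simp add: q_def L_def mult_ac)
  qed
  have "filterlim (\<lambda>N. \<theta>0 * ln (2 * real N)) at_top sequentially" using \<theta>0 by real_asymp
  then have "\<forall>\<^sub>F N in sequentially. 1 \<le> \<theta>0 * L N" unfolding L_def by (simp add: filterlim_at_top)
  then have "\<forall>\<^sub>F N in sequentially. measure M ?A * (1 - real N * x N) \<le> exp (- (q N * ((real N - real N0) / D)))"
    using eventually_gt_at_top[of 0] eventually_ge_at_top[of N0]
    by eventually_elim (rule main)
  then have "measure M ?A * (1 - 0) \<le> 0"
    by (rule tendsto_le[OF trivial_limit_sequentially lim2 lim1])
  then show ?thesis by (simp add: measure_le_0_iff)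
qed

end

section \<open>Assembly of the limit superior, and potentials vanishing at infinity\<close>

context markov_semigroup begin

lemma permanental_limsup:
  assumes Z: "permanental_sequence M \<alpha> (\<lambda>j k. U j k + f k) Z" and \<alpha>: "0 < \<alpha>"
    and f: "\<And>i. 0 \<le> f i" "f \<longlonglongrightarrow> 0" "\<And>j. (\<Sum>i. Q j i * f i) \<le> 0"
  shows "AE \<omega> in M. limsup (\<lambda>n. ereal (Z n \<omega> / (U n n * ln (real (Suc n))))) = 1"
proof -
  interpret prob_space M using Z by (simp add: permanental_sequence_def)
  have [measurable]: "Z j \<in> borel_measurable M" for j using Z by (simp add: permanental_sequence_def)
  obtain B where B: "\<And>i. \<bar>f i\<bar> \<le> B"
    using convergent_imp_bounded[OF f(2)] by (auto simp: bounded_iff)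
  \<comment> \<open>A countable family tending to 0, so that the exceptional null sets can be
    united; the 5 keeps it within the range of the upper bound.\<close>
  define \<epsilon> where "\<epsilon> k = 1 / (real k + 5)" for k :: nat
  have \<epsilon>: "0 < \<epsilon> k" "\<epsilon> k \<le> 1 / 5" for k by (auto simp: \<epsilon>_def frac_le)
  \<comment> \<open>Index 0 stands for the integer 1, whose logarithm is 0, and is left out.\<close>
  have scale: "0 < U n n * ln (real (Suc n))" if "1 \<le> n" for n
    using U_diag_pos[of n] that by (intro mult_pos_pos ln_gt_zero) auto
  have "AE \<omega> in M. \<forall>k. \<forall>\<^sub>F j in sequentially. Z j \<omega> < (1 + 4 * \<epsilon> k) * (U j j * ln (real (Suc j)))"
    unfolding AE_all_countable using permanental_eventually_less[OF Z \<alpha> f(1,2) \<epsilon>] by blast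
  moreover have "AE \<omega> in M. \<forall>k N. \<not> (\<forall>j\<ge>N. Z j \<omega> \<le> (1 - \<epsilon> k) * (U j j * ln (real (Suc j))))"
    unfolding AE_all_countable
  proof (intro allI)
    fix k N
    have "\<epsilon> k < 1" using \<epsilon>(2)[of k] by linarith
    from permanental_small_null[OF Z \<alpha> f(1) B f(3) \<epsilon>(1) this, of N]
    show "AE \<omega> in M. \<not> (\<forall>j\<ge>N. Z j \<omega> \<le> (1 - \<epsilon> k) * (U j j * ln (real (Suc j))))"
      by (intro AE_I[of _ _ "{\<omega> \<in> space M. \<forall>j\<ge>N. Z j \<omega> \<le> (1 - \<epsilon> k) * (U j j * ln (real (Suc j)))}"])
         (auto simp: emeasure_eq_measure)
  qed
  ultimately show ?thesis
  proof eventually_elim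
    case (elim \<omega>)
    let ?X = "\<lambda>n. ereal (Z n \<omega> / (U n n * ln (real (Suc n))))"
    have \<epsilon>_lim: "(\<lambda>k. c * \<epsilon> k) \<longlonglongrightarrow> 0" for c unfolding \<epsilon>_def by real_asymp
    have up: "limsup ?X \<le> ereal (1 + 4 * \<epsilon> k)" for k
    proof (rule Limsup_bounded)
      show "\<forall>\<^sub>F n in sequentially. ?X n \<le> ereal (1 + 4 * \<epsilon> k)"
        using elim(1)[rule_format, of k] eventually_ge_at_top[of 1]
      proof eventually_elim
        case (elim n)
        then show ?case using scale[of n] by (simp add: pos_divide_le_eq less_imp_le del: of_nat_Suc)
      qed
    qed
    have low: "ereal (1 - \<epsilon> k) \<le> limsup ?X" for k
    proof (rule ccontr)
      assume "\<not> ereal (1 - \<epsilon> k) \<le> limsup ?X"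
      then have "limsup ?X < ereal (1 - \<epsilon> k)" by simp
      from Limsup_lessD[OF this]
      have "\<forall>\<^sub>F n in sequentially. Z n \<omega> \<le> (1 - \<epsilon> k) * (U n n * ln (real (Suc n)))"
        using eventually_ge_at_top[of 1]
      proof eventually_elim
        case (elim n)
        then show ?case using scale[of n] by (simp add: pos_divide_less_eq less_imp_le del: of_nat_Suc)
      qed
      then show False using elim(2) by (auto simp: eventually_sequentially)
    qed
    have "(\<lambda>k. ereal (1 + 4 * \<epsilon> k)) \<longlonglongrightarrow> ereal (1 + 0)"
      by (intro tendsto_intros \<epsilon>_lim)
    then have "limsup ?X \<le> ereal (1 + 0)" by (rule LIMSEQ_le_const) (use up in blast)
    moreover have "(\<lambda>k. ereal (1 - 1 * \<epsilon> k)) \<longlonglongrightarrow> ereal (1 - 0)"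
      by (intro tendsto_intros \<epsilon>_lim)
    then have "ereal (1 - 0) \<le> limsup ?X" by (rule LIMSEQ_le_const2) (use low in auto)
    ultimately show ?case by (simp add: one_ereal_def)
  qed
qed

text \<open>Beyond some \<open>K\<close> the density \<open>h\<close> is small and contributes at
  most \<open>mass_bound\<close> times its bound; the finitely many remaining columns of
  \<open>U\<close> vanish at infinity.\<close>

lemma potential_tendsto_0:
  assumes h: "\<And>k. 0 \<le> h k" "h \<longlonglongrightarrow> 0" and f: "\<And>j. (\<lambda>k. U j k * h k) sums f j"
  shows "f \<longlonglongrightarrow> 0"
proof (rule order_tendstoI)
  fix e :: real assume "e < 0"
  moreover have "0 \<le> f j" for j
    using sums_le[OF _ sums_zero f] U_nonneg h(1) by simp
  ultimately show "\<forall>\<^sub>F j in sequentially. e < f j" by (intro always_eventually) (auto intro: less_le_trans)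
next
  fix e :: real assume e: "0 < e"
  define d where "d = e / (2 * mass_bound)"
  have d: "0 < d" using e mass_bound_pos by (simp add: d_def)
  from order_tendstoD(2)[OF h(2) d] obtain K where K: "\<And>k. K \<le> k \<Longrightarrow> h k < d"
    by (auto simp: eventually_sequentially)
  have le: "f j \<le> (\<Sum>k<K. U j k * h k) + mass_bound * d" for j
  proof -
    have s: "(\<lambda>k. (if k < K then U j k * h k else 0) + U j k * d) sums
        ((\<Sum>k<K. U j k * h k) + (\<Sum>k. U j k) * d)"
      using sums_If_finite_set[of "{..<K}" "\<lambda>k. U j k * h k"]
      by (intro sums_add sums_mult2 summable_sums U_summable) simp
    have "f j \<le> (\<Sum>k<K. U j k * h k) + (\<Sum>k. U j k) * d"
    proof (rule sums_le[OF _ f s])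
      fix k
      show "U j k * h k \<le> (if k < K then U j k * h k else 0) + U j k * d"
        using K[of k] d U_nonneg[of j k] by (auto intro!: mult_left_mono)
    qed
    also have "(\<Sum>k. U j k) * d \<le> mass_bound * d" using U_sum_le d by (intro mult_right_mono) auto
    finally show ?thesis by simp
  qed
  have "(\<lambda>j. \<Sum>k<K. U j k * h k) \<longlonglongrightarrow> 0"
    by (intro tendsto_null_sum tendsto_mult_left_zero U_tendsto_0)
  from order_tendstoD(2)[OF this, of "e / 2"] e
  have "\<forall>\<^sub>F j in sequentially. (\<Sum>k<K. U j k * h k) < e / 2" by simp
  then show "\<forall>\<^sub>F j in sequentially. f j < e"
  proof eventually_elim
    case (elim j)
    have "mass_bound * d = e / 2" using mass_bound_pos by (simp add: d_def)
    then show ?case using le[of j] elim by linarith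
  qed
qed

text \<open>From row \<open>I + m\<close> on, the band meets only values of \<open>f\<close> with
  index at least \<open>I\<close>, and row sums of absolute values are at most
  \<open>C\<close>.\<close>

lemma multidiagonal_Q_tendsto_0:
  assumes Q: "multidiagonal m Q" and f: "f \<longlonglongrightarrow> 0"
  shows "(\<lambda>k. \<Sum>i. Q k i * f i) \<longlonglongrightarrow> 0"
proof (rule LIMSEQ_I)
  fix e :: real assume e: "0 < e"
  define d where "d = e / (C + 1)"
  have d: "0 < d" using e C_nonneg by (simp add: d_def)
  obtain I where I: "\<And>i. I \<le> i \<Longrightarrow> \<bar>f i\<bar> < d" using LIMSEQ_D[OF f d] by auto
  obtain B where B: "\<And>i. \<bar>f i\<bar> \<le> B"
    using convergent_imp_bounded[OF f] by (auto simp: bounded_iff)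
  have "norm ((\<Sum>i. Q k i * f i) - 0) < e" if k: "I + m \<le> k" for k
  proof -
    have "\<bar>Q k i * f i\<bar> \<le> \<bar>Q k i\<bar> * d" for i
    proof (cases "I \<le> i")
      case True then show ?thesis using I[of i] by (simp add: abs_mult mult_left_mono)
    next
      case False
      then have "int m < \<bar>int i - int k\<bar>" using k by linarith
      then have "Q k i = 0" using Q by (simp add: multidiagonal_def)
      then show ?thesis by simp
    qed
    then have "(\<Sum>i. \<bar>Q k i * f i\<bar>) \<le> (\<Sum>i. \<bar>Q k i\<bar> * d)"
      by (intro suminf_le summable_Q_mult(1)[OF B] summable_mult2 Q_summable)
    also have "\<dots> = (\<Sum>i. \<bar>Q k i\<bar>) * d" by (rule suminf_mult2[OF Q_summable, symmetric])
    also have "\<dots> \<le> C * d" using d Q_bound by (intro mult_right_mono) auto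
    also have "\<dots> < e" using e C_nonneg by (simp add: d_def field_simps)
    finally show ?thesis using summable_rabs[of "\<lambda>i. Q k i * f i"] summable_Q_mult(1)[of f B k] B by simp
  qed
  then show "\<exists>N. \<forall>k\<ge>N. norm ((\<Sum>i. Q k i * f i) - 0) < e" by blast
qed

end

section \<open>From the process to its semigroup\<close>

text \<open>The strong Markov property at the constant time \<open>s\<close> with the whole space as
  event. Absorption at the cemetery ensures that a path in \<open>k\<close> at time
  \<open>s + t\<close> is in some state \<open>i\<close> at time \<open>s\<close>.\<close>

lemma transition_CK:
  assumes X: "borel_right_process X" and st: "0 \<le> s" "0 \<le> t"
  shows "(\<lambda>i. transition X s j i * transition X t i k) sums transition X (s + t) j k"
proof -
  let ?\<Omega> = "space (base X)"
  interpret prob_space "law X j" using X by (simp add: borel_right_process_def)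
  have sets: "sets (law X j) = sets (base X)" using X by (simp add: borel_right_process_def)
  have [measurable]: "state X s \<in> base X \<rightarrow>\<^sub>M count_space UNIV"
    "state X (s + t) \<in> base X \<rightarrow>\<^sub>M count_space UNIV"
    using X st by (simp_all add: borel_right_process_def)
  have all: "?\<Omega> \<in> past X u" for u
    using sigma_sets_top by (auto simp: past_def)
  have none: "{} \<in> past X u" for u by (auto simp: past_def intro: sigma_sets.Empty)
  have "{\<omega> \<in> ?\<Omega>. ennreal s < ennreal u} \<in> past X u" for u
    by (cases "ennreal s < ennreal u") (use all none in auto)
  then have opt: "optional_time X (\<lambda>_. ennreal s)" and pa: "?\<Omega> \<in> past_at X (\<lambda>_. ennreal s)"
    unfolding optional_time_def past_at_def by blast+
  let ?E = "\<lambda>i. {\<omega> \<in> ?\<Omega>. state X s \<omega> = Some i \<and> state X (s + t) \<omega> = Some k}"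
  have "measure (law X j) (?E i) = transition X s j i * transition X t i k" for i
  proof -
    have "strong_markov X" using X by (simp add: borel_right_process_def)
    from this[unfolded strong_markov_def, rule_format, OF opt pa st(2), of j i k]
    show ?thesis using st by (simp add: transition_def)
  qed
  moreover have "(\<lambda>i. measure (law X j) (?E i)) sums measure (law X j) (\<Union>i. ?E i)"
  proof (rule finite_measure_UNION)
    have "?E i \<in> sets (base X)" for i by measurable
    then show "range ?E \<subseteq> sets (law X j)" by (auto simp: sets)
    show "disjoint_family ?E" by (auto simp: disjoint_family_on_def)
  qed
  moreover have "(\<Union>i. ?E i) = {\<omega> \<in> ?\<Omega>. state X (s + t) \<omega> = Some k}"
  proof -
    have absorbed: "\<forall>\<omega>\<in>?\<Omega>. \<forall>s t. 0 \<le> s \<longrightarrow> s \<le> t \<longrightarrow> state X s \<omega> = None \<longrightarrow> state X t \<omega> = None"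
      using X by (simp add: borel_right_process_def)
    have "state X s \<omega> \<noteq> None" if "\<omega> \<in> ?\<Omega>" "state X (s + t) \<omega> = Some k" for \<omega>
    proof
      assume "state X s \<omega> = None"
      then have "state X (s + t) \<omega> = None"
        using absorbed[rule_format, OF that(1) st(1), of "s + t"] st by simp
      then show False using that(2) by simp
    qed
    then show ?thesis by auto
  qed
  ultimately show ?thesis by (simp add: transition_def)
qed

lemma transition_sums:
  assumes X: "borel_right_process X" and t: "0 \<le> t"
  shows "summable (transition X t j)" "(\<Sum>k. transition X t j k) \<le> 1"
proof -
  interpret prob_space "law X j" using X by (simp add: borel_right_process_def)
  have sets: "sets (law X j) = sets (base X)" using X by (simp add: borel_right_process_def)
  have [measurable]: "state X t \<in> base X \<rightarrow>\<^sub>M count_space UNIV"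
    using X t by (simp add: borel_right_process_def)
  let ?E = "\<lambda>k. {\<omega> \<in> space (base X). state X t \<omega> = Some k}"
  have "(\<lambda>k. measure (law X j) (?E k)) sums measure (law X j) (\<Union>k. ?E k)"
  proof (rule finite_measure_UNION)
    have "?E k \<in> sets (base X)" for k by measurable
    then show "range ?E \<subseteq> sets (law X j)" by (auto simp: sets)
    show "disjoint_family ?E" by (auto simp: disjoint_family_on_def)
  qed
  then have "transition X t j sums measure (law X j) (\<Union>k. ?E k)"
    by (simp add: transition_def[abs_def])
  then show "summable (transition X t j)" "(\<Sum>k. transition X t j k) \<le> 1"
    by (auto simp: sums_iff)
qed

lemma transition_zero:
  assumes X: "borel_right_process X"
  shows "transition X 0 j k = (if j = k then 1 else 0)"
proof -
  interpret prob_space "law X j" using X by (simp add: borel_right_process_def)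
  have sets: "sets (law X j) = sets (base X)" using X by (simp add: borel_right_process_def)
  then have sp: "space (law X j) = space (base X)" by (rule sets_eq_imp_space_eq)
  have [measurable]: "state X 0 \<in> base X \<rightarrow>\<^sub>M count_space UNIV"
    using X by (simp add: borel_right_process_def)
  have m: "{\<omega> \<in> space (base X). state X 0 \<omega> = Some k} \<in> sets (law X j)"
    unfolding sets by measurable
  have start: "AE \<omega> in law X j. state X 0 \<omega> = Some j"
    using X by (simp add: borel_right_process_def)
  show ?thesis
  proof (cases "j = k")
    case True
    then have k: "k = j" by simp
    show ?thesis using start m prob_Collect_eq_1[of "\<lambda>\<omega>. state X 0 \<omega> = Some j"]
      unfolding k by (simp add: transition_def sp)
  next
    case False
    have "AE \<omega> in law X j. \<not> state X 0 \<omega> = Some k"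
      using start by eventually_elim (use False in simp)
    then show ?thesis using m False prob_Collect_eq_0[of "\<lambda>\<omega>. state X 0 \<omega> = Some k"]
      by (simp add: transition_def sp)
  qed
qed

lemma process_markov_semigroup:
  assumes "borel_right_process X" "symmetric_process X" "uniform_markov_chain X"
    and Q: "is_Q_matrix X Q" and "row_sums_bounded_away Q"
  obtains C \<delta> where "markov_semigroup (transition X) Q C \<delta>"
proof -
  obtain Q' where Q': "is_Q_matrix X Q'" "matrix_sup_norm Q' < \<infinity>"
    using assms(3) by (auto simp: uniform_markov_chain_def)
  \<comment> \<open>Uniformity supplies a norm bound for some \<open>Q'\<close>; uniqueness of the
    one-sided derivative transfers it to the given \<open>Q\<close>.\<close>
  have "Q' = Q"
  proof (intro ext)
    fix j k
    show "Q' j k = Q j k"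
      by (rule has_field_derivative_unique[of "\<lambda>t. transition X t j k" _ 0 "{0..}"])
         (use Q Q'(1) in \<open>auto simp: is_Q_matrix_def at_within_Ici_at_right\<close>)
  qed
  with Q'(2) have norm: "matrix_sup_norm Q < \<infinity>" by blast
  define C where "C = enn2real (matrix_sup_norm Q)"
  have C: "(\<Sum>k. ennreal \<bar>Q j k\<bar>) \<le> ennreal C" for j
  proof -
    have "(\<Sum>k. ennreal \<bar>Q j k\<bar>) \<le> matrix_sup_norm Q"
      unfolding matrix_sup_norm_def by (rule SUP_upper) simp
    also have "\<dots> = ennreal C" unfolding C_def by (rule ennreal_enn2real[symmetric]) (use norm in simp)
    finally show ?thesis .
  qed
  have sm: "summable (\<lambda>k. \<bar>Q j k\<bar>)" for j
    using C[of j] by (intro summable_suminf_not_top) (auto simp: top_unique)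
  have bd: "(\<Sum>k. \<bar>Q j k\<bar>) \<le> C" for j
  proof -
    have "ennreal (\<Sum>k. \<bar>Q j k\<bar>) \<le> ennreal C" using C[of j] sm by (simp add: suminf_ennreal2)
    then show ?thesis by (simp add: C_def)
  qed
  obtain \<delta> where \<delta>: "0 < \<delta>" "\<And>j. (\<Sum>k. Q j k) \<le> - \<delta>"
    using assms(5) by (auto simp: row_sums_bounded_away_def)
  have "markov_semigroup (transition X) Q C \<delta>"
  proof
    show "((\<lambda>t. transition X t j k) has_real_derivative Q j k) (at 0 within {0..})" for j k
      using Q by (simp add: is_Q_matrix_def)
    show "transition X t j k = transition X t k j" if "0 \<le> t" for t j k
      using assms(2) that by (simp add: symmetric_process_def)
    show "0 \<le> transition X t j k" for t j k
      by (simp add: transition_def)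
  qed (rule assms(1) transition_zero transition_sums transition_CK sm bd \<delta> | assumption)+
  then show thesis by (rule that)
qed

text \<open>Monotonicity in time together with the limit at 0 gives \<open>P_t f \<le> f\<close>,
  which becomes a bound for the generator through \<open>Q_excessive\<close>.\<close>

lemma excessive_imp_Q_le_0:
  assumes "markov_semigroup (transition X) Q C \<delta>"
    and f: "\<And>i. 0 \<le> f i" "\<And>i. \<bar>f i\<bar> \<le> B" and ex: "excessive X (\<lambda>k. ennreal (f k))"
  shows "(\<Sum>i. Q j i * f i) \<le> 0"
proof -
  interpret markov_semigroup "transition X" Q C \<delta> by fact
  show ?thesis
  proof (rule Q_excessive[OF f(2)])
    fix t :: real assume t: "0 < t"
    let ?P = "\<lambda>t. semigroup_op X t (\<lambda>k. ennreal (f k)) j"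
    have anti: "antimono_on {0<..} ?P" and lim: "(?P \<longlongrightarrow> ennreal (f j)) (at_right 0)"
      using ex by (auto simp: excessive_def)
    have "\<forall>\<^sub>F s in at_right 0. ?P t \<le> ?P s"
      using eventually_at_right_real[OF t]
    proof eventually_elim
      case (elim s)
      then show ?case using monotone_onD[OF anti, of s t] t by simp
    qed
    then have "?P t \<le> ennreal (f j)"
      by (intro tendsto_lowerbound[OF lim]) auto
    moreover have "?P t = ennreal (\<Sum>i. transition X t j i * f i)"
      using t f summable_p_mult[of t f B j]
      by (simp add: semigroup_op_def ennreal_mult[symmetric] nonneg suminf_ennreal2)
    ultimately show "(\<Sum>i. transition X t j i * f i) \<le> f j" using f(1) by simp
  qed
qed

theorem theorem1p5:
  fixes X :: "'w process"
    and Q U :: "nat \<Rightarrow> nat \<Rightarrow> real"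
    and f :: "nat \<Rightarrow> real"
    and \<alpha> :: real
    and M :: "'b measure"
    and Z :: "nat \<Rightarrow> 'b \<Rightarrow> real"
  assumes "borel_right_process X"
    and "symmetric_process X"
    and "transient X"
    and U: "U = potential_density X"
    and "\<forall>j k. 0 < U j k"
    and "uniform_markov_chain X"
    and Q: "is_Q_matrix X Q"
    and "\<forall>k. 0 \<le> f k"
    and "excessive X (\<lambda>k. ennreal (f k))"
    and "0 < \<alpha>"
    and "row_sums_bounded_away Q"
  shows "(permanental_sequence M \<alpha> (\<lambda>j k. U j k + f k) Z \<and> f \<in> c0_plus \<longrightarrow>
            (AE \<omega> in M. limsup (\<lambda>n. ereal (Z n \<omega> / (U n n * ln (real (Suc n))))) = 1))
       \<and> ((\<exists>k\<ge>1. multidiagonal k Q) \<longrightarrow>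
            (f \<in> c0_plus \<longleftrightarrow> (\<exists>h\<in>c0_plus. \<forall>j. (\<lambda>k. U j k * h k) sums f j)))"
proof -
  obtain C \<delta> where S: "markov_semigroup (transition X) Q C \<delta>"
    using process_markov_semigroup[OF assms(1,2,6) Q assms(11)] .
  interpret markov_semigroup "transition X" Q C \<delta> by (rule S)
  \<comment> \<open>The variable \<open>U\<close> of the theorem hides the constant of the same name
    in the locale; the two are identified here.\<close>
  have U_eq: "U = markov_semigroup.U (transition X)"
    by (intro ext) (simp add: assms(4) potential_density_def potential_def U_def V_def)
  have f_nonneg: "0 \<le> f k" for k using assms(8) by simp
  have bounded: "\<exists>B. \<forall>i. \<bar>f i\<bar> \<le> B" and Q_f: "\<And>j. (\<Sum>i. Q j i * f i) \<le> 0" if "f \<longlonglongrightarrow> 0"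
  proof -
    show "\<exists>B. \<forall>i. \<bar>f i\<bar> \<le> B"
      using convergent_imp_bounded[OF that] by (auto simp: bounded_iff)
    then show "(\<Sum>i. Q j i * f i) \<le> 0" for j
      using excessive_imp_Q_le_0[OF S f_nonneg _ assms(9)] by blast
  qed
  show ?thesis
  proof (intro conjI impI)
    assume "permanental_sequence M \<alpha> (\<lambda>j k. U j k + f k) Z \<and> f \<in> c0_plus"
    then show "AE \<omega> in M. limsup (\<lambda>n. ereal (Z n \<omega> / (U n n * ln (real (Suc n))))) = 1"
      unfolding U_eq using assms(10) f_nonneg Q_f
      by (intro permanental_limsup) (auto simp: c0_plus_def)
  next
    assume "\<exists>k\<ge>1. multidiagonal k Q"
    then obtain m where m: "multidiagonal m Q" by blast
    show "f \<in> c0_plus \<longleftrightarrow> (\<exists>h\<in>c0_plus. \<forall>j. (\<lambda>k. U j k * h k) sums f j)"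
    proof
      assume "f \<in> c0_plus"
      then have f: "f \<longlonglongrightarrow> 0" by (simp add: c0_plus_def)
      obtain B where B: "\<And>i. \<bar>f i\<bar> \<le> B" using bounded[OF f] by blast
      have "(\<lambda>k. - (\<Sum>i. Q k i * f i)) \<longlonglongrightarrow> - 0"
        by (intro tendsto_minus multidiagonal_Q_tendsto_0[OF m f])
      then have "(\<lambda>k. - (\<Sum>i. Q k i * f i)) \<in> c0_plus"
        using Q_f[OF f] by (simp add: c0_plus_def)
      moreover have "(\<lambda>k. U j k * - (\<Sum>i. Q k i * f i)) sums f j" for j
        unfolding U_eq by (rule potential_of_minus_Q[OF B])
      ultimately show "\<exists>h\<in>c0_plus. \<forall>j. (\<lambda>k. U j k * h k) sums f j"
        by (intro bexI[of _ "\<lambda>k. - (\<Sum>i. Q k i * f i)"] allI)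
    next
      assume "\<exists>h\<in>c0_plus. \<forall>j. (\<lambda>k. U j k * h k) sums f j"
      then obtain h where h: "h \<in> c0_plus" "\<And>j. (\<lambda>k. U j k * h k) sums f j" by blast
      have "f \<longlonglongrightarrow> 0"
        by (rule potential_tendsto_0[of h]) (use h in \<open>auto simp: c0_plus_def U_eq\<close>)
      then show "f \<in> c0_plus" using f_nonneg by (simp add: c0_plus_def)
    qed
  qed
qed

end
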